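(* Let $\alpha>0$ and $1<p,q<\infty$, and let $C$ denote the set of all Toeplitz operators $T_\varphi:F_\alpha^p\to F_\alpha^q$ with continuous, compactly supported symbols $\varphi$ on $\mathbb{C}$. Then: (1) $C$ is dense in $\mathcal{N}(F_\alpha^p,F_\alpha^q)$ with respect to the nuclear norm. (2) $C$ is norm-dense in $\mathcal{K}(F_\alpha^p,F_\alpha^q)$.
   Context: Let $dA$ be Lebesgue area measure on $\mathbb{C}$. For $1\le p<\infty$, $F_\alpha^p$ is the Banach space of entire functions $f$ with $\|f\|_{\alpha,p}^p=\frac{p\alpha}{2\pi}\int_{\mathbb{C}}|f(z)e^{-\frac{\alpha}{2}|z|^2}|^p\,dA(z)<\infty$. For a bounded, compactly supported measurable $\varphi$, the Toeplitz operator is $T_\varphi f(z)=\int_{\mathbb{C}}e^{\alpha z\overline{w}}\varphi(w)f(w)\,d\lambda_\alpha(w)$, where $d\lambda_\alpha(w)=\frac{\alpha}{\pi}e^{-\alpha|w|^2}dA(w)$. $\mathcal{K}(X,Y)$ is the space of compact linear operators from $X$ to $Y$ with the operator norm. For Banach spaces $X,Y$, $\mathcal{N}(X,Y)$ is the set of bounded linear $T:X\to Y$ of the form $Tx=\sum_{j\ge1}x_j'(x)y_j$ with $x_j'\in X'$, $y_j\in Y$, $\sum_j\|x_j'\|_{X'}\|y_j\|_Y<\infty$; the nuclear norm $\|T\|_{\mathcal N}$ is the infimum of $\sum_j\|x_j'\|\|y_j\|$ over all such representations. *)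

theory Defs
  imports "HOL-Analysis.Analysis"
begin

text \<open>
  The exponents and the weight are real parameters, so the spaces cannot be types of a normed
  type class. A space is given by the set of its points and its norm; its points are
  complex-valued functions with pointwise linear structure. The values of the norm
  outside the set of points play no role.
\<close>

record 'a fun_space =
  points :: "('a \<Rightarrow> complex) set"
  nrm :: "('a \<Rightarrow> complex) \<Rightarrow> real"

definition unit_cball :: "'a fun_space \<Rightarrow> ('a \<Rightarrow> complex) set" where
  "unit_cball X = {f \<in> points X. nrm X f \<le> 1}"

definition norm_topology :: "'a fun_space \<Rightarrow> ('a \<Rightarrow> complex) topology" where
  "norm_topology X = Metric_space.mtopology (points X) (\<lambda>f g. nrm X (\<lambda>z. f z - g z))"

text \<open>
  Operators and functionals are extensional (\<^term>\<open>undefined\<close> off the points of the domain), so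
  that equality is equality of maps on the domain.
\<close>

definition linear_ops ::
    "'a fun_space \<Rightarrow> 'b fun_space \<Rightarrow> (('a \<Rightarrow> complex) \<Rightarrow> 'b \<Rightarrow> complex) set" where
  "linear_ops X Y = {T \<in> points X \<rightarrow>\<^sub>E points Y.
     (\<forall>f\<in>points X. \<forall>g\<in>points X. T (\<lambda>z. f z + g z) = (\<lambda>z. T f z + T g z)) \<and>
     (\<forall>c. \<forall>f\<in>points X. T (\<lambda>z. c * f z) = (\<lambda>z. c * T f z))}"

definition bounded_ops ::
    "'a fun_space \<Rightarrow> 'b fun_space \<Rightarrow> (('a \<Rightarrow> complex) \<Rightarrow> 'b \<Rightarrow> complex) set" where
  "bounded_ops X Y =
     {T \<in> linear_ops X Y. \<exists>B. \<forall>f\<in>points X. nrm Y (T f) \<le> B * nrm X f}"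

definition op_norm ::
    "'a fun_space \<Rightarrow> 'b fun_space \<Rightarrow> (('a \<Rightarrow> complex) \<Rightarrow> 'b \<Rightarrow> complex) \<Rightarrow> real" where
  "op_norm X Y T = (SUP f\<in>unit_cball X. nrm Y (T f))"

definition op_diff ::
    "'a fun_space \<Rightarrow> (('a \<Rightarrow> complex) \<Rightarrow> 'b \<Rightarrow> complex) \<Rightarrow> (('a \<Rightarrow> complex) \<Rightarrow> 'b \<Rightarrow> complex)
      \<Rightarrow> ('a \<Rightarrow> complex) \<Rightarrow> 'b \<Rightarrow> complex" where
  "op_diff X S T = (\<lambda>f\<in>points X. \<lambda>z. S f z - T f z)"

definition compact_ops ::
    "'a fun_space \<Rightarrow> 'b fun_space \<Rightarrow> (('a \<Rightarrow> complex) \<Rightarrow> 'b \<Rightarrow> complex) set" where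
  "compact_ops X Y = {T \<in> linear_ops X Y.
     compactin (norm_topology Y) (norm_topology Y closure_of (T ` unit_cball X))}"

definition dual :: "'a fun_space \<Rightarrow> (('a \<Rightarrow> complex) \<Rightarrow> complex) set" where
  "dual X = {l \<in> extensional (points X).
     (\<forall>f\<in>points X. \<forall>g\<in>points X. l (\<lambda>z. f z + g z) = l f + l g) \<and>
     (\<forall>c. \<forall>f\<in>points X. l (\<lambda>z. c * f z) = c * l f) \<and>
     (\<exists>B. \<forall>f\<in>points X. cmod (l f) \<le> B * nrm X f)}"

definition dual_norm :: "'a fun_space \<Rightarrow> (('a \<Rightarrow> complex) \<Rightarrow> complex) \<Rightarrow> real" where
  "dual_norm X l = (SUP f\<in>unit_cball X. cmod (l f))"

text \<open>
  The representations of \<open>T\<close> as a nuclear sum; the series for \<open>T f\<close> converges in the norm of \<open>Y\<close>.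
\<close>

definition nuclear_reps ::
    "'a fun_space \<Rightarrow> 'b fun_space \<Rightarrow> (('a \<Rightarrow> complex) \<Rightarrow> 'b \<Rightarrow> complex)
      \<Rightarrow> ((nat \<Rightarrow> ('a \<Rightarrow> complex) \<Rightarrow> complex) \<times> (nat \<Rightarrow> 'b \<Rightarrow> complex)) set" where
  "nuclear_reps X Y T = {(l, y).
     (\<forall>j. l j \<in> dual X \<and> y j \<in> points Y) \<and>
     summable (\<lambda>j. dual_norm X (l j) * nrm Y (y j)) \<and>
     (\<forall>f\<in>points X. (\<lambda>n. nrm Y (\<lambda>z. T f z - (\<Sum>j<n. l j f * y j z))) \<longlonglongrightarrow> 0)}"

definition nuclear_ops ::
    "'a fun_space \<Rightarrow> 'b fun_space \<Rightarrow> (('a \<Rightarrow> complex) \<Rightarrow> 'b \<Rightarrow> complex) set" where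
  "nuclear_ops X Y = {T \<in> bounded_ops X Y. nuclear_reps X Y T \<noteq> {}}"

definition nuclear_norm ::
    "'a fun_space \<Rightarrow> 'b fun_space \<Rightarrow> (('a \<Rightarrow> complex) \<Rightarrow> 'b \<Rightarrow> complex) \<Rightarrow> real" where
  "nuclear_norm X Y T =
     (INF (l, y)\<in>nuclear_reps X Y T. \<Sum>j. dual_norm X (l j) * nrm Y (y j))"

definition dense_in :: "'t set \<Rightarrow> ('t \<Rightarrow> 't \<Rightarrow> real) \<Rightarrow> 't set \<Rightarrow> bool" where
  "dense_in M d C \<longleftrightarrow> C \<subseteq> M \<and> (\<forall>T\<in>M. \<forall>\<epsilon>>0. \<exists>S\<in>C. d T S < \<epsilon>)"

definition fock :: "real \<Rightarrow> real \<Rightarrow> complex fun_space" where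
  "fock \<alpha> p =
     \<lparr>points = {f. f holomorphic_on UNIV \<and>
        integrable lborel (\<lambda>z. cmod (f z * exp (- (\<alpha> / 2) * (cmod z)\<^sup>2)) powr p)},
      nrm = (\<lambda>f. (p * \<alpha> / (2 * pi) *
        (LINT z|lborel. cmod (f z * exp (- (\<alpha> / 2) * (cmod z)\<^sup>2)) powr p)) powr (1 / p))\<rparr>"

definition gauss_measure :: "real \<Rightarrow> complex measure" where
  "gauss_measure \<alpha> = density lborel (\<lambda>w. ennreal (\<alpha> / pi * exp (- \<alpha> * (cmod w)\<^sup>2)))"

definition toeplitz ::
    "real \<Rightarrow> (complex \<Rightarrow> complex) \<Rightarrow> (complex \<Rightarrow> complex) \<Rightarrow> complex \<Rightarrow> complex" where
  "toeplitz \<alpha> \<phi> f z = (LINT w|gauss_measure \<alpha>. exp (\<alpha> * z * cnj w) * \<phi> w * f w)"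

text \<open>
  The Toeplitz operators on \<^term>\<open>fock \<alpha> p\<close> with continuous, compactly supported symbol. That
  they map into \<^term>\<open>fock \<alpha> q\<close> is part of the inclusion in \<^const>\<open>dense_in\<close>.
\<close>

definition toeplitz_cc ::
    "real \<Rightarrow> real \<Rightarrow> ((complex \<Rightarrow> complex) \<Rightarrow> complex \<Rightarrow> complex) set" where
  "toeplitz_cc \<alpha> p = {restrict (toeplitz \<alpha> \<phi>) (points (fock \<alpha> p)) | \<phi>.
     continuous_on UNIV \<phi> \<and> compact (closure {w. \<phi> w \<noteq> 0})}"

end

theory Submission
  imports Defs "HOL-Complex_Analysis.Complex_Analysis" "HOL-Probability.Distributions"
begin

text \<open>
  Write \<open>X\<close> and \<open>Y\<close> for the two Fock spaces, \<open>c\<^sub>i\<close> for the \<open>i\<close>-th Taylor coefficient at \<open>0\<close>, and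
  \<open>l \<otimes> y\<close> for the operator \<open>f \<mapsto> l(f) y\<close>. Trace duality and the injectivity of the Berezin
  transform would give the density by a Hahn-Banach argument. The proof below constructs the
  approximations instead, in the closure \<open>E\<close> of the Toeplitz operators for the nuclear norm.

  Every \<open>c\<^sub>i \<otimes> z\<^sup>k\<close> lies in \<open>E\<close> (\<open>matrix_unit_in_closure\<close>). A symbol
  \<open>exp(\<alpha>|w|\<^sup>2) cnj w\<^sup>i w\<^sup>k \<eta>(|w|)\<close> cancels the Gaussian, and by orthogonality of the monomials its
  Toeplitz operator is a combination of the \<open>c\<^bsub>i+j\<^esub> \<otimes> z\<^bsup>k+j\<^esup>\<close>, whose coefficients are radial moments of
  \<open>\<eta>\<close>. When \<open>\<eta>\<close> concentrates at \<open>0\<close>, normalised so that the moment for \<open>j = 0\<close> is \<open>1\<close>, the terms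
  with \<open>j > 0\<close> vanish in nuclear norm; those with \<open>j < 0\<close> lie in \<open>E\<close> by induction on \<open>k\<close>.

  Polynomials are dense in \<open>Y\<close>, and the functionals \<open>c\<^sub>i\<close> span a norm-dense subspace of the dual of
  \<open>X\<close>, so all \<open>l \<otimes> y\<close> and hence all nuclear operators belong to \<open>E\<close> (\<open>nuclear_closure_rank_one\<close>,
  \<open>nuclear_closure_all\<close>). Both density statements come from the dilations \<open>(dil r f)(z) = f(r z)\<close>.
  For \<open>r < 1\<close> they are nuclear, with Taylor expansion converging in operator norm
  (\<open>summable_coef_monomial\<close>), and they tend to the identity strongly as \<open>r \<rightarrow> 1\<close>
  (\<open>dil_tendsto\<close>). For the dual one needs \<open>l \<circ> dil r \<rightarrow> l\<close> in norm (\<open>dual_dilation\<close>). In place of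
  reflexivity this uses that, for exponents above \<open>1\<close>, a bounded sequence that tends to \<open>0\<close> pointwise
  tends to \<open>0\<close> weakly (\<open>weakly_null\<close>): by the Brezis-Lieb lemma one can add \<open>n\<close> of its terms with norm
  of order only \<open>n\<^bsup>1/p\<^esup>\<close>.

  A compact operator \<open>T\<close> is the limit in operator norm of the operators \<open>dil r \<circ> T\<close>, which are nuclear,
  and the operator norm is at most the nuclear norm; so the second density follows from the first.
\<close>

section \<open>Area measure on the complex plane\<close>

lemma lborel_complex_eq_distr:
  "(lborel :: complex measure) = distr (lborel \<Otimes>\<^sub>M lborel) borel (\<lambda>(x, y). Complex x y)"
proof (rule lborel_eqI)
  have m[measurable]: "(\<lambda>(x, y). Complex x y) \<in> borel_measurable (lborel \<Otimes>\<^sub>M lborel)"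
    unfolding Complex_eq by measurable
  fix l u :: complex
  assume "\<And>b. b \<in> Basis \<Longrightarrow> l \<bullet> b \<le> u \<bullet> b"
  from this[of 1] this[of \<i>] have le: "Re l \<le> Re u" "Im l \<le> Im u"
    by (simp_all add: Basis_complex_def)
  have "(\<lambda>(x, y). Complex x y) -` box l u = box (Re l) (Re u) \<times> box (Im l) (Im u)"
    by (auto simp: box_def Basis_complex_def)
  then have "emeasure (distr (lborel \<Otimes>\<^sub>M lborel) borel (\<lambda>(x, y). Complex x y)) (box l u) =
    emeasure (lborel \<Otimes>\<^sub>M lborel) (box (Re l) (Re u) \<times> box (Im l) (Im u))"
    by (simp add: emeasure_distr space_pair_measure)
  also have "\<dots> = ennreal (Re u - Re l) * ennreal (Im u - Im l)"
    using le by (simp add: lborel.emeasure_pair_measure_Times)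
  finally show "emeasure (distr (lborel \<Otimes>\<^sub>M lborel) borel (\<lambda>(x, y). Complex x y)) (box l u) =
      (\<Prod>b\<in>Basis. (u - l) \<bullet> b)"
    using le by (simp add: Basis_complex_def ennreal_mult)
qed simp

lemma nn_integral_lborel_complex:
  assumes [measurable]: "f \<in> borel_measurable borel"
  shows "(\<integral>\<^sup>+z. f z \<partial>lborel) = (\<integral>\<^sup>+y. \<integral>\<^sup>+x. f (Complex x y) \<partial>lborel \<partial>lborel)"
    and "(\<integral>\<^sup>+z. f z \<partial>lborel) = (\<integral>\<^sup>+x. \<integral>\<^sup>+y. f (Complex x y) \<partial>lborel \<partial>lborel)"
proof -
  have m[measurable]: "(\<lambda>(x, y). Complex x y) \<in> borel_measurable (lborel \<Otimes>\<^sub>M lborel)"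
    unfolding Complex_eq by measurable
  have *: "(\<integral>\<^sup>+z. f z \<partial>lborel) = (\<integral>\<^sup>+v. f (case v of (x, y) \<Rightarrow> Complex x y) \<partial>(lborel \<Otimes>\<^sub>M lborel))"
    by (subst lborel_complex_eq_distr, subst nn_integral_distr) auto
  show "(\<integral>\<^sup>+z. f z \<partial>lborel) = (\<integral>\<^sup>+y. \<integral>\<^sup>+x. f (Complex x y) \<partial>lborel \<partial>lborel)"
    unfolding * by (subst lborel_pair.nn_integral_snd[symmetric]) auto
  show "(\<integral>\<^sup>+z. f z \<partial>lborel) = (\<integral>\<^sup>+x. \<integral>\<^sup>+y. f (Complex x y) \<partial>lborel \<partial>lborel)"
    unfolding * by (subst lborel.nn_integral_fst[symmetric]) auto
qed

lemma nn_integral_lborel_shear: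
  assumes [measurable]: "f \<in> borel_measurable borel"
  shows "(\<integral>\<^sup>+z. f (Complex (Re z + c * Im z) (Im z)) \<partial>lborel) = (\<integral>\<^sup>+z. f z \<partial>lborel)"
    and "(\<integral>\<^sup>+z. f (Complex (Re z) (Im z + c * Re z)) \<partial>lborel) = (\<integral>\<^sup>+z. f z \<partial>lborel)"
proof -
  have [measurable]: "(\<lambda>z. f (Complex (Re z + c * Im z) (Im z))) \<in> borel_measurable borel"
    "(\<lambda>z. f (Complex (Re z) (Im z + c * Re z))) \<in> borel_measurable borel"
    "(\<lambda>x. f (Complex x y)) \<in> borel_measurable borel"
    "(\<lambda>y. f (Complex x y)) \<in> borel_measurable borel" for x y
    unfolding Complex_eq by measurable
  show "(\<integral>\<^sup>+z. f (Complex (Re z + c * Im z) (Im z)) \<partial>lborel) = (\<integral>\<^sup>+z. f z \<partial>lborel)"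
    using nn_integral_real_affine[of "\<lambda>x. f (Complex x _)" 1 "c * _"]
    by (simp add: nn_integral_lborel_complex(1) add.commute)
  show "(\<integral>\<^sup>+z. f (Complex (Re z) (Im z + c * Re z)) \<partial>lborel) = (\<integral>\<^sup>+z. f z \<partial>lborel)"
    using nn_integral_real_affine[of "\<lambda>y. f (Complex _ y)" 1 "c * _"]
    by (simp add: nn_integral_lborel_complex(2) add.commute)
qed

text \<open>
  A rotation by an angle other than \<open>\<pi>\<close> is a product of three shears, which preserve area by
  Fubini and translation invariance; the rotation by \<open>\<pi>\<close> is the square of the rotation by \<open>\<pi>/2\<close>.
\<close>
lemma nn_integral_lborel_rotate:
  assumes [measurable]: "f \<in> borel_measurable borel" and w: "cmod w = 1"
  shows "(\<integral>\<^sup>+z. f (w * z) \<partial>lborel) = (\<integral>\<^sup>+z. f z \<partial>lborel)"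
proof -
  have *: "(\<integral>\<^sup>+z. f (w * z) \<partial>lborel) = (\<integral>\<^sup>+z. f z \<partial>lborel)"
    if [measurable]: "f \<in> borel_measurable borel" and w: "cmod w = 1" "Re w \<noteq> -1"
    for f :: "complex \<Rightarrow> ennreal" and w
  proof -
    \<comment> \<open>minus the tangent of half the angle\<close>
    define t where "t = - Im w / (1 + Re w)"
    have w1: "(Re w)\<^sup>2 + (Im w)\<^sup>2 = 1"
      using w by (metis cmod_power2 one_power2)
    have nz: "1 + Re w \<noteq> 0" using w by auto
    have 1: "1 + t * Im w = Re w"
      using w1 nz by (simp add: t_def field_simps power2_eq_square)
    have "t * (1 + Re w) = - Im w"
      using nz by (simp add: t_def)
    then have 2: "t + t * Re w = - Im w"
      by (simp add: algebra_simps)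
    define S where "S z = Complex (Re z + t * Im z) (Im z)" for z
    define U where "U z = Complex (Re z) (Im z + Im w * Re z)" for z
    have [measurable]: "S \<in> borel_measurable borel" "U \<in> borel_measurable borel"
      unfolding S_def[abs_def] U_def[abs_def] Complex_eq by measurable
    have "S (U (S z)) = w * z" for z
    proof (rule complex_eqI)
      have "Re (S (U (S z))) = Re z * (1 + t * Im w) + Im z * (t + t * (1 + t * Im w))"
        by (simp add: S_def U_def algebra_simps)
      then show "Re (S (U (S z))) = Re (w * z)" by (simp add: 1 2)
      have "Im (S (U (S z))) = Im w * Re z + (1 + t * Im w) * Im z"
        by (simp add: S_def U_def algebra_simps)
      then show "Im (S (U (S z))) = Im (w * z)" by (simp add: 1)
    qed
    then have "(\<integral>\<^sup>+z. f (w * z) \<partial>lborel) = (\<integral>\<^sup>+z. f (S (U (S z))) \<partial>lborel)" by simp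
    also have "\<dots> = (\<integral>\<^sup>+z. f (S (U z)) \<partial>lborel)"
      using nn_integral_lborel_shear(1)[of "\<lambda>z. f (S (U z))" t, folded S_def] by simp
    also have "\<dots> = (\<integral>\<^sup>+z. f (S z) \<partial>lborel)"
      using nn_integral_lborel_shear(2)[of "\<lambda>z. f (S z)" "Im w", folded U_def] by simp
    also have "\<dots> = (\<integral>\<^sup>+z. f z \<partial>lborel)"
      using nn_integral_lborel_shear(1)[of f t, folded S_def] by simp
    finally show ?thesis .
  qed
  show ?thesis
  proof (cases "Re w = -1")
    case False
    then show ?thesis using * assms by blast
  next
    case True
    have "(Im w)\<^sup>2 = 0" using w True by (metis add_cancel_right_right cmod_power2 one_power2 power2_minus)
    then have "w = \<i> * \<i>" using True by (simp add: complex_eq_iff)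
    then show ?thesis using *[of "\<lambda>z. f (\<i> * z)" \<i>] *[of f \<i>] by (simp add: mult.assoc)
  qed
qed

lemma lborel_distr_rotate:
  assumes "cmod w = 1"
  shows "distr lborel borel ((*) w) = (lborel :: complex measure)"
proof (rule measure_eqI)
  fix A assume "A \<in> sets (distr lborel borel ((*) w))"
  then have [measurable]: "A \<in> sets borel" by simp
  have "emeasure (distr lborel borel ((*) w)) A = (\<integral>\<^sup>+z. indicator A z \<partial>distr lborel borel ((*) w))"
    by simp
  also have "\<dots> = (\<integral>\<^sup>+z. indicator A (w * z) \<partial>lborel)"
    by (subst nn_integral_distr) auto
  also have "\<dots> = emeasure lborel A"
    using nn_integral_lborel_rotate[OF _ assms, of "indicator A"] by simp
  finally show "emeasure (distr lborel borel ((*) w)) A = emeasure lborel A" .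
qed simp

lemma integral_lborel_rotate:
  fixes f :: "complex \<Rightarrow> complex"
  assumes "f \<in> borel_measurable borel" "cmod w = 1"
  shows "(LINT z|lborel. f (w * z)) = (LINT z|lborel. f z)"
  using integral_distr[of "(*) w" lborel borel f] assms lborel_distr_rotate[of w] by simp

text \<open>
  Rotating the variable by a number \<open>w\<close> with \<open>w\<^bsup>|a-b|\<^esup> = -1\<close> changes the sign of the integrand and
  preserves the integral.
\<close>
lemma integral_monomials_eq_0:
  fixes \<eta> :: "real \<Rightarrow> complex"
  assumes [measurable]: "\<eta> \<in> borel_measurable borel" and "a \<noteq> b"
  shows "(LINT z|lborel. cnj z ^ a * z ^ b * \<eta> (cmod z)) = 0"
proof -
  define k where "k = nat \<bar>int b - int a\<bar>"
  have k: "k > 0" using \<open>a \<noteq> b\<close> by (simp add: k_def)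
  define w where "w = cis (pi / k)"
  have "w ^ k = cis (real k * (pi / real k))"
    by (simp only: w_def Complex.DeMoivre)
  then have w: "cmod w = 1" "w ^ k = -1" "w \<noteq> 0" "cnj w * w = 1"
    using k by (simp_all add: w_def cis_cnj cis_mult)
  have ne: "cnj w ^ a * w ^ b \<noteq> 1"
  proof (cases "a < b")
    case True
    then have "b = a + k" by (simp add: k_def)
    then have "cnj w ^ a * w ^ b = (cnj w * w) ^ a * w ^ k"
      by (simp add: power_add power_mult_distrib)
    then show ?thesis using w by simp
  next
    case False
    then have "a = b + k" using \<open>a \<noteq> b\<close> by (simp add: k_def)
    then have "cnj w ^ a * w ^ b = (cnj w * w) ^ b * cnj (w ^ k)"
      by (simp add: power_add power_mult_distrib)
    then show ?thesis using w by simp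
  qed
  define F where "F z = cnj z ^ a * z ^ b * \<eta> (cmod z)" for z
  have [measurable]: "(\<lambda>z. cnj z ^ a * z ^ b) \<in> borel_measurable borel"
    by (intro borel_measurable_continuous_onI continuous_intros)
  have [measurable]: "F \<in> borel_measurable borel"
    unfolding F_def[abs_def] by measurable
  have "F (w * z) = (cnj w ^ a * w ^ b) * F z" for z
    using w by (simp add: F_def norm_mult power_mult_distrib)
  then have "(LINT z|lborel. F z) = (cnj w ^ a * w ^ b) * (LINT z|lborel. F z)"
    using integral_lborel_rotate[of F w] w by simp
  then have "(LINT z|lborel. F z) = 0" using ne by (metis mult_cancel_right1)
  then show ?thesis by (simp add: F_def)
qed

lemma integrable_gaussian_complex:
  assumes "\<beta> > 0"
  shows "integrable lborel (\<lambda>z::complex. exp (- \<beta> * (cmod z)\<^sup>2))"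
proof -
  let ?g = "\<lambda>x::real. exp (- \<beta> * x\<^sup>2)"
  define \<sigma> where "\<sigma> = sqrt (1 / (2 * \<beta>))"
  have s: "\<sigma> > 0" "\<sigma>\<^sup>2 = 1 / (2 * \<beta>)" using assms by (auto simp: \<sigma>_def)
  have "integrable lborel (\<lambda>x. sqrt (2 * pi * \<sigma>\<^sup>2) * normal_density 0 \<sigma> x)"
    using integrable_normal_density[OF \<open>\<sigma> > 0\<close>, of 0] by simp
  also have "(\<lambda>x. sqrt (2 * pi * \<sigma>\<^sup>2) * normal_density 0 \<sigma> x) = ?g"
    using s assms by (auto simp: normal_density_def field_simps)
  finally have i: "integrable lborel ?g" .
  have fin: "(\<integral>\<^sup>+x. ennreal (?g x) \<partial>lborel) < \<infinity>"
    using nn_integral_eq_integral[OF i] by simp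
  have "(\<integral>\<^sup>+z. ennreal (exp (- \<beta> * (cmod z)\<^sup>2)) \<partial>lborel)
      = (\<integral>\<^sup>+z. (\<Prod>b\<in>(Basis::complex set). ennreal (?g (z \<bullet> b))) \<partial>lborel)"
    by (simp add: Basis_complex_def cmod_power2 ennreal_mult'[symmetric] exp_add[symmetric] algebra_simps)
  also have "\<dots> = (\<Prod>b\<in>(Basis::complex set). (\<integral>\<^sup>+x. ennreal (?g x) \<partial>lborel))"
    by (subst nn_integral_lborel_prod[where f = "\<lambda>b x. ennreal (?g x)"]) auto
  also have "\<dots> < \<infinity>"
    using fin by (simp add: Basis_complex_def ennreal_mult_less_top)
  finally show ?thesis
    by (intro integrableI_bounded) auto
qed

lemma integrable_lborel_scaleR_iff:
  fixes f :: "'a::euclidean_space \<Rightarrow> real"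
  assumes [measurable]: "f \<in> borel_measurable borel" and r: "r > 0"
  shows "integrable lborel (\<lambda>z. f (r *\<^sub>R z)) \<longleftrightarrow> integrable lborel f"
    and "(LINT z|lborel. f (r *\<^sub>R z)) = (LINT z|lborel. f z) / r ^ DIM('a)"
proof -
  have nz: "r \<noteq> 0" using r by simp
  have eq: "lborel = density (distr lborel borel (\<lambda>x::'a. r *\<^sub>R x)) (\<lambda>_. ennreal (\<bar>r\<bar> ^ DIM('a)))"
    using lborel_affine[OF nz, of "0::'a"] by simp
  have "integrable lborel f \<longleftrightarrow> integrable (density (distr lborel borel (\<lambda>x::'a. r *\<^sub>R x)) (\<lambda>_. ennreal (\<bar>r\<bar> ^ DIM('a)))) f"
    by (subst eq) simp
  also have "\<dots> \<longleftrightarrow> integrable lborel (\<lambda>z. f (r *\<^sub>R z))"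
    using r by (subst integrable_density) (auto simp: integrable_distr_eq)
  finally show "integrable lborel (\<lambda>z. f (r *\<^sub>R z)) \<longleftrightarrow> integrable lborel f" by simp
  have "(LINT z|lborel. f z) = (LINT z|density (distr lborel borel (\<lambda>x::'a. r *\<^sub>R x)) (\<lambda>_. ennreal (\<bar>r\<bar> ^ DIM('a))). f z)"
    by (subst eq) simp
  also have "\<dots> = r ^ DIM('a) * (LINT z|lborel. f (r *\<^sub>R z))"
    using r by (subst integral_density) (auto simp: integral_distr)
  finally show "(LINT z|lborel. f (r *\<^sub>R z)) = (LINT z|lborel. f z) / r ^ DIM('a)"
    using r by simp
qed

lemma integrable_lborel_translate_iff:
  fixes f :: "'a::euclidean_space \<Rightarrow> real"
  assumes [measurable]: "f \<in> borel_measurable borel"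
  shows "integrable lborel (\<lambda>z. f (a + z)) \<longleftrightarrow> integrable lborel f"
    and "(LINT z|lborel. f (a + z)) = (LINT z|lborel. f z)"
  using integrable_distr_eq[of "(+) a" lborel borel f] integral_distr[of "(+) a" lborel borel f]
  by (simp_all add: lborel_distr_plus)

section \<open>Nuclear operators between normed function spaces\<close>

text \<open>
  The condition \<open>nrm_minus\<close> does not follow from \<open>nrm_scale\<close>, because it concerns all functions: in
  \<^locale>\<open>Metric_space\<close> the distance is symmetric on the whole type.
\<close>
locale normed_fun_space =
  fixes X :: "'a fun_space"
  assumes zero_mem: "(\<lambda>_. 0) \<in> points X"
    and add_mem: "f \<in> points X \<Longrightarrow> g \<in> points X \<Longrightarrow> (\<lambda>z. f z + g z) \<in> points X"
    and scale_mem: "f \<in> points X \<Longrightarrow> (\<lambda>z. c * f z) \<in> points X"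
    and nrm_nonneg: "nrm X f \<ge> 0"
    and nrm_add: "f \<in> points X \<Longrightarrow> g \<in> points X \<Longrightarrow> nrm X (\<lambda>z. f z + g z) \<le> nrm X f + nrm X g"
    and nrm_scale: "f \<in> points X \<Longrightarrow> nrm X (\<lambda>z. c * f z) = cmod c * nrm X f"
    and nrm_minus: "nrm X (\<lambda>z. - f z) = nrm X f"
    and nrm_eq_0: "f \<in> points X \<Longrightarrow> nrm X f = 0 \<Longrightarrow> f = (\<lambda>_. 0)"
begin

lemma diff_mem: "f \<in> points X \<Longrightarrow> g \<in> points X \<Longrightarrow> (\<lambda>z. f z - g z) \<in> points X"
  using add_mem[of f "\<lambda>z. -1 * g z"] scale_mem[of g "-1"] by simp

lemma sum_mem:
  assumes "\<And>i. i \<in> I \<Longrightarrow> f i \<in> points X"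
  shows "(\<lambda>z. \<Sum>i\<in>I. f i z) \<in> points X"
  using assms by (induction I rule: infinite_finite_induct) (auto simp: zero_mem intro!: add_mem)

lemma nrm_0 [simp]: "nrm X (\<lambda>_. 0) = 0"
  using nrm_scale[OF zero_mem, of 0] by simp

lemma nrm_minus_commute: "nrm X (\<lambda>z. f z - g z) = nrm X (\<lambda>z. g z - f z)"
  using nrm_minus[of "\<lambda>z. f z - g z"] by simp

lemma nrm_diff:
  assumes "f \<in> points X" "g \<in> points X"
  shows "nrm X (\<lambda>z. f z - g z) \<le> nrm X f + nrm X g"
  using nrm_add[OF assms(1) scale_mem[OF assms(2)], of "-1"] nrm_scale[OF assms(2), of "-1"] by simp

lemma nrm_triangle3:
  assumes "f \<in> points X" "g \<in> points X" "h \<in> points X"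
  shows "nrm X (\<lambda>z. f z - h z) \<le> nrm X (\<lambda>z. f z - g z) + nrm X (\<lambda>z. g z - h z)"
  using nrm_add[OF diff_mem[OF assms(1,2)] diff_mem[OF assms(2,3)]] by simp

lemma nrm_sum_le:
  assumes "\<And>i. i \<in> I \<Longrightarrow> f i \<in> points X"
  shows "nrm X (\<lambda>z. \<Sum>i\<in>I. f i z) \<le> (\<Sum>i\<in>I. nrm X (f i))"
  using assms
proof (induction I rule: infinite_finite_induct)
  case (insert i I)
  then have "nrm X (\<lambda>z. f i z + (\<Sum>j\<in>I. f j z)) \<le> nrm X (f i) + nrm X (\<lambda>z. \<Sum>j\<in>I. f j z)"
    by (intro nrm_add sum_mem) auto
  with insert show ?case by fastforce
qed simp_all

lemma metric: "Metric_space (points X) (\<lambda>f g. nrm X (\<lambda>z. f z - g z))"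
proof
  show "0 \<le> nrm X (\<lambda>z. f z - g z)" for f g by (rule nrm_nonneg)
  show "nrm X (\<lambda>z. f z - g z) = nrm X (\<lambda>z. g z - f z)"
    for f g by (rule nrm_minus_commute)
  show "nrm X (\<lambda>z. f z - g z) = 0 \<longleftrightarrow> f = g" if "f \<in> points X" "g \<in> points X" for f g
    using nrm_eq_0[OF diff_mem[OF that]] by (auto simp: fun_eq_iff)
  show "nrm X (\<lambda>z. f z - h z) \<le> nrm X (\<lambda>z. f z - g z) + nrm X (\<lambda>z. g z - h z)"
    if "f \<in> points X" "g \<in> points X" "h \<in> points X"
    for f g h
    using nrm_triangle3 that by blast
qed

lemma dual_add: "l \<in> dual X \<Longrightarrow> f \<in> points X \<Longrightarrow> g \<in> points X \<Longrightarrow> l (\<lambda>z. f z + g z) = l f + l g"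
  and dual_scale: "l \<in> dual X \<Longrightarrow> f \<in> points X \<Longrightarrow> l (\<lambda>z. c * f z) = c * l f"
  by (auto simp: dual_def)

lemma dual_0: "l \<in> dual X \<Longrightarrow> l (\<lambda>_. 0) = 0"
  using dual_scale[OF _ zero_mem, of l 0] by simp

lemma dual_diff:
  "l \<in> dual X \<Longrightarrow> f \<in> points X \<Longrightarrow> g \<in> points X \<Longrightarrow> l (\<lambda>z. f z - g z) = l f - l g"
  using dual_add[of l f "\<lambda>z. -1 * g z"] dual_scale[of l g "-1"] scale_mem[of g "-1"] by simp

lemma dual_sum:
  assumes "l \<in> dual X" "\<And>i. i \<in> I \<Longrightarrow> f i \<in> points X"
  shows "l (\<lambda>z. \<Sum>i\<in>I. f i z) = (\<Sum>i\<in>I. l (f i))"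
  using assms(2)
proof (induction I rule: infinite_finite_induct)
  case (insert i I)
  then show ?case
    using dual_add[OF assms(1), of "f i" "\<lambda>z. \<Sum>i\<in>I. f i z"] by (auto simp: sum_mem)
qed (simp_all add: dual_0 assms(1))

lemma dual_bdd_above:
  assumes "l \<in> dual X"
  shows "bdd_above ((\<lambda>f. cmod (l f)) ` unit_cball X)"
proof -
  obtain B where B: "\<forall>f\<in>points X. cmod (l f) \<le> B * nrm X f"
    using assms unfolding dual_def by blast
  show ?thesis
  proof (rule bdd_aboveI2)
    fix g assume "g \<in> unit_cball X"
    then have "cmod (l g) \<le> B * nrm X g" "0 \<le> nrm X g" "nrm X g \<le> 1"
      using B nrm_nonneg by (auto simp: unit_cball_def)
    then show "cmod (l g) \<le> \<bar>B\<bar>"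
      using mult_mono[of B "\<bar>B\<bar>" "nrm X g" 1] by linarith
  qed
qed

lemma dual_le:
  assumes "l \<in> dual X" "f \<in> points X"
  shows "cmod (l f) \<le> dual_norm X l * nrm X f"
proof (cases "nrm X f = 0")
  case True
  then show ?thesis using nrm_eq_0 assms dual_0 by fastforce
next
  case False
  then have pos: "nrm X f > 0" using nrm_nonneg[of f] by simp
  have bdd: "bdd_above ((\<lambda>f. cmod (l f)) ` unit_cball X)"
    by (rule dual_bdd_above[OF assms(1)])
  let ?g = "\<lambda>z. of_real (1 / nrm X f) * f z"
  have "?g \<in> unit_cball X"
    using pos nrm_scale[OF assms(2), of "of_real (1 / nrm X f)"]
      scale_mem[OF assms(2), of "of_real (1 / nrm X f)"]
    by (simp add: unit_cball_def norm_divide)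
  then have "cmod (l ?g) \<le> dual_norm X l"
    unfolding dual_norm_def by (intro cSUP_upper bdd)
  moreover have "l ?g = of_real (1 / nrm X f) * l f"
    using assms by (intro dual_scale)
  ultimately show ?thesis
    using pos by (simp add: norm_mult norm_divide pos_divide_le_eq)
qed

lemma zero_in_ball: "(\<lambda>_. 0) \<in> unit_cball X"
  by (simp add: unit_cball_def zero_mem)

lemma dual_norm_le:
  assumes "\<And>f. f \<in> points X \<Longrightarrow> cmod (l f) \<le> B * nrm X f" "B \<ge> 0"
  shows "dual_norm X l \<le> B"
  unfolding dual_norm_def
proof (rule cSUP_least)
  show "unit_cball X \<noteq> {}" using zero_in_ball by blast
  fix f assume "f \<in> unit_cball X"
  then have "cmod (l f) \<le> B * nrm X f" "nrm X f \<le> 1"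
    using assms by (auto simp: unit_cball_def)
  then show "cmod (l f) \<le> B"
    using assms(2) mult_left_le by (metis nrm_nonneg order_trans)
qed

lemma dual_norm_nonneg:
  assumes "l \<in> dual X"
  shows "dual_norm X l \<ge> 0"
proof -
  have "cmod (l (\<lambda>_. 0)) \<le> dual_norm X l"
    unfolding dual_norm_def by (intro cSUP_upper dual_bdd_above assms zero_in_ball)
  then show ?thesis using norm_ge_zero order_trans by blast
qed

lemma dualI:
  assumes "\<And>f g. f \<in> points X \<Longrightarrow> g \<in> points X \<Longrightarrow> l (\<lambda>z. f z + g z) = l f + l g"
    and "\<And>c f. f \<in> points X \<Longrightarrow> l (\<lambda>z. c * f z) = c * l f"
    and "\<And>f. f \<in> points X \<Longrightarrow> cmod (l f) \<le> B * nrm X f"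
  shows "restrict l (points X) \<in> dual X"
  using assms unfolding dual_def by (auto simp: add_mem scale_mem intro!: exI[of _ B])

lemma op_norm_le:
  assumes "\<And>f. f \<in> unit_cball X \<Longrightarrow> nrm Y (T f) \<le> e"
  shows "op_norm X Y T \<le> e"
  unfolding op_norm_def using assms zero_in_ball by (intro cSUP_least) auto

end

text \<open>
  A bound given by one representation, instead of the infimum over all of them, is easy to add and
  to scale. As \<open>T\<close> need not be extensional, differences of operators can be formed pointwise.
\<close>
definition nuclear_le ::
  "'a fun_space \<Rightarrow> 'b fun_space \<Rightarrow> (('a \<Rightarrow> complex) \<Rightarrow> 'b \<Rightarrow> complex) \<Rightarrow> real \<Rightarrow> bool" where
  "nuclear_le X Y T e \<longleftrightarrow> T \<in> points X \<rightarrow> points Y \<and>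
     (\<exists>(l, y)\<in>nuclear_reps X Y T. (\<Sum>j. dual_norm X (l j) * nrm Y (y j)) \<le> e)"

definition nuclear_closure ::
  "'a fun_space \<Rightarrow> 'b fun_space \<Rightarrow> (('a \<Rightarrow> complex) \<Rightarrow> 'b \<Rightarrow> complex) set
    \<Rightarrow> (('a \<Rightarrow> complex) \<Rightarrow> 'b \<Rightarrow> complex) set" where
  "nuclear_closure X Y C =
     {T. \<forall>e>0. \<exists>S\<in>C. nuclear_le X Y (\<lambda>f z. T f z - S f z) e}"

locale normed_fun_space_pair = X: normed_fun_space X + Y: normed_fun_space Y
  for X :: "'a fun_space" and Y :: "'b fun_space"
begin

abbreviation "mass l y n \<equiv> \<Sum>j<n. dual_norm X (l j) * nrm Y (y j)"

abbreviation "err T l y f n \<equiv> nrm Y (\<lambda>z. T f z - (\<Sum>j<n. l j f * y j z))"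

lemma nuclear_leI:
  assumes "\<And>f. f \<in> points X \<Longrightarrow> T f \<in> points Y"
    and ly: "\<And>j. l j \<in> dual X" "\<And>j. y j \<in> points Y"
    and "\<And>n. mass l y n \<le> e"
    and "\<And>f. f \<in> points X \<Longrightarrow> (\<lambda>n. err T l y f n) \<longlonglongrightarrow> 0"
  shows "nuclear_le X Y T e"
proof -
  have s: "summable (\<lambda>j. dual_norm X (l j) * nrm Y (y j))"
    using assms by (intro summableI_nonneg_bounded[where x = e])
      (auto simp: Y.nrm_nonneg X.dual_norm_nonneg)
  then have "(\<Sum>j. dual_norm X (l j) * nrm Y (y j)) \<le> e"
    using assms by (intro suminf_le_const) auto
  moreover have "(l, y) \<in> nuclear_reps X Y T"
    using s assms by (auto simp: nuclear_reps_def)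
  ultimately show ?thesis
    unfolding nuclear_le_def using assms(1) by (intro conjI bexI[of _ "(l, y)"]) auto
qed

lemma nuclear_leE:
  assumes "nuclear_le X Y T e"
  obtains l y where "\<And>f. f \<in> points X \<Longrightarrow> T f \<in> points Y"
    "\<And>j. l j \<in> dual X" "\<And>j. y j \<in> points Y"
    "\<And>n. mass l y n \<le> e"
    "\<And>f. f \<in> points X \<Longrightarrow> (\<lambda>n. err T l y f n) \<longlonglongrightarrow> 0"
    "summable (\<lambda>j. dual_norm X (l j) * nrm Y (y j))"
proof -
  obtain l y where *: "(l, y) \<in> nuclear_reps X Y T"
    "(\<Sum>j. dual_norm X (l j) * nrm Y (y j)) \<le> e"
    using assms by (auto simp: nuclear_le_def)
  show ?thesis
  proof (rule that[of l y])
    fix n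
    have "mass l y n \<le> (\<Sum>j. dual_norm X (l j) * nrm Y (y j))"
      using * by (intro sum_le_suminf)
        (auto simp: nuclear_reps_def Y.nrm_nonneg X.dual_norm_nonneg)
    with * show "mass l y n \<le> e" by linarith
  qed (use * assms in \<open>auto simp: nuclear_reps_def nuclear_le_def\<close>)
qed

lemma nuclear_reps_cong:
  "(\<And>f. f \<in> points X \<Longrightarrow> T f = S f) \<Longrightarrow> nuclear_reps X Y T = nuclear_reps X Y S"
  by (simp add: nuclear_reps_def cong: ball_cong)

lemma nuclear_le_cong:
  assumes "\<And>f. f \<in> points X \<Longrightarrow> T f = S f"
  shows "nuclear_le X Y T e \<longleftrightarrow> nuclear_le X Y S e"
proof -
  have "T \<in> points X \<rightarrow> points Y \<longleftrightarrow> S \<in> points X \<rightarrow> points Y"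
    unfolding Pi_iff using assms by auto
  then show ?thesis
    by (simp add: nuclear_le_def nuclear_reps_cong[OF assms])
qed

lemma nuclear_norm_le:
  assumes "nuclear_le X Y T e"
  shows "nuclear_norm X Y T \<le> e"
proof -
  obtain l y where *: "(l, y) \<in> nuclear_reps X Y T"
    "(\<Sum>j. dual_norm X (l j) * nrm Y (y j)) \<le> e"
    using assms by (auto simp: nuclear_le_def)
  have "bdd_below ((\<lambda>(l, y). \<Sum>j. dual_norm X (l j) * nrm Y (y j)) ` nuclear_reps X Y T)"
  proof (rule bdd_belowI2)
    fix r assume "r \<in> nuclear_reps X Y T"
    then show "0 \<le> (case r of (l, y) \<Rightarrow> \<Sum>j. dual_norm X (l j) * nrm Y (y j))"
      by (auto simp: nuclear_reps_def Y.nrm_nonneg X.dual_norm_nonneg intro!: suminf_nonneg)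
  qed
  then have "nuclear_norm X Y T \<le> (\<Sum>j. dual_norm X (l j) * nrm Y (y j))"
    unfolding nuclear_norm_def using *(1) by (intro cINF_lower2[where x = "(l, y)"]) auto
  with * show ?thesis by linarith
qed

lemma rank_one_sum_le:
  assumes "\<And>j. l j \<in> dual X" "\<And>j. y j \<in> points Y" "f \<in> points X"
  shows "nrm Y (\<lambda>z. \<Sum>j<n. l j f * y j z) \<le> mass l y n * nrm X f"
proof -
  have "nrm Y (\<lambda>z. \<Sum>j<n. l j f * y j z) \<le> (\<Sum>j<n. nrm Y (\<lambda>z. l j f * y j z))"
    using assms by (intro Y.nrm_sum_le Y.scale_mem)
  also have "\<dots> \<le> (\<Sum>j<n. (dual_norm X (l j) * nrm X f) * nrm Y (y j))"
    using assms by (intro sum_mono)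
      (auto simp: Y.nrm_scale intro!: mult_right_mono X.dual_le Y.nrm_nonneg)
  finally show ?thesis by (simp add: sum_distrib_left sum_distrib_right mult_ac)
qed

lemma nuclear_le_bound:
  assumes "nuclear_le X Y T e" "f \<in> points X"
  shows "nrm Y (T f) \<le> e * nrm X f"
proof -
  obtain l y where T: "\<And>f. f \<in> points X \<Longrightarrow> T f \<in> points Y"
    and ly: "\<And>j. l j \<in> dual X" "\<And>j. y j \<in> points Y"
    and le: "\<And>n. mass l y n \<le> e"
    and lim: "\<And>f. f \<in> points X \<Longrightarrow> (\<lambda>n. err T l y f n) \<longlonglongrightarrow> 0"
    using assms(1) by (rule nuclear_leE) blast
  have "nrm Y (T f) \<le> err T l y f n + e * nrm X f" for n
  proof -
    have m: "(\<lambda>z. \<Sum>j<n. l j f * y j z) \<in> points Y"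
      using ly by (intro Y.sum_mem Y.scale_mem)
    have "nrm Y (T f) \<le> err T l y f n + nrm Y (\<lambda>z. \<Sum>j<n. l j f * y j z)"
      using Y.nrm_add[OF Y.diff_mem[OF T[OF assms(2)] m] m] by simp
    moreover have "nrm Y (\<lambda>z. \<Sum>j<n. l j f * y j z) \<le> e * nrm X f"
      using rank_one_sum_le[of l y f n, OF ly assms(2)] mult_right_mono[OF le X.nrm_nonneg]
      by (rule order_trans)
    ultimately show ?thesis by linarith
  qed
  moreover have "(\<lambda>n. err T l y f n + e * nrm X f) \<longlonglongrightarrow> 0 + e * nrm X f"
    using lim[OF assms(2)] by (intro tendsto_intros)
  ultimately show ?thesis
    by (intro LIMSEQ_le_const[where X = "\<lambda>n. err T l y f n + e * nrm X f"]) auto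
qed

lemma nuclear_le_mono: "nuclear_le X Y T d \<Longrightarrow> d \<le> e \<Longrightarrow> nuclear_le X Y T e"
  unfolding nuclear_le_def by (blast intro: order_trans)

text \<open>Representations are infinite series, so that a rank-one operator is padded with zero vectors.\<close>
lemma nuclear_le_rank_one:
  assumes "l \<in> dual X" "y \<in> points Y"
  shows "nuclear_le X Y (\<lambda>f z. l f * y z) (dual_norm X l * nrm Y y)"
proof (rule nuclear_leI[where l = "\<lambda>_. l" and y = "\<lambda>j. if j = 0 then y else (\<lambda>_. 0)"])
  have s: "(\<Sum>j<n. dual_norm X l * nrm Y (if j = 0 then y else (\<lambda>_. 0))) =
     (if n = 0 then 0 else dual_norm X l * nrm Y y)" for n :: nat
    by (induction n) auto
  show "(\<Sum>j<n. dual_norm X l * nrm Y (if j = 0 then y else (\<lambda>_. 0))) \<le> dual_norm X l * nrm Y y" for n :: nat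
    using s[of n] assms by (cases "n = 0") (auto simp: X.dual_norm_nonneg Y.nrm_nonneg)
  have "(\<Sum>j<n. l f * (if j = 0 then y else (\<lambda>_. 0)) z) = (if n = 0 then 0 else l f * y z)" for n :: nat and f z
    by (induction n) auto
  then have "\<forall>\<^sub>F n in sequentially. nrm Y (\<lambda>z. l f * y z - (\<Sum>j<n. l f * (if j = 0 then y else (\<lambda>_. 0)) z)) = 0" for f
    by (intro eventually_sequentiallyI[of 1]) auto
  then show "(\<lambda>n. nrm Y (\<lambda>z. l f * y z - (\<Sum>j<n. l f * (if j = 0 then y else (\<lambda>_. 0)) z))) \<longlonglongrightarrow> 0" for f
    by (rule tendsto_eventually)
qed (use assms in \<open>auto simp: Y.zero_mem intro: Y.scale_mem\<close>)

text \<open>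
  Two representations are merged by interleaving. A partial sum of the merged series is then a sum
  of two partial sums of about half its length.
\<close>
lemma nuclear_le_add:
  assumes "nuclear_le X Y T d" "nuclear_le X Y S e"
  shows "nuclear_le X Y (\<lambda>f z. T f z + S f z) (d + e)"
proof -
  obtain l y where T: "\<And>f. f \<in> points X \<Longrightarrow> T f \<in> points Y"
    and ly: "\<And>j. l j \<in> dual X" "\<And>j. y j \<in> points Y"
    and le: "\<And>n. mass l y n \<le> d"
    and lim: "\<And>f. f \<in> points X \<Longrightarrow> (\<lambda>n. err T l y f n) \<longlonglongrightarrow> 0"
    using assms(1) by (rule nuclear_leE) blast
  obtain l' y' where S: "\<And>f. f \<in> points X \<Longrightarrow> S f \<in> points Y"
    and ly': "\<And>j. l' j \<in> dual X" "\<And>j. y' j \<in> points Y"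
    and le': "\<And>n. mass l' y' n \<le> e"
    and lim': "\<And>f. f \<in> points X \<Longrightarrow> (\<lambda>n. err S l' y' f n) \<longlonglongrightarrow> 0"
    using assms(2) by (rule nuclear_leE) blast
  define L where "L j = (if even j then l (j div 2) else l' (j div 2))" for j
  define W where "W j = (if even j then y (j div 2) else y' (j div 2))" for j
  have split: "(\<Sum>j<n. g (L j) (W j)) =
      (\<Sum>j<(n + 1) div 2. g (l j) (y j)) + (\<Sum>j<n div 2. g (l' j) (y' j))"
    for g :: "_ \<Rightarrow> _ \<Rightarrow> 'c::comm_monoid_add" and n
  proof (induction n)
    case (Suc n)
    show ?case
    proof (cases "even n")
      case True
      then have "(Suc n + 1) div 2 = Suc ((n + 1) div 2)" "Suc n div 2 = n div 2" "(n + 1) div 2 = n div 2"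
        by (auto elim!: evenE)
      with True Suc show ?thesis by (simp add: L_def W_def ac_simps)
    next
      case False
      then have "(Suc n + 1) div 2 = (n + 1) div 2" "Suc n div 2 = Suc (n div 2)"
        by (auto elim!: oddE)
      with False Suc show ?thesis by (simp add: L_def W_def ac_simps)
    qed
  qed simp
  show ?thesis
  proof (rule nuclear_leI[where l = L and y = W])
    fix f assume f: "f \<in> points X"
    show "(\<lambda>z. T f z + S f z) \<in> points Y" using S T f by (intro Y.add_mem)
    let ?a = "\<lambda>n. err T l y f n"
    let ?b = "\<lambda>n. err S l' y' f n"
    have "\<forall>\<^sub>F n in sequentially. Z \<le> (n + 1) div 2" "\<forall>\<^sub>F n in sequentially. Z \<le> n div 2" for Z :: nat
      by (rule eventually_sequentiallyI[of "2 * Z"], linarith)+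
    then have "filterlim (\<lambda>n::nat. (n + 1) div 2) at_top at_top" "filterlim (\<lambda>n::nat. n div 2) at_top at_top"
      by (auto simp: filterlim_at_top)
    then have lim_ab: "(\<lambda>n. ?a ((n + 1) div 2) + ?b (n div 2)) \<longlonglongrightarrow> 0 + 0"
      by (intro tendsto_add filterlim_compose[OF lim[OF f]] filterlim_compose[OF lim'[OF f]])
    have le_ab: "nrm Y (\<lambda>z. T f z + S f z - (\<Sum>j<n. L j f * W j z)) \<le> ?a ((n + 1) div 2) + ?b (n div 2)" for n
    proof -
      have "(\<lambda>z. T f z + S f z - (\<Sum>j<n. L j f * W j z)) =
          (\<lambda>z. (T f z - (\<Sum>j<(n + 1) div 2. l j f * y j z)) + (S f z - (\<Sum>j<n div 2. l' j f * y' j z)))"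
        using split[of "\<lambda>l y. l f * y _" n] by (simp add: fun_eq_iff algebra_simps)
      moreover have "(\<lambda>z. T f z - (\<Sum>j<(n + 1) div 2. l j f * y j z)) \<in> points Y"
        "(\<lambda>z. S f z - (\<Sum>j<n div 2. l' j f * y' j z)) \<in> points Y"
        using T S f ly ly' by (auto intro!: Y.diff_mem Y.sum_mem Y.scale_mem)
      ultimately show ?thesis using Y.nrm_add by simp
    qed
    show "(\<lambda>n. nrm Y (\<lambda>z. T f z + S f z - (\<Sum>j<n. L j f * W j z))) \<longlonglongrightarrow> 0"
    proof (rule Lim_null_comparison)
      show "(\<lambda>n. ?a ((n + 1) div 2) + ?b (n div 2)) \<longlonglongrightarrow> 0" using lim_ab by simp
    qed (simp only: real_norm_def abs_of_nonneg[OF Y.nrm_nonneg] le_ab eventually_True)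
  next
    fix n show "(\<Sum>j<n. dual_norm X (L j) * nrm Y (W j)) \<le> d + e"
      unfolding split[of "\<lambda>l y. dual_norm X l * nrm Y y" n] using le le' by (intro add_mono)
  qed (auto simp: L_def W_def ly ly')
qed

lemma nuclear_le_scale:
  assumes "nuclear_le X Y T e"
  shows "nuclear_le X Y (\<lambda>f z. c * T f z) (cmod c * e)"
proof -
  obtain l y where T: "\<And>f. f \<in> points X \<Longrightarrow> T f \<in> points Y"
    and ly: "\<And>j. l j \<in> dual X" "\<And>j. y j \<in> points Y"
    and le: "\<And>n. mass l y n \<le> e"
    and lim: "\<And>f. f \<in> points X \<Longrightarrow> (\<lambda>n. err T l y f n) \<longlonglongrightarrow> 0"
    using assms(1) by (rule nuclear_leE) blast
  show ?thesis
  proof (rule nuclear_leI[where l = l and y = "\<lambda>j z. c * y j z"])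
    fix f assume f: "f \<in> points X"
    have "nrm Y (\<lambda>z. c * T f z - (\<Sum>j<n. l j f * (c * y j z))) =
        cmod c * err T l y f n" for n
    proof -
      have "(\<lambda>z. T f z - (\<Sum>j<n. l j f * y j z)) \<in> points Y"
        using T f ly by (intro Y.diff_mem Y.sum_mem Y.scale_mem)
      from Y.nrm_scale[OF this, of c] show ?thesis
        by (simp add: right_diff_distrib sum_distrib_left mult.left_commute)
    qed
    with tendsto_mult_right_zero[OF lim[OF f], of "cmod c"]
    show "(\<lambda>n. nrm Y (\<lambda>z. c * T f z - (\<Sum>j<n. l j f * (c * y j z)))) \<longlonglongrightarrow> 0" by simp
  next
    fix n
    have "(\<Sum>j<n. dual_norm X (l j) * nrm Y (\<lambda>z. c * y j z)) = cmod c * mass l y n"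
      by (simp add: Y.nrm_scale[OF ly(2)] sum_distrib_left mult.left_commute)
    with le[of n] show "(\<Sum>j<n. dual_norm X (l j) * nrm Y (\<lambda>z. c * y j z)) \<le> cmod c * e"
      by (simp add: mult_left_mono)
  qed (use T ly in \<open>auto intro: Y.scale_mem\<close>)
qed

lemma nuclear_le_0: "nuclear_le X Y (\<lambda>f z. 0) 0"
  by (rule nuclear_leI[where l = "\<lambda>_. \<lambda>f\<in>points X. 0" and y = "\<lambda>_ _. 0"])
    (auto simp: Y.zero_mem intro!: X.dualI[where B = 0])

lemma nuclear_closureD:
  assumes "T \<in> nuclear_closure X Y C" "e > 0"
  shows "\<exists>S\<in>C. nuclear_le X Y (\<lambda>f z. T f z - S f z) e"
  using assms by (simp add: nuclear_closure_def)

lemma nuclear_closure_cong: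
  assumes "\<And>f. f \<in> points X \<Longrightarrow> T f = S f"
  shows "T \<in> nuclear_closure X Y C \<longleftrightarrow> S \<in> nuclear_closure X Y C"
proof -
  have "nuclear_le X Y (\<lambda>f z. T f z - R f z) e \<longleftrightarrow> nuclear_le X Y (\<lambda>f z. S f z - R f z) e" for R e
    by (rule nuclear_le_cong) (simp add: assms)
  then show ?thesis by (simp add: nuclear_closure_def)
qed

lemma subset_nuclear_closure: "C \<subseteq> nuclear_closure X Y C"
proof
  fix T assume "T \<in> C"
  moreover have "nuclear_le X Y (\<lambda>f z. T f z - T f z) e" if "e > 0" for e
    using nuclear_le_mono[OF nuclear_le_0, of e] that by simp
  ultimately show "T \<in> nuclear_closure X Y C" by (auto simp: nuclear_closure_def intro!: bexI[of _ T])
qed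

lemma nuclear_closure_closed:
  assumes "\<And>e. e > 0 \<Longrightarrow> \<exists>S\<in>nuclear_closure X Y C. nuclear_le X Y (\<lambda>f z. T f z - S f z) e"
  shows "T \<in> nuclear_closure X Y C"
  unfolding nuclear_closure_def
proof safe
  fix e :: real assume "e > 0"
  then have e: "e / 2 > 0" by simp
  obtain S where S: "S \<in> nuclear_closure X Y C" "nuclear_le X Y (\<lambda>f z. T f z - S f z) (e / 2)"
    using assms[OF e] by blast
  obtain R where R: "R \<in> C" "nuclear_le X Y (\<lambda>f z. S f z - R f z) (e / 2)"
    using nuclear_closureD[OF S(1) e] by blast
  show "\<exists>R\<in>C. nuclear_le X Y (\<lambda>f z. T f z - R f z) e"
    using nuclear_le_add[OF S(2) R(2)] R(1) by auto
qed

end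

text \<open>
  The set \<open>C\<close> itself need not be a subspace, because operators that agree on the points of \<open>X\<close> may
  differ elsewhere as functions. The closure ignores such differences.
\<close>
locale nuclear_subspace = normed_fun_space_pair X Y
  for X :: "'a fun_space" and Y :: "'b fun_space" +
  fixes C :: "(('a \<Rightarrow> complex) \<Rightarrow> 'b \<Rightarrow> complex) set"
  assumes C_0: "(\<lambda>f z. 0) \<in> C"
    and C_add: "S \<in> C \<Longrightarrow> T \<in> C \<Longrightarrow> (\<lambda>f z. S f z + T f z) \<in> nuclear_closure X Y C"
    and C_scale: "S \<in> C \<Longrightarrow> (\<lambda>f z. c * S f z) \<in> nuclear_closure X Y C"
begin

abbreviation "E \<equiv> nuclear_closure X Y C"

lemma closure_add:
  assumes "S \<in> E" "T \<in> E"
  shows "(\<lambda>f z. S f z + T f z) \<in> E"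
proof (rule nuclear_closure_closed)
  fix e :: real assume "e > 0"
  then have e: "e / 2 > 0" by simp
  obtain S' T' where *: "S' \<in> C" "T' \<in> C" "nuclear_le X Y (\<lambda>f z. S f z - S' f z) (e / 2)"
    "nuclear_le X Y (\<lambda>f z. T f z - T' f z) (e / 2)"
    using nuclear_closureD[OF assms(1) e] nuclear_closureD[OF assms(2) e] by blast
  have "nuclear_le X Y (\<lambda>f z. (S f z + T f z) - (S' f z + T' f z)) e"
    using nuclear_le_add[OF *(3,4)] by (simp add: algebra_simps)
  then show "\<exists>R\<in>E. nuclear_le X Y (\<lambda>f z. (S f z + T f z) - R f z) e"
    using C_add[OF *(1,2)] by (intro bexI[of _ "\<lambda>f z. S' f z + T' f z"])
qed

lemma closure_scale:
  assumes "S \<in> E"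
  shows "(\<lambda>f z. c * S f z) \<in> E"
proof (rule nuclear_closure_closed)
  fix e :: real assume "e > 0"
  then have e: "e / (cmod c + 1) > 0" by (simp add: add_nonneg_pos)
  obtain S' where *: "S' \<in> C" "nuclear_le X Y (\<lambda>f z. S f z - S' f z) (e / (cmod c + 1))"
    using nuclear_closureD[OF assms(1) e] by blast
  have "cmod c * (e / (cmod c + 1)) \<le> e"
    using \<open>e > 0\<close> mult_left_mono[of "cmod c" "cmod c + 1" e]
    by (simp add: pos_divide_le_eq add_nonneg_pos mult.commute)
  with nuclear_le_scale[OF *(2), of c]
  have "nuclear_le X Y (\<lambda>f z. c * S f z - c * S' f z) e"
    by (auto simp: algebra_simps intro: nuclear_le_mono)
  then show "\<exists>R\<in>E. nuclear_le X Y (\<lambda>f z. c * S f z - R f z) e"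
    using C_scale[OF *(1), of c] by (intro bexI[of _ "\<lambda>f z. c * S' f z"])
qed

lemma closure_sum:
  assumes "\<And>i. i \<in> I \<Longrightarrow> S i \<in> E"
  shows "(\<lambda>f z. \<Sum>i\<in>I. S i f z) \<in> E"
  using assms
proof (induction I rule: infinite_finite_induct)
  case (insert i I)
  then show ?case using closure_add[of "S i" "\<lambda>f z. \<Sum>i\<in>I. S i f z"] by simp
qed (use C_0 subset_nuclear_closure in auto)

text \<open>
  Replacing \<open>l\<close> by a combination of the \<open>c\<^sub>i\<close>, and then \<open>y\<close> by a combination of the \<open>u\<^sub>j\<close>, leaves two
  errors of rank one, \<open>(l - l') \<otimes> y\<close> and \<open>l' \<otimes> (y - y')\<close>, with nuclear norms at most products of norms.
\<close>
lemma nuclear_closure_rank_one: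
  assumes cu: "\<And>i j. (\<lambda>f z. c i f * u j z) \<in> E"
    and c: "\<And>i. c i \<in> dual X" and u: "\<And>j. u j \<in> points Y"
    and c_dense: "\<And>l e. l \<in> dual X \<Longrightarrow> e > 0 \<Longrightarrow>
      \<exists>n a. \<forall>f\<in>points X. cmod (l f - (\<Sum>i<n. a i * c i f)) \<le> e * nrm X f"
    and u_dense: "\<And>y e. y \<in> points Y \<Longrightarrow> e > 0 \<Longrightarrow>
      \<exists>n b. nrm Y (\<lambda>z. y z - (\<Sum>j<n. b j * u j z)) \<le> e"
    and l: "l \<in> dual X" and y: "y \<in> points Y"
  shows "(\<lambda>f z. l f * y z) \<in> E"
proof (rule nuclear_closure_closed)
  fix e :: real assume e: "e > 0"
  define d where "d = e / 2 / (nrm Y y + 1)"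
  have d: "d > 0" "d * nrm Y y \<le> e / 2"
    using e Y.nrm_nonneg[of y] by (auto simp: d_def field_simps add_nonneg_pos)
  obtain n a where a: "\<And>f. f \<in> points X \<Longrightarrow> cmod (l f - (\<Sum>i<n. a i * c i f)) \<le> d * nrm X f"
    using c_dense[OF l d(1)] by blast
  define l' where "l' = (\<lambda>f\<in>points X. \<Sum>i<n. a i * c i f)"
  have l'_bound: "cmod (\<Sum>i<n. a i * c i f) \<le> (\<Sum>i<n. cmod (a i) * dual_norm X (c i)) * nrm X f"
    if "f \<in> points X" for f
  proof -
    have "cmod (\<Sum>i<n. a i * c i f) \<le> (\<Sum>i<n. cmod (a i) * (dual_norm X (c i) * nrm X f))"
      using c that by (intro sum_norm_le) (auto simp: norm_mult intro!: mult_left_mono X.dual_le)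
    then show ?thesis by (simp add: sum_distrib_right mult.assoc)
  qed
  have l': "l' \<in> dual X" unfolding l'_def
    by (rule X.dualI[OF _ _ l'_bound])
      (use c in \<open>auto simp: X.dual_add X.dual_scale distrib_left sum.distrib sum_distrib_left mult_ac\<close>)
  have ll': "dual_norm X (\<lambda>f\<in>points X. l f - l' f) \<le> d"
    using a d(1) by (intro X.dual_norm_le) (auto simp: l'_def)
  have ll'm: "(\<lambda>f\<in>points X. l f - l' f) \<in> dual X"
    using l l' a by (intro X.dualI[where B = d])
      (auto simp: l'_def[symmetric] X.dual_add X.dual_scale X.add_mem X.scale_mem algebra_simps, simp add: l'_def)
  define d' where "d' = e / 2 / (dual_norm X l' + 1)"
  have d': "d' > 0" "dual_norm X l' * d' \<le> e / 2"
    using e X.dual_norm_nonneg[OF l'] by (auto simp: d'_def field_simps add_nonneg_pos)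
  obtain m b where b: "nrm Y (\<lambda>z. y z - (\<Sum>j<m. b j * u j z)) \<le> d'"
    using u_dense[OF y d'(1)] by blast
  define y' where "y' z = (\<Sum>j<m. b j * u j z)" for z
  have y': "y' \<in> points Y" unfolding y'_def[abs_def] using u by (intro Y.sum_mem Y.scale_mem)
  have "nuclear_le X Y (\<lambda>f z. (\<lambda>f\<in>points X. l f - l' f) f * y z) (e / 2)"
    using nuclear_le_rank_one[OF ll'm y] ll' d(2) mult_right_mono[OF ll' Y.nrm_nonneg[of y]]
    by (auto intro: nuclear_le_mono)
  moreover have "nuclear_le X Y (\<lambda>f z. l' f * (y z - y' z)) (e / 2)"
    using nuclear_le_rank_one[OF l' Y.diff_mem[OF y y']] d'(2) b
      mult_left_mono[OF b X.dual_norm_nonneg[OF l']]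
    by (auto simp: y'_def intro: nuclear_le_mono)
  ultimately have "nuclear_le X Y (\<lambda>f z. (\<lambda>f\<in>points X. l f - l' f) f * y z + l' f * (y z - y' z)) (e / 2 + e / 2)"
    by (rule nuclear_le_add)
  then have 1: "nuclear_le X Y (\<lambda>f z. l f * y z - l' f * y' z) e"
    by (subst nuclear_le_cong[where S = "\<lambda>f z. (\<lambda>f\<in>points X. l f - l' f) f * y z + l' f * (y z - y' z)"])
      (auto simp: algebra_simps)
  have "(\<lambda>f z. \<Sum>i<n. \<Sum>j<m. (a i * b j) * (c i f * u j z)) \<in> E"
    by (intro closure_sum closure_scale cu)
  then have "(\<lambda>f z. l' f * y' z) \<in> E"
    by (subst nuclear_closure_cong[where S = "\<lambda>f z. \<Sum>i<n. \<Sum>j<m. (a i * b j) * (c i f * u j z)"])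
      (auto simp: l'_def y'_def sum_product mult_ac)
  with 1 show "\<exists>S\<in>E. nuclear_le X Y (\<lambda>f z. l f * y z - S f z) e"
    by (intro bexI[of _ "\<lambda>f z. l' f * y' z"])
qed

text \<open>
  The tail of a nuclear representation is small in nuclear norm, and what precedes it is a finite sum
  of operators of rank one.
\<close>
lemma nuclear_closure_all:
  assumes rank1: "\<And>l y. l \<in> dual X \<Longrightarrow> y \<in> points Y \<Longrightarrow> (\<lambda>f z. l f * y z) \<in> E"
    and "nuclear_le X Y T s"
  shows "T \<in> E"
proof (rule nuclear_closure_closed)
  fix e :: real assume e: "e > 0"
  obtain l y where T: "\<And>f. f \<in> points X \<Longrightarrow> T f \<in> points Y"
    and ly: "\<And>j. l j \<in> dual X" "\<And>j. y j \<in> points Y"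
    and le: "\<And>n. mass l y n \<le> s"
    and lim: "\<And>f. f \<in> points X \<Longrightarrow> (\<lambda>n. err T l y f n) \<longlonglongrightarrow> 0"
    and sm: "summable (\<lambda>j. dual_norm X (l j) * nrm Y (y j))"
    using assms(2) by (rule nuclear_leE) blast
  obtain N where N: "\<And>n. n \<ge> N \<Longrightarrow> norm (\<Sum>i. dual_norm X (l (i + n)) * nrm Y (y (i + n))) < e"
    using suminf_exist_split[OF e sm] by blast
  have sm': "summable (\<lambda>j. dual_norm X (l (j + N)) * nrm Y (y (j + N)))"
    using sm by (subst summable_iff_shift)
  have "nuclear_le X Y (\<lambda>f z. T f z - (\<Sum>j<N. l j f * y j z)) e"
  proof (rule nuclear_leI[where l = "\<lambda>j. l (j + N)" and y = "\<lambda>j. y (j + N)"])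
    fix n
    have "(\<Sum>j<n. dual_norm X (l (j + N)) * nrm Y (y (j + N))) \<le> (\<Sum>i. dual_norm X (l (i + N)) * nrm Y (y (i + N)))"
      using sm' ly by (intro sum_le_suminf) (auto simp: Y.nrm_nonneg X.dual_norm_nonneg)
    with N[of N] show "(\<Sum>j<n. dual_norm X (l (j + N)) * nrm Y (y (j + N))) \<le> e" by simp
  next
    fix f assume f: "f \<in> points X"
    have "(\<Sum>j<N. l j f * y j z) + (\<Sum>j<n. l (j + N) f * y (j + N) z) = (\<Sum>j<n + N. l j f * y j z)" for n z
      by (induction n) (auto simp: add_ac)
    then have "T f z - (\<Sum>j<N. l j f * y j z) - (\<Sum>j<n. l (j + N) f * y (j + N) z) = T f z - (\<Sum>j<n + N. l j f * y j z)" for n z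
      by (simp only: diff_diff_eq)
    then show "(\<lambda>n. nrm Y (\<lambda>z. T f z - (\<Sum>j<N. l j f * y j z) - (\<Sum>j<n. l (j + N) f * y (j + N) z))) \<longlonglongrightarrow> 0"
      using LIMSEQ_ignore_initial_segment[OF lim[OF f], of N] by presburger
  qed (use T ly in \<open>auto intro!: Y.diff_mem Y.sum_mem Y.scale_mem\<close>)
  moreover have "(\<lambda>f z. \<Sum>j<N. l j f * y j z) \<in> E"
    using ly by (intro closure_sum rank1)
  ultimately show "\<exists>S\<in>E. nuclear_le X Y (\<lambda>f z. T f z - S f z) e"
    by (intro bexI[of _ "\<lambda>f z. \<Sum>j<N. l j f * y j z"])
qed

end

section \<open>Inequalities for powers\<close>

text \<open>
  Convexity at \<open>x + y = t (x/t) + (1 - t) (y/(1 - t))\<close>. With the best \<open>t\<close> this yields the triangle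
  inequality, with \<open>t\<close> close to \<open>1\<close> the inequality behind the Brezis-Lieb lemma.
\<close>
lemma powr_add_le_convex:
  fixes x y t p :: real
  assumes "x \<ge> 0" "y \<ge> 0" "0 < t" "t < 1" "p \<ge> 1"
  shows "(x + y) powr p \<le> t powr (1 - p) * x powr p + (1 - t) powr (1 - p) * y powr p"
proof -
  have ge1: "s powr (1 - p) \<ge> 1" if "0 < s" "s < 1" for s :: real
    using powr_mono2'[of "1 - p" s 1] that assms by simp
  consider "x = 0" | "y = 0" | "x > 0" "y > 0" using assms by linarith
  then show ?thesis
  proof cases
    case 1
    then show ?thesis using ge1[of "1 - t"] mult_right_mono[of 1 "(1 - t) powr (1 - p)" "y powr p"] assms by simp
  next
    case 2
    then show ?thesis using ge1[of t] mult_right_mono[of 1 "t powr (1 - p)" "x powr p"] assms by simp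
  next
    case 3
    have eq: "s * (v / s) powr p = s powr (1 - p) * v powr p" if "s > 0" "v > 0" for s v :: real
      using that by (simp add: powr_divide powr_diff)
    have "((1 - t) *\<^sub>R (y / (1 - t)) + t *\<^sub>R (x / t)) powr p
        \<le> (1 - t) * (y / (1 - t)) powr p + t * (x / t) powr p"
      using powr_convex[OF assms(5)] assms 3 by (intro convex_onD) auto
    then show ?thesis using assms 3 by (simp add: eq add.commute)
  qed
qed

text \<open>
  To be applied to \<open>x = |u|\<close>, \<open>y = |v|\<close> and \<open>s = |u + v|\<close>: in the difference of the \<open>p\<close>-th powers of
  \<open>|u + v|\<close> and \<open>|v|\<close>, the share that is not controlled by \<open>u\<close> is as small as desired.
\<close>
lemma powr_diff_le:
  fixes e p :: real
  assumes "e > 0" "p \<ge> 1"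
  obtains C where "C \<ge> 0"
    "\<And>x y s. \<lbrakk>x \<ge> 0; y \<ge> 0; s \<ge> 0; s \<le> x + y; y \<le> s + x\<rbrakk> \<Longrightarrow> \<bar>s powr p - y powr p\<bar> \<le> e * y powr p + C * x powr p"
proof -
  define d where "d = min 1 (e / 2)"
  have d: "0 < d" "d \<le> 1" "2 * d \<le> e" using assms by (auto simp: d_def)
  \<comment> \<open>chosen such that \<open>t\<^bsup>1-p\<^esup> \<le> 1 + d\<close>\<close>
  define t where "t = (1 + d) powr (- (1 / p))"
  have t0: "t > 0" using d by (simp add: t_def)
  have t1: "t < 1" using d assms powr_less_mono[of "- (1 / p)" 0 "1 + d"] by (simp add: t_def)
  have "t powr (1 - p) = (1 + d) powr ((p - 1) / p)"
  proof -
    have "- (1 / p) * (1 - p) = (p - 1) / p" using assms by (simp add: field_simps)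
    then show ?thesis by (simp only: t_def powr_powr)
  qed
  also have "\<dots> \<le> (1 + d) powr 1" using d assms by (intro powr_mono) auto
  finally have t2: "t powr (1 - p) \<le> 1 + d" using d by simp
  define C where "C = (1 - t) powr (1 - p)"
  have C: "C \<ge> 0" by (simp add: C_def)
  have le: "v powr p \<le> (1 + d) * y powr p + C * x powr p" if "x \<ge> 0" "y \<ge> 0" "v \<ge> 0" "v \<le> x + y" for x y v
  proof -
    have "v powr p \<le> (y + x) powr p" using that assms by (intro powr_mono2) auto
    also have "\<dots> \<le> t powr (1 - p) * y powr p + C * x powr p"
      unfolding C_def using that t0 t1 assms by (intro powr_add_le_convex) auto
    also have "\<dots> \<le> (1 + d) * y powr p + C * x powr p"
      using t2 by (intro add_mono mult_right_mono) auto
    finally show ?thesis .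
  qed
  show ?thesis
  proof (rule that[of "2 * C"])
    fix x y s :: real assume *: "x \<ge> 0" "y \<ge> 0" "s \<ge> 0" "s \<le> x + y" "y \<le> s + x"
    have 1: "s powr p \<le> (1 + d) * y powr p + C * x powr p" using * by (intro le) auto
    have 2: "y powr p \<le> (1 + d) * s powr p + C * x powr p" using * by (intro le) auto
    have 3: "d * s powr p \<le> d * ((1 + d) * y powr p + C * x powr p)"
      using 1 d by (intro mult_left_mono) auto
    have 4: "d * (1 + d) * y powr p \<le> e * y powr p" "d * y powr p \<le> e * y powr p"
      using d mult_left_mono[of d 1 d] by (auto intro!: mult_right_mono simp: distrib_left, linarith)
    have 5: "d * (C * x powr p) \<le> C * x powr p" "0 \<le> C * x powr p"
      using d C mult_right_mono[of d 1 "C * x powr p"] by auto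
    show "\<bar>s powr p - y powr p\<bar> \<le> e * y powr p + 2 * C * x powr p"
      unfolding abs_le_iff using 1 2 3 4 5 by (simp add: algebra_simps)
  qed (use C in simp)
qed

section \<open>Taylor coefficients and radial weights\<close>

lemma integrable_le:
  fixes f g :: "'a \<Rightarrow> real"
  assumes "integrable M g" "f \<in> borel_measurable M" "\<And>x. \<bar>f x\<bar> \<le> g x"
  shows "integrable M f"
  by (rule Bochner_Integration.integrable_bound[OF assms(1,2)])
    (use assms(3) in \<open>auto intro!: always_eventually intro: order_trans[OF _ abs_ge_self]\<close>)

lemma integrable_indicator_cball:
  "integrable lborel (indicator (cball a R) :: 'a::euclidean_space \<Rightarrow> real)"
  by (rule integrable_real_indicator[OF _ emeasure_lborel_cball_finite]) simp

definition coef :: "nat \<Rightarrow> (complex \<Rightarrow> complex) \<Rightarrow> complex" where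
  "coef n f = (deriv ^^ n) f 0 / fact n"

lemma coef_sums:
  assumes "f holomorphic_on UNIV"
  shows "(\<lambda>n. coef n f * z ^ n) sums f z"
  using holomorphic_power_series[of f 0 "cmod z + 1" z] assms holomorphic_on_subset
  by (auto simp: coef_def)

lemma coef_add:
  assumes "f holomorphic_on UNIV" "g holomorphic_on UNIV"
  shows "coef n (\<lambda>z. f z + g z) = coef n f + coef n g"
  using higher_deriv_add[OF assms] by (simp add: coef_def add_divide_distrib)

lemma coef_scale:
  assumes "f holomorphic_on UNIV"
  shows "coef n (\<lambda>z. c * f z) = c * coef n f"
  using higher_deriv_cmult[OF assms] by (simp add: coef_def)

lemma summable_coef_norm:
  assumes "f holomorphic_on UNIV"
  shows "summable (\<lambda>n. cmod (coef n f) * R ^ n)"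
proof -
  have "summable (\<lambda>n. norm (coef n f * of_real R ^ n))"
    by (rule powser_insidea[of _ "of_real (\<bar>R\<bar> + 1)"]) (use coef_sums[OF assms] in \<open>auto simp: sums_iff\<close>)
  then have "summable (\<lambda>n. norm (cmod (coef n f) * R ^ n))" by (simp add: norm_mult norm_power abs_mult power_abs)
  then show ?thesis by (rule summable_norm_cancel)
qed

text \<open>
  In the Taylor expansion of \<open>f\<close> only one term survives, by orthogonality of the monomials. For
  \<open>a = b = 0\<close> and \<open>\<eta>\<close> the indicator function of an interval, this is the mean value property on a
  disc.
\<close>
lemma integral_radial_moment:
  fixes \<eta> :: "real \<Rightarrow> real" and f :: "complex \<Rightarrow> complex"
  assumes f: "f holomorphic_on UNIV"
    and [measurable]: "\<eta> \<in> borel_measurable borel"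
    and bound: "\<And>s. \<bar>\<eta> s\<bar> \<le> M" and supp: "\<And>s. s > R \<Longrightarrow> \<eta> s = 0" and R: "R > 0"
  shows "(LINT z|lborel. cnj z ^ a * z ^ b * f z * of_real (\<eta> (cmod z))) =
    (if b \<le> a then coef (a - b) f * of_real (LINT z|lborel. cmod z ^ (2 * a) * \<eta> (cmod (z :: complex))) else 0)"
proof -
  let ?m = "LINT z|lborel. cmod z ^ (2 * a) * \<eta> (cmod (z :: complex))"
  define t where "t j z = coef j f * (cnj z ^ a * z ^ (b + j) * of_real (\<eta> (cmod z)))" for j z
  have M: "M \<ge> 0" using bound[of 0] by linarith
  have cont: "continuous_on UNIV (\<lambda>z. cnj z ^ a * z ^ k)" for k
    by (intro continuous_intros)
  have [measurable]: "(\<lambda>z. cnj z ^ a * z ^ k) \<in> borel_measurable borel" for k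
    by (intro borel_measurable_continuous_onI cont)
  have [measurable]: "t j \<in> borel_measurable borel" for j
    unfolding t_def[abs_def] by measurable
  have tb: "cmod (t j z) \<le> M * R ^ (a + b) * (cmod (coef j f) * R ^ j) * indicator (cball 0 R) z" for j z
  proof (cases "cmod z \<le> R")
    case True
    have "cmod (t j z) = cmod (coef j f) * (cmod z ^ (a + b + j) * \<bar>\<eta> (cmod z)\<bar>)"
      by (simp add: t_def norm_mult norm_power power_add)
    also have "\<dots> \<le> cmod (coef j f) * (R ^ (a + b + j) * M)"
      using True bound M R by (intro mult_left_mono mult_mono power_mono) auto
    finally show ?thesis using True by (simp add: power_add mult_ac)
  next
    case False
    then show ?thesis using supp[of "cmod z"] by (simp add: t_def)
  qed
  have iB: "integrable lborel (\<lambda>z::complex. M * R ^ (a + b) * (cmod (coef j f) * R ^ j) * indicator (cball 0 R) z)" for j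
    by (intro integrable_mult_right integrable_indicator_cball)
  have it: "integrable lborel (t j)" for j
    by (rule Bochner_Integration.integrable_bound[OF iB[of j]])
      (use tb[of j] in \<open>auto intro!: always_eventually intro: order_trans[OF _ abs_ge_self]\<close>)
  have sm: "summable (\<lambda>j. M * R ^ (a + b) * (cmod (coef j f) * R ^ j))"
    using summable_coef_norm[OF f, of R] by (rule summable_mult)
  have smt: "summable (\<lambda>j. norm (t j z))" for z
    by (rule summable_comparison_test'[OF summable_mult2[OF sm, of "indicator (cball 0 R) z"]])
      (use tb[of _ z] in simp)
  have "(\<lambda>j. integral\<^sup>L lborel (t j)) sums (LINT z|lborel. (\<Sum>j. t j z))"
  proof (rule sums_integral[OF it])
    show "AE z in lborel. summable (\<lambda>j. norm (t j z))" using smt by simp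
    show "summable (\<lambda>j. LINT z|lborel. norm (t j z))"
    proof (rule summable_comparison_test'[OF summable_mult2[OF sm, of "measure lborel (cball (0::complex) R)"]])
      fix j
      have "(LINT z|lborel. norm (t j z)) \<le>
        (LINT z|lborel. M * R ^ (a + b) * (cmod (coef j f) * R ^ j) * indicator (cball (0::complex) R) z)"
        using tb it iB by (intro integral_mono) auto
      then show "norm (LINT z|lborel. norm (t j z)) \<le>
          M * R ^ (a + b) * (cmod (coef j f) * R ^ j) * measure lborel (cball (0::complex) R)"
        by simp
    qed
  qed
  moreover have "(\<Sum>j. t j z) = cnj z ^ a * z ^ b * f z * of_real (\<eta> (cmod z))" for z
  proof -
    have "(\<lambda>j. (cnj z ^ a * z ^ b * of_real (\<eta> (cmod z))) * (coef j f * z ^ j)) sums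
        ((cnj z ^ a * z ^ b * of_real (\<eta> (cmod z))) * f z)"
      by (intro sums_mult coef_sums f)
    then show ?thesis by (simp add: t_def sums_iff power_add mult_ac)
  qed
  moreover have "integral\<^sup>L lborel (t j) =
    (if b + j = a then coef j f * of_real ?m else 0)" for j
  proof (cases "b + j = a")
    case True
    have "cnj z ^ a * z ^ a * of_real (\<eta> (cmod z)) = of_real (cmod z ^ (2 * a) * \<eta> (cmod z))" for z
    proof -
      have "cnj z ^ a * z ^ a = of_real ((cmod z)\<^sup>2) ^ a"
        using complex_norm_square[of z] by (simp add: power_mult_distrib[symmetric] mult.commute)
      then show ?thesis by (simp add: power_mult)
    qed
    then have "t j = (\<lambda>z. coef j f * of_real (cmod z ^ (2 * a) * \<eta> (cmod z)))"
      using True by (simp add: t_def fun_eq_iff)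
    then show ?thesis
      using True by (simp only: integral_mult_right_zero integral_complex_of_real refl if_True)
  next
    case False
    then show ?thesis
      using integral_monomials_eq_0[of "\<lambda>s. of_real (\<eta> s)" a "b + j"] by (simp add: t_def[abs_def])
  qed
  ultimately have s: "(\<lambda>j. if b + j = a then coef j f * of_real ?m else 0)
     sums (LINT z|lborel. cnj z ^ a * z ^ b * f z * of_real (\<eta> (cmod z)))" by simp
  show ?thesis
  proof (cases "b \<le> a")
    case True
    then have "b + j = a \<longleftrightarrow> j = a - b" for j by auto
    with s have "(\<lambda>j. if j = a - b then coef j f * of_real ?m else 0)
      sums (LINT z|lborel. cnj z ^ a * z ^ b * f z * of_real (\<eta> (cmod z)))" by simp
    from sums_unique2[OF this sums_single] show ?thesis using True by simp
  next
    case False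
    then have "b + j \<noteq> a" for j by simp
    with False sums_unique2[OF s] show ?thesis by simp
  qed
qed

section \<open>The Fock space as a normed space\<close>

locale fock_space =
  fixes \<alpha> p :: real
  assumes \<alpha>: "\<alpha> > 0" and p: "p \<ge> 1"
begin

abbreviation "F \<equiv> points (fock \<alpha> p)"
abbreviation "N \<equiv> nrm (fock \<alpha> p)"
abbreviation "dN \<equiv> dual_norm (fock \<alpha> p)"

definition wt :: "(complex \<Rightarrow> complex) \<Rightarrow> complex \<Rightarrow> real" where
  "wt f z = cmod (f z) * exp (- (\<alpha> / 2) * (cmod z)\<^sup>2)"

definition c0 :: real where "c0 = p * \<alpha> / (2 * pi)"

lemma c0: "c0 > 0" using \<alpha> p by (simp add: c0_def)

lemma wt_nonneg [simp]: "wt f z \<ge> 0" by (simp add: wt_def)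

lemma wt_eq: "cmod (f z * complex_of_real (exp (- (\<alpha> / 2) * (cmod z)\<^sup>2))) = wt f z"
  by (simp add: wt_def norm_mult)

lemma F_iff: "f \<in> F \<longleftrightarrow> f holomorphic_on UNIV \<and> integrable lborel (\<lambda>z. wt f z powr p)"
  by (simp only: fock_def fun_space.select_convs mem_Collect_eq wt_eq)

lemma N_eq: "N f = (c0 * (LINT z|lborel. wt f z powr p)) powr (1 / p)"
  by (simp only: fock_def fun_space.select_convs wt_eq c0_def)

lemma holo: "f \<in> F \<Longrightarrow> f holomorphic_on UNIV"
  and intg: "f \<in> F \<Longrightarrow> integrable lborel (\<lambda>z. wt f z powr p)"
  by (auto simp: F_iff)

lemma integral_wt_nonneg: "(LINT z|lborel. wt f z powr p) \<ge> 0"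
  by (intro integral_nonneg_AE) auto

lemma N_powr: "N f powr p = c0 * (LINT z|lborel. wt f z powr p)"
  using c0 p integral_wt_nonneg[of f] by (simp add: N_eq powr_powr)

lemma N_nonneg: "N f \<ge> 0" by (simp add: N_eq)

lemma N_leI:
  assumes "c0 * (LINT z|lborel. wt f z powr p) \<le> M powr p" "M \<ge> 0"
  shows "N f \<le> M"
proof (rule ccontr)
  assume "\<not> N f \<le> M"
  then have "M powr p < N f powr p" using assms p by (intro powr_less_mono2) auto
  then show False using assms by (simp add: N_powr)
qed

lemma wt_add: "wt (\<lambda>z. f z + g z) z \<le> wt f z + wt g z"
  unfolding wt_def distrib_right[symmetric] by (intro mult_right_mono norm_triangle_ineq) auto

lemma wt_measurable:
  assumes "f holomorphic_on UNIV"
  shows "wt f \<in> borel_measurable borel"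
  unfolding wt_def[abs_def] using holomorphic_on_imp_continuous_on[OF assms]
  by (intro borel_measurable_continuous_onI continuous_intros)

lemma convex_bound:
  assumes "f \<in> F" "g \<in> F" "0 < t" "t < 1"
  shows "(\<lambda>z. f z + g z) \<in> F"
    "N (\<lambda>z. f z + g z) powr p \<le> t powr (1 - p) * N f powr p + (1 - t) powr (1 - p) * N g powr p"
proof -
  have [measurable]: "wt (\<lambda>z. f z + g z) \<in> borel_measurable borel"
    using assms by (intro wt_measurable holomorphic_intros holo)
  have le: "wt (\<lambda>z. f z + g z) z powr p \<le> t powr (1 - p) * wt f z powr p + (1 - t) powr (1 - p) * wt g z powr p" for z
  proof -
    have "wt (\<lambda>z. f z + g z) z powr p \<le> (wt f z + wt g z) powr p"
      using p wt_add by (intro powr_mono2) auto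
    also have "\<dots> \<le> t powr (1 - p) * wt f z powr p + (1 - t) powr (1 - p) * wt g z powr p"
      using assms p by (intro powr_add_le_convex) auto
    finally show ?thesis .
  qed
  have i: "integrable lborel (\<lambda>z. t powr (1 - p) * wt f z powr p + (1 - t) powr (1 - p) * wt g z powr p)"
    using assms intg by auto
  have i2: "integrable lborel (\<lambda>z. wt (\<lambda>z. f z + g z) z powr p)"
    by (rule integrable_le[OF i]) (use le in auto)
  then show "(\<lambda>z. f z + g z) \<in> F"
    using assms by (auto simp: F_iff intro!: holomorphic_intros)
  have "(LINT z|lborel. wt (\<lambda>z. f z + g z) z powr p) \<le>
     (LINT z|lborel. t powr (1 - p) * wt f z powr p + (1 - t) powr (1 - p) * wt g z powr p)"
    using i i2 le by (intro integral_mono) auto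
  also have "\<dots> = t powr (1 - p) * (LINT z|lborel. wt f z powr p) + (1 - t) powr (1 - p) * (LINT z|lborel. wt g z powr p)"
    using assms intg by simp
  finally have "c0 * (LINT z|lborel. wt (\<lambda>z. f z + g z) z powr p) \<le>
     c0 * (t powr (1 - p) * (LINT z|lborel. wt f z powr p) + (1 - t) powr (1 - p) * (LINT z|lborel. wt g z powr p))"
    using c0 by (intro mult_left_mono) auto
  then show "N (\<lambda>z. f z + g z) powr p \<le> t powr (1 - p) * N f powr p + (1 - t) powr (1 - p) * N g powr p"
    by (simp add: N_powr algebra_simps)
qed

lemma F_add: "f \<in> F \<Longrightarrow> g \<in> F \<Longrightarrow> (\<lambda>z. f z + g z) \<in> F"
  by (rule convex_bound(1)[of f g "1/2"]) auto

lemma N_add: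
  assumes "f \<in> F" "g \<in> F"
  shows "N (\<lambda>z. f z + g z) \<le> N f + N g"
proof (rule field_le_epsilon)
  fix e :: real assume e: "e > 0"
  \<comment> \<open>The slack makes both numbers positive, so that \<open>a / (a + b)\<close> lies strictly between \<open>0\<close> and \<open>1\<close>.\<close>
  define a where "a = N f + e / 2"
  define b where "b = N g + e / 2"
  have ab: "a > 0" "b > 0" "N f \<le> a" "N g \<le> b" using e N_nonneg[of f] N_nonneg[of g] by (auto simp: a_def b_def)
  define t where "t = a / (a + b)"
  have t: "0 < t" "t < 1" "1 - t = b / (a + b)" using ab by (auto simp: t_def field_simps)
  have eq: "(x / (a + b)) powr (1 - p) * x powr p = x * (a + b) powr (p - 1)" if "x > 0" for x
  proof -
    have "(x / (a + b)) powr (1 - p) * x powr p = (x powr (1 - p) * x powr p) / (a + b) powr (1 - p)"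
      using ab that by (simp add: powr_divide)
    also have "x powr (1 - p) * x powr p = x" using that by (simp add: powr_add[symmetric])
    also have "x / (a + b) powr (1 - p) = x * (a + b) powr (p - 1)"
      using ab by (simp add: powr_minus_divide[symmetric] divide_inverse powr_minus[symmetric])
    finally show ?thesis .
  qed
  have "N (\<lambda>z. f z + g z) powr p \<le> t powr (1 - p) * N f powr p + (1 - t) powr (1 - p) * N g powr p"
    using assms t by (intro convex_bound) auto
  also have "\<dots> \<le> t powr (1 - p) * a powr p + (1 - t) powr (1 - p) * b powr p"
    using ab p N_nonneg by (intro add_mono mult_left_mono powr_mono2) auto
  also have "\<dots> = (a + b) * (a + b) powr (p - 1)"
    unfolding t(3) unfolding t_def eq[OF ab(1)] eq[OF ab(2)] by (simp add: distrib_right)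
  also have "\<dots> = (a + b) powr p" using ab by (simp add: powr_mult_base)
  finally have "N (\<lambda>z. f z + g z) \<le> a + b"
    using ab by (intro N_leI) (auto simp: N_powr)
  then show "N (\<lambda>z. f z + g z) \<le> N f + N g + e" by (simp add: a_def b_def)
qed

lemma wt_scale: "wt (\<lambda>z. c * f z) z = cmod c * wt f z"
  by (simp add: wt_def norm_mult)

lemma F_scale: "f \<in> F \<Longrightarrow> (\<lambda>z. c * f z) \<in> F"
  by (auto simp: F_iff wt_scale powr_mult intro!: holomorphic_intros)

lemma N_scale: "N (\<lambda>z. c * f z) = cmod c * N f"
  using p c0 by (simp add: N_eq wt_scale powr_mult powr_powr mult.left_commute[of c0] integral_wt_nonneg)

text \<open>
  The mean value property on the unit disc is applied to \<open>g(w) = f(a + w) exp(- \<alpha> w cnj a)\<close>. The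
  exponential factor turns the weight at \<open>a + w\<close> into the weight at \<open>a\<close>, up to a bounded factor:
  \<open>|g(w)| = wt f (a + w) exp(\<alpha>/2 |a|\<^sup>2) exp(\<alpha>/2 |w|\<^sup>2)\<close>. The passage from the mean of \<open>|g|\<close> to that of
  its \<open>p\<close>-th power is by \<open>x \<le> s + s\<^bsup>1-p\<^esup> x\<^sup>p\<close>.
\<close>
lemma pointwise_bound: "\<exists>K>0. \<forall>f\<in>F. \<forall>z. cmod (f z) \<le> K * exp (\<alpha> / 2 * (cmod z)\<^sup>2) * N f"
proof -
  define V where "V = measure lborel (cball (0::complex) 1)"
  have V: "V > 0" unfolding V_def by (simp add: content_cball_pos)
  define K where "K = 1 + exp (p * \<alpha> / 2) / (c0 * V)"
  have K: "K > 0" using V c0 by (simp add: K_def add_pos_pos)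
  \<comment> \<open>A number \<open>s > 0\<close> instead of the norm covers the case of norm \<open>0\<close>.\<close>
  have main: "cmod (f a) \<le> K * exp (\<alpha> / 2 * (cmod a)\<^sup>2) * s" if f: "f \<in> F" and s: "s > 0" "N f \<le> s" for f a s
  proof -
    define E where "E = exp (\<alpha> / 2 * (cmod a)\<^sup>2)"
    define g where "g w = f (a + w) * exp (- (of_real \<alpha> * w * cnj a))" for w
    have "(f \<circ> (\<lambda>w. a + w)) holomorphic_on UNIV"
      by (rule holomorphic_on_compose_gen[OF _ holo[OF f]]) (auto intro!: holomorphic_intros)
    then have g: "g holomorphic_on UNIV"
      unfolding g_def[abs_def] by (intro holomorphic_intros) (simp add: o_def)
    have gm[measurable]: "g \<in> borel_measurable borel"
      by (intro borel_measurable_continuous_onI holomorphic_on_imp_continuous_on g)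
    have "(LINT z|lborel. cnj z ^ 0 * z ^ 0 * g z * of_real (indicator {..1} (cmod z))) =
       coef 0 g * of_real (LINT z|lborel. cmod z ^ (2 * 0) * indicator {..1} (cmod (z::complex)))"
      using integral_radial_moment[OF g, of "indicator {..1}" 1 1 0 0] by (auto split: split_indicator)
    also have "(\<lambda>z::complex. cmod z ^ (2 * 0) * indicator {..1} (cmod z) :: real) = indicator (cball 0 1)"
      by (auto split: split_indicator)
    also have "(LINT z|lborel. indicator (cball (0::complex) 1) z :: real) = V"
      by (simp add: V_def)
    finally have "f a * of_real V = (LINT z|lborel. g z * of_real (indicator {..1} (cmod z)))"
      by (simp add: coef_def g_def)
    then have 1: "cmod (f a) * V \<le> (LINT z|lborel. cmod (g z * of_real (indicator {..1} (cmod z))))"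
      using V integral_norm_bound[of lborel "\<lambda>z. g z * of_real (indicator {..1} (cmod z))"]
      by (metis abs_of_pos norm_mult norm_of_real)
    define h where "h z = E * (s * indicator (cball 0 1) z + s powr (1 - p) * (exp (p * \<alpha> / 2) * wt f (a + z) powr p))" for z
    have [measurable]: "wt f \<in> borel_measurable borel" by (intro wt_measurable holo f)
    have tr: "integrable lborel (\<lambda>z. wt f (a + z) powr p)"
      "(LINT z|lborel. wt f (a + z) powr p) = (LINT z|lborel. wt f z powr p)"
      using integrable_lborel_translate_iff[of "\<lambda>z. wt f z powr p" a] intg[OF f] by auto
    have h: "integrable lborel h"
      unfolding h_def using tr
      by (intro integrable_mult_right Bochner_Integration.integrable_add integrable_indicator_cball)
    have le: "cmod (g z * of_real (indicator {..1} (cmod z))) \<le> h z" for z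
    proof (cases "cmod z \<le> 1")
      case True
      have "(cmod (a + z))\<^sup>2 = (cmod a)\<^sup>2 + (cmod z)\<^sup>2 + 2 * Re (z * cnj a)"
        unfolding cmod_power2 by (simp add: power2_eq_square algebra_simps)
      then have ex: "exp (- (\<alpha> * Re (z * cnj a))) = exp (- (\<alpha> / 2) * (cmod (a + z))\<^sup>2) * E * exp (\<alpha> / 2 * (cmod z)\<^sup>2)"
        by (simp add: E_def exp_add[symmetric] algebra_simps)
      have "cmod (g z) = cmod (f (a + z)) * exp (- (\<alpha> * Re (z * cnj a)))"
        by (simp add: g_def norm_mult norm_exp_eq_Re mult.assoc)
      also have "\<dots> = E * (wt f (a + z) * exp (\<alpha> / 2 * (cmod z)\<^sup>2))"
        unfolding ex by (simp add: wt_def)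
      also have "\<dots> \<le> E * (wt f (a + z) * exp (\<alpha> / 2))"
        using True \<alpha> by (intro mult_left_mono) (auto simp: E_def power_le_one)
      finally have 2: "cmod (g z) \<le> E * (wt f (a + z) * exp (\<alpha> / 2))" .
      define x where "x = wt f (a + z) * exp (\<alpha> / 2)"
      have x: "x \<ge> 0" by (simp add: x_def)
      have "x \<le> s + s powr (1 - p) * x powr p"
      proof (cases "x \<le> s")
        case True
        moreover have "0 \<le> s powr (1 - p) * x powr p" by simp
        ultimately show ?thesis by linarith
      next
        case False
        then have "x = x powr (1 - p) * x powr p" using s by (simp add: powr_add[symmetric])
        also have "\<dots> \<le> s powr (1 - p) * x powr p"
          using False s p by (intro mult_right_mono powr_mono2') auto
        finally show ?thesis using s by linarith
      qed
      moreover have "x powr p = exp (p * \<alpha> / 2) * wt f (a + z) powr p"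
        by (simp add: x_def powr_mult exp_powr_real mult.commute)
      ultimately show ?thesis
        using True 2 by (simp add: h_def x_def E_def) (meson exp_ge_zero mult_left_mono order_trans)
    next
      case False
      then show ?thesis using s by (simp add: h_def E_def)
    qed
    have ig: "integrable lborel (\<lambda>z. cmod (g z * of_real (indicator {..1} (cmod z))))"
      by (rule integrable_le[OF h]) (use le in auto)
    have "(LINT z|lborel. cmod (g z * of_real (indicator {..1} (cmod z)))) \<le> (LINT z|lborel. h z)"
      using ig h le by (intro integral_mono) auto
    also have "\<dots> = E * (s * V + s powr (1 - p) * (exp (p * \<alpha> / 2) * (LINT z|lborel. wt f z powr p)))"
      unfolding h_def using tr
      by (subst integral_mult_right_zero, subst Bochner_Integration.integral_add)
        (auto simp: V_def integrable_indicator_cball)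
    also have "(LINT z|lborel. wt f z powr p) = N f powr p / c0" using c0 by (simp add: N_powr)
    also have "E * (s * V + s powr (1 - p) * (exp (p * \<alpha> / 2) * (N f powr p / c0))) \<le>
        E * (s * V + s powr (1 - p) * (exp (p * \<alpha> / 2) * (s powr p / c0)))"
      using s c0 p N_nonneg by (intro mult_left_mono add_left_mono divide_right_mono powr_mono2) (auto simp: E_def)
    also have "s powr (1 - p) * (exp (p * \<alpha> / 2) * (s powr p / c0)) = s * exp (p * \<alpha> / 2) / c0"
      using s by (simp add: powr_diff)
    also have "E * (s * V + s * exp (p * \<alpha> / 2) / c0) = (K * E * s) * V"
      using V c0 by (simp add: K_def field_simps)
    finally have "cmod (f a) * V \<le> (K * E * s) * V" using 1 by linarith
    then show ?thesis using V by (simp add: E_def)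
  qed
  have "cmod (f a) \<le> K * exp (\<alpha> / 2 * (cmod a)\<^sup>2) * N f" if f: "f \<in> F" for f a
  proof (rule field_le_epsilon)
    fix e :: real assume e: "e > 0"
    define Q where "Q = K * exp (\<alpha> / 2 * (cmod a)\<^sup>2)"
    have Q: "Q > 0" using K by (simp add: Q_def)
    have "cmod (f a) \<le> Q * (N f + e / Q)"
      unfolding Q_def
    proof (rule main[OF f], unfold Q_def[symmetric])
      have "e / Q > 0" using e Q by simp
      then show "N f + e / Q > 0" "N f \<le> N f + e / Q" using N_nonneg[of f] by linarith+
    qed
    then show "cmod (f a) \<le> Q * N f + e" using Q by (simp add: distrib_left)
  qed
  then show ?thesis using K by blast
qed

sublocale normed_fun_space "fock \<alpha> p"
proof
  show "(\<lambda>_. 0) \<in> F" using p by (simp add: F_iff wt_def)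
  show "N (\<lambda>z. - f z) = N f" for f using N_scale[of "-1" f] by simp
  show "f = (\<lambda>_. 0)" if "f \<in> F" "N f = 0" for f
    using pointwise_bound that by fastforce
qed (use F_add F_scale N_nonneg N_add N_scale in auto)

end

lemma ex_mult_less:
  fixes S e :: real
  assumes "S \<ge> 0" "e > 0"
  shows "\<exists>d>0. d * S < e"
  using assms by (intro exI[of _ "e / (S + 1)"]) (auto simp: field_simps add_nonneg_pos)

context fock_space
begin

section \<open>Limits in the Fock space\<close>

lemma montel:
  assumes G: "\<And>k. G k \<in> F" and M: "\<And>k. N (G k) \<le> M"
  obtains g r where "g holomorphic_on UNIV" "strict_mono (r :: nat \<Rightarrow> nat)"
    "\<And>z. (\<lambda>k. G (r k) z) \<longlonglongrightarrow> g z"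
    "\<And>K. compact K \<Longrightarrow> uniform_limit K (G \<circ> r) g sequentially"
proof -
  obtain K where K: "K > 0" "\<And>f z. f \<in> F \<Longrightarrow> cmod (f z) \<le> K * exp (\<alpha> / 2 * (cmod z)\<^sup>2) * N f"
    using pointwise_bound by blast
  show ?thesis
  proof (rule Montel[of UNIV "{h \<in> F. N h \<le> M}" G])
    fix S :: "complex set" assume "compact S"
    then obtain R where R: "\<And>z. z \<in> S \<Longrightarrow> cmod z \<le> R"
      using compact_imp_bounded bounded_iff by metis
    have "cmod (h z) \<le> K * exp (\<alpha> / 2 * R\<^sup>2) * M" if "h \<in> F" "N h \<le> M" "z \<in> S" for h z
    proof -
      have "cmod (h z) \<le> K * exp (\<alpha> / 2 * (cmod z)\<^sup>2) * N h" using K that by blast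
      also have "\<dots> \<le> K * exp (\<alpha> / 2 * R\<^sup>2) * M"
        using K(1) \<alpha> R[OF that(3)] that(2) N_nonneg[of h]
        by (intro mult_mono) (auto intro!: mult_left_mono power_mono)
      finally show ?thesis .
    qed
    then show "\<exists>B. \<forall>h\<in>{h \<in> F. N h \<le> M}. \<forall>z\<in>S. cmod (h z) \<le> B" by blast
  next
    fix g r assume "g holomorphic_on UNIV" "strict_mono (r :: nat \<Rightarrow> nat)"
      "\<And>x. x \<in> UNIV \<Longrightarrow> (\<lambda>n. G (r n) x) \<longlonglongrightarrow> g x"
      "\<And>K. \<lbrakk>compact K; K \<subseteq> UNIV\<rbrakk> \<Longrightarrow> uniform_limit K (G \<circ> r) g sequentially"
    then show ?thesis by (intro that[of g r]) auto
  qed (use G M holo in auto)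
qed

lemma tendsto_wt_powr:
  assumes "(\<lambda>k. G k z) \<longlonglongrightarrow> f z"
  shows "(\<lambda>k. wt (G k) z powr p) \<longlonglongrightarrow> wt f z powr p"
proof (rule tendsto_powr')
  show "(\<lambda>k. wt (G k) z) \<longlonglongrightarrow> wt f z"
    unfolding wt_def by (intro tendsto_intros assms)
qed (use p in auto)

text \<open>
  The limit is holomorphic because, by Montel's theorem, a subsequence converges locally uniformly.
  The bound on its norm is Fatou's lemma.
\<close>
lemma fock_limit:
  assumes G: "\<And>k. G k \<in> F" and M: "\<And>k. N (G k) \<le> M" and lim: "\<And>z. (\<lambda>k. G k z) \<longlonglongrightarrow> f z"
  shows "f \<in> F" "N f \<le> M"
proof -
  obtain g r where g: "g holomorphic_on UNIV" "strict_mono (r :: nat \<Rightarrow> nat)"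
    "\<And>z. (\<lambda>k. G (r k) z) \<longlonglongrightarrow> g z"
    by (rule montel[of G M, OF G M]) blast
  have "f z = g z" for z
    using LIMSEQ_unique[OF LIMSEQ_subseq_LIMSEQ[OF lim[of z] g(2), unfolded o_def] g(3)] .
  then have f: "f holomorphic_on UNIV" using g(1) by (simp add: fun_eq_iff cong: holomorphic_cong)
  have M0: "M \<ge> 0" using M[of 0] N_nonneg[of "G 0"] by linarith
  have [measurable]: "wt f \<in> borel_measurable borel" "wt (G k) \<in> borel_measurable borel" for k
    using f G holo by (auto intro!: wt_measurable)
  have int: "(\<integral>\<^sup>+z. ennreal (wt (G k) z powr p) \<partial>lborel) \<le> ennreal (M powr p / c0)" for k
  proof -
    have "(\<integral>\<^sup>+z. ennreal (wt (G k) z powr p) \<partial>lborel) = ennreal (LINT z|lborel. wt (G k) z powr p)"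
      by (intro nn_integral_eq_integral intg G) auto
    also have "(LINT z|lborel. wt (G k) z powr p) = N (G k) powr p / c0"
      using c0 by (simp add: N_powr)
    also have "ennreal \<dots> \<le> ennreal (M powr p / c0)"
      using c0 p M N_nonneg by (intro ennreal_leI divide_right_mono powr_mono2) auto
    finally show ?thesis .
  qed
  have "(\<lambda>k. ennreal (wt (G k) z powr p)) \<longlonglongrightarrow> ennreal (wt f z powr p)" for z
    by (intro tendsto_ennrealI tendsto_wt_powr lim)
  then have "(\<integral>\<^sup>+z. ennreal (wt f z powr p) \<partial>lborel) = (\<integral>\<^sup>+z. liminf (\<lambda>k. ennreal (wt (G k) z powr p)) \<partial>lborel)"
    by (intro nn_integral_cong sym[OF lim_imp_Liminf] trivial_limit_sequentially)
  also have "\<dots> \<le> liminf (\<lambda>k. \<integral>\<^sup>+z. ennreal (wt (G k) z powr p) \<partial>lborel)"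
    by (intro nn_integral_liminf) auto
  also have "\<dots> \<le> liminf (\<lambda>k. ennreal (M powr p / c0))"
    by (intro Liminf_mono always_eventually allI int)
  also have "\<dots> = ennreal (M powr p / c0)" by (simp add: Liminf_const)
  finally have nn: "(\<integral>\<^sup>+z. ennreal (wt f z powr p) \<partial>lborel) \<le> ennreal (M powr p / c0)" .
  have i: "integrable lborel (\<lambda>z. wt f z powr p)"
  proof (rule integrableI_bounded)
    show "(\<integral>\<^sup>+z. ennreal (norm (wt f z powr p)) \<partial>lborel) < \<infinity>"
      using nn by (simp add: order_le_less_trans)
  qed simp
  then show "f \<in> F" using f by (simp add: F_iff)
  have "ennreal (LINT z|lborel. wt f z powr p) \<le> ennreal (M powr p / c0)"
    using nn nn_integral_eq_integral[OF i] by simp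
  then have "(LINT z|lborel. wt f z powr p) \<le> M powr p / c0"
    using c0 by (subst (asm) ennreal_le_iff) auto
  then show "N f \<le> M"
    using c0 M0 by (intro N_leI) (auto simp: field_simps)
qed

text \<open>For a series whose pointwise sum is known, Fatou's lemma for the tails does the work of completeness.\<close>
lemma summable_in_F:
  assumes g: "\<And>n. g n \<in> F" and sm: "summable (\<lambda>n. N (g n))" and lim: "\<And>z. (\<lambda>n. g n z) sums f z"
  shows "f \<in> F" "N (\<lambda>z. f z - (\<Sum>n<m. g n z)) \<le> (\<Sum>n. N (g (n + m)))"
    "(\<lambda>m. N (\<lambda>z. f z - (\<Sum>n<m. g n z))) \<longlonglongrightarrow> 0"
proof -
  have tail: "(\<lambda>z. f z - (\<Sum>n<m. g n z)) \<in> F \<and> N (\<lambda>z. f z - (\<Sum>n<m. g n z)) \<le> (\<Sum>n. N (g (n + m)))" for m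
  proof -
    have sm': "summable (\<lambda>n. N (g (n + m)))" using sm by (subst summable_iff_shift)
    have 1: "(\<lambda>z. \<Sum>n<k. g (n + m) z) \<in> F" for k by (intro sum_mem g)
    have 2: "N (\<lambda>z. \<Sum>n<k. g (n + m) z) \<le> (\<Sum>n. N (g (n + m)))" for k
    proof -
      have "N (\<lambda>z. \<Sum>n<k. g (n + m) z) \<le> (\<Sum>n<k. N (g (n + m)))" by (intro nrm_sum_le g)
      also have "\<dots> \<le> (\<Sum>n. N (g (n + m)))" using sm' N_nonneg by (intro sum_le_suminf) auto
      finally show ?thesis .
    qed
    have 3: "(\<lambda>k. \<Sum>n<k. g (n + m) z) \<longlonglongrightarrow> f z - (\<Sum>n<m. g n z)" for z
      using lim[of z] sums_iff_shift[of "\<lambda>n. g n z" m "f z - (\<Sum>n<m. g n z)"] by (simp add: sums_def)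
    show ?thesis using fock_limit[OF 1 2 3] by blast
  qed
  show "f \<in> F" using tail[of 0] by simp
  show "N (\<lambda>z. f z - (\<Sum>n<m. g n z)) \<le> (\<Sum>n. N (g (n + m)))" for m using tail by blast
  show "(\<lambda>m. N (\<lambda>z. f z - (\<Sum>n<m. g n z))) \<longlonglongrightarrow> 0"
  proof (rule Lim_null_comparison)
    show "\<forall>\<^sub>F m in sequentially. norm (N (\<lambda>z. f z - (\<Sum>n<m. g n z))) \<le> (\<Sum>n. N (g (n + m)))"
      using tail by (simp add: abs_of_nonneg N_nonneg)
    have "(\<lambda>m. (\<Sum>n. N (g n)) - (\<Sum>n<m. N (g n))) \<longlonglongrightarrow> (\<Sum>n. N (g n)) - (\<Sum>n. N (g n))"
      by (intro tendsto_diff tendsto_const summable_LIMSEQ sm)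
    then show "(\<lambda>m. \<Sum>n. N (g (n + m))) \<longlonglongrightarrow> 0"
      by (simp add: suminf_minus_initial_segment[OF sm])
  qed
qed

text \<open>
  The Brezis-Lieb lemma: a bounded sequence that tends to \<open>0\<close> pointwise behaves asymptotically as if
  its support were disjoint from that of \<open>f\<close>. It gives the strong convergence of the dilations
  and the weak convergence of such sequences.
\<close>
lemma brezis_lieb:
  assumes f: "f \<in> F" and g: "\<And>k. g k \<in> F" and M: "\<And>k. N (g k) \<le> M" and lim: "\<And>z. (\<lambda>k. g k z) \<longlonglongrightarrow> 0"
  shows "(\<lambda>k. N (\<lambda>z. f z + g k z) powr p - N (g k) powr p) \<longlonglongrightarrow> N f powr p"
proof (rule LIMSEQ_I)
  fix e :: real assume e: "e > 0"
  define A where "A k z = wt (\<lambda>z. f z + g k z) z powr p" for k z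
  define B where "B k z = wt (g k) z powr p" for k z
  define U where "U z = wt f z powr p" for z
  obtain d where d: "d > 0" "d * M powr p < e / 2"
    using ex_mult_less[of "M powr p" "e / 2"] e by auto
  obtain C where C: "C \<ge> 0"
    "\<And>x y s. \<lbrakk>x \<ge> 0; y \<ge> 0; s \<ge> 0; s \<le> x + y; y \<le> s + x\<rbrakk> \<Longrightarrow> \<bar>s powr p - y powr p\<bar> \<le> d * y powr p + C * x powr p"
    using powr_diff_le[OF d(1) p] by blast
  have AB: "\<bar>A k z - B k z\<bar> \<le> d * B k z + C * U z" for k z
    unfolding A_def B_def U_def
  proof (rule C(2))
    show "wt (\<lambda>z. f z + g k z) z \<le> wt f z + wt (g k) z" by (rule wt_add)
    show "wt (g k) z \<le> wt (\<lambda>z. f z + g k z) z + wt f z"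
      using wt_add[of "\<lambda>z. f z + g k z" "\<lambda>z. - f z" z] by (simp add: wt_def)
  qed auto
  have Bn: "B k z \<ge> 0" and Un: "U z \<ge> 0" for k z by (simp_all add: B_def U_def)
  have iA: "integrable lborel (A k)" and iB: "integrable lborel (B k)" and iU: "integrable lborel U" for k
    unfolding A_def[abs_def] B_def[abs_def] U_def[abs_def] using f g by (auto intro!: intg F_add)
  \<comment> \<open>What remains of the defect after removing \<open>d * B k z\<close> is dominated by a multiple of \<open>U\<close>.\<close>
  define D where "D k z = max 0 (\<bar>A k z - B k z - U z\<bar> - d * B k z)" for k z
  have D: "(\<lambda>k. LINT z|lborel. D k z) \<longlonglongrightarrow> (LINT z|(lborel :: complex measure). (0::real))"
  proof (rule integral_dominated_convergence[where w = "\<lambda>z::complex. (C + 1) * U z"])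
    show "AE z in lborel. (\<lambda>k. D k z) \<longlonglongrightarrow> 0"
    proof (intro always_eventually allI)
      fix z
      have "(\<lambda>k. f z + g k z) \<longlonglongrightarrow> f z + 0" by (intro tendsto_intros lim)
      then have "(\<lambda>k. A k z) \<longlonglongrightarrow> U z"
        unfolding A_def U_def by (intro tendsto_wt_powr) simp
      moreover have "(\<lambda>k. B k z) \<longlonglongrightarrow> 0"
        using tendsto_wt_powr[of g z "\<lambda>_. 0"] lim p by (simp add: B_def wt_def)
      ultimately have "(\<lambda>k. max 0 (\<bar>A k z - B k z - U z\<bar> - d * B k z)) \<longlonglongrightarrow> max 0 (\<bar>U z - 0 - U z\<bar> - d * 0)"
        by (intro tendsto_intros)
      then show "(\<lambda>k. D k z) \<longlonglongrightarrow> 0" by (simp add: D_def)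
    qed
    show "AE z in lborel. norm (D k z) \<le> (C + 1) * U z" for k
    proof (intro always_eventually allI)
      fix z show "norm (D k z) \<le> (C + 1) * U z"
        using AB[of k z] Un[of z] C(1) mult_nonneg_nonneg[OF C(1) Un[of z]]
        by (auto simp: D_def max_def algebra_simps abs_if split: if_splits)
    qed
    show "D k \<in> borel_measurable lborel" for k
      unfolding D_def[abs_def]
      using iA[THEN borel_measurable_integrable] iB[THEN borel_measurable_integrable] iU[THEN borel_measurable_integrable]
      by measurable
  qed (use iU in auto)
  then have "(\<lambda>k. c0 * (LINT z|lborel. D k z)) \<longlonglongrightarrow> 0" using tendsto_mult_right_zero by auto
  then have "\<forall>\<^sub>F k in sequentially. c0 * (LINT z|lborel. D k z) < e / 2"
    using e by (intro order_tendstoD(2)[where y = 0]) auto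
  then obtain n0 where n0: "\<And>k. k \<ge> n0 \<Longrightarrow> c0 * (LINT z|lborel. D k z) < e / 2"
    by (auto simp: eventually_sequentially)
  show "\<exists>n0. \<forall>k\<ge>n0. norm (N (\<lambda>z. f z + g k z) powr p - N (g k) powr p - N f powr p) < e"
  proof (intro exI allI impI)
    fix k assume k: "k \<ge> n0"
    have iABU: "integrable lborel (\<lambda>z. A k z - B k z - U z)" using iA iB iU by auto
    have iD: "integrable lborel (D k)"
      unfolding D_def[abs_def] using iA iU iB by (intro integrable_max integrable_zero Bochner_Integration.integrable_diff integrable_abs integrable_mult_right)
    have "\<bar>LINT z|lborel. A k z - B k z - U z\<bar> \<le> (LINT z|lborel. D k z + d * B k z)"
    proof (rule order_trans[OF integral_abs_bound])
      show "(LINT z|lborel. \<bar>A k z - B k z - U z\<bar>) \<le> (LINT z|lborel. D k z + d * B k z)"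
        using iABU iD iB by (intro integral_mono) (auto simp: D_def)
    qed
    also have "\<dots> = (LINT z|lborel. D k z) + d * (LINT z|lborel. B k z)"
      using iD iB by simp
    finally have "c0 * \<bar>LINT z|lborel. A k z - B k z - U z\<bar> \<le> c0 * (LINT z|lborel. D k z) + d * (c0 * (LINT z|lborel. B k z))"
      using c0 mult_left_mono[of _ _ c0] by (fastforce simp: algebra_simps)
    also have "c0 * (LINT z|lborel. B k z) = N (g k) powr p" by (simp add: N_powr B_def)
    also have "d * N (g k) powr p \<le> d * M powr p"
      using d p M N_nonneg by (intro mult_left_mono powr_mono2) auto
    finally have "c0 * \<bar>LINT z|lborel. A k z - B k z - U z\<bar> < e" using n0[OF k] d by linarith
    moreover have "c0 * (LINT z|lborel. A k z - B k z - U z) = N (\<lambda>z. f z + g k z) powr p - N (g k) powr p - N f powr p"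
      using iA[of k] iB[of k] iU by (simp add: N_powr A_def[abs_def] B_def[abs_def] U_def[abs_def] algebra_simps)
    ultimately show "norm (N (\<lambda>z. f z + g k z) powr p - N (g k) powr p - N f powr p) < e"
      using c0 by (metis abs_mult abs_of_pos real_norm_def)
  qed
qed

text \<open>
  A gliding hump. If \<open>|l(g k)| \<ge> e\<close> for infinitely many \<open>k\<close>, then adding \<open>n\<close> of these functions, with
  unimodular factors that make the values of \<open>l\<close> positive, gives a function \<open>G\<close> with \<open>l(G) \<ge> n e\<close>. By
  the Brezis-Lieb lemma, terms far out in the sequence can be chosen such that each increases the
  \<open>p\<close>-th power of the norm by at most a constant. Hence \<open>n e\<close> is of order \<open>n\<^bsup>1/p\<^esup>\<close>, which is absurd for
  \<open>p > 1\<close>.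
\<close>
lemma weakly_null:
  assumes "p > 1" and l: "l \<in> dual (fock \<alpha> p)" and g: "\<And>k. g k \<in> F" and M: "\<And>k. N (g k) \<le> M"
    and lim: "\<And>z. (\<lambda>k. g k z) \<longlonglongrightarrow> 0"
  shows "(\<lambda>k. l (g k)) \<longlonglongrightarrow> 0"
proof (rule ccontr)
  assume "\<not> ?thesis"
  then obtain e where e: "e > 0" "\<And>n0. \<exists>k\<ge>n0. cmod (l (g k)) \<ge> e"
    by (auto simp: LIMSEQ_iff not_less)
  define Q where "Q = M powr p + 1"
  have Q: "Q > 0" by (simp add: Q_def add_nonneg_pos)
  have claim: "\<exists>G\<in>F. Re (l G) \<ge> real n * e \<and> N G powr p \<le> real n * Q" for n
  proof (induction n)
    case 0
    show ?case using zero_mem p dual_0[OF l] by (intro bexI[of _ "\<lambda>_. 0"]) auto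
  next
    case (Suc n)
    then obtain G where G: "G \<in> F" "Re (l G) \<ge> real n * e" "N G powr p \<le> real n * Q" by blast
    define u where "u k = cnj (sgn (l (g k)))" for k
    have u: "cmod (u k) \<le> 1" for k by (simp add: u_def norm_sgn)
    have ul: "u k * l (g k) = of_real (cmod (l (g k)))" for k
      using complex_norm_square[of "l (g k)"]
      by (cases "l (g k) = 0") (auto simp: u_def sgn_div_norm scaleR_conv_of_real power2_eq_square field_simps)
    have ug: "(\<lambda>z. u k * g k z) \<in> F" "N (\<lambda>z. u k * g k z) \<le> M" for k
      using g F_scale N_scale[of "u k" "g k"] M[of k] mult_right_mono[OF u N_nonneg, of k "g k"] by auto
    have "(\<lambda>k. u k * g k z) \<longlonglongrightarrow> 0" for z
    proof (rule Lim_null_comparison[OF always_eventually])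
      show "\<forall>k. norm (u k * g k z) \<le> norm (g k z)"
        using mult_right_mono[OF u norm_ge_zero] by (auto simp: norm_mult)
      show "(\<lambda>k. norm (g k z)) \<longlonglongrightarrow> 0" using lim tendsto_norm_zero by blast
    qed
    from brezis_lieb[OF G(1) ug this]
    have "\<forall>\<^sub>F k in sequentially. N (\<lambda>z. G z + u k * g k z) powr p - N (\<lambda>z. u k * g k z) powr p < N G powr p + 1"
      by (rule order_tendstoD) simp
    then obtain n0 where n0: "\<And>k. k \<ge> n0 \<Longrightarrow>
      N (\<lambda>z. G z + u k * g k z) powr p - N (\<lambda>z. u k * g k z) powr p < N G powr p + 1"
      by (auto simp: eventually_sequentially)
    obtain k where k: "k \<ge> n0" "cmod (l (g k)) \<ge> e" using e(2) by blast
    have "N (\<lambda>z. u k * g k z) powr p \<le> M powr p" using ug p N_nonneg by (intro powr_mono2) auto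
    then have "N (\<lambda>z. G z + u k * g k z) powr p \<le> real (Suc n) * Q"
      using n0[OF k(1)] G(3) by (simp add: Q_def algebra_simps)
    moreover have "Re (l (\<lambda>z. G z + u k * g k z)) \<ge> real (Suc n) * e"
      using G k dual_add[OF l G(1) ug(1)] dual_scale[OF l g, of "u k" k] ul by (simp add: algebra_simps)
    ultimately show ?case using F_add[OF G(1) ug(1)] by blast
  qed
  define B where "B = dN l"
  have B: "B \<ge> 0" using dual_norm_nonneg[OF l] by (simp add: B_def)
  have bd: "real n powr (p - 1) \<le> B powr p * Q / e powr p" if "n > 0" for n
  proof -
    obtain G where G: "G \<in> F" "Re (l G) \<ge> real n * e" "N G powr p \<le> real n * Q" using claim by blast
    have "real n * e \<le> cmod (l G)" using G(2) complex_Re_le_cmod order_trans by blast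
    also have "\<dots> \<le> B * N G" unfolding B_def by (intro dual_le l G)
    finally have "(real n * e) powr p \<le> (B * N G) powr p" using e p by (intro powr_mono2) auto
    also have "\<dots> = B powr p * N G powr p" using B N_nonneg by (simp add: powr_mult)
    also have "\<dots> \<le> B powr p * (real n * Q)" using G by (intro mult_left_mono) auto
    finally have "real n powr p * e powr p \<le> B powr p * (real n * Q)" using e by (simp add: powr_mult)
    moreover have "real n powr p = real n powr (p - 1) * real n" using that by (simp add: powr_diff)
    ultimately have "real n * (real n powr (p - 1) * e powr p) \<le> real n * (B powr p * Q)" by (simp add: mult_ac)
    then show ?thesis using that e by (simp add: pos_le_divide_eq)
  qed
  have "filterlim (\<lambda>x. x powr (p - 1)) at_top at_top" using \<open>p > 1\<close> by real_asymp
  then have "filterlim (\<lambda>n. real n powr (p - 1)) at_top sequentially"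
    using filterlim_compose filterlim_real_sequentially by blast
  then have "\<forall>\<^sub>F n in sequentially. real n powr (p - 1) > B powr p * Q / e powr p"
    by (simp add: filterlim_at_top_dense)
  from eventually_happens[OF eventually_conj[OF this eventually_gt_at_top[of 0]]]
  obtain n where "B powr p * Q / e powr p < real n powr (p - 1)" "n > 0" by auto
  with bd[of n] show False by linarith
qed

end

abbreviation mon :: "nat \<Rightarrow> complex \<Rightarrow> complex" where
  "mon n \<equiv> \<lambda>z. z ^ n"

context fock_space
begin

section \<open>Monomials, coefficient functionals and dilations\<close>

text \<open>As \<open>s < 1\<close>, a Gaussian of rate \<open>(1 - s) \<alpha> / 2\<close> is left over, which makes the integral finite.\<close>
lemma monomial_bound:
  assumes "0 < s" "s < 1"
  shows "\<exists>C>0. \<forall>n K. (\<forall>x\<ge>0. x ^ n \<le> K * exp (s * \<alpha> / 2 * x\<^sup>2)) \<longrightarrow> mon n \<in> F \<and> N (mon n) \<le> C * K"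
proof -
  define \<beta> where "\<beta> = p * ((1 - s) * \<alpha> / 2)"
  have \<beta>: "\<beta> > 0" using assms \<alpha> p by (simp add: \<beta>_def)
  define J where "J = (LINT z|lborel. exp (- \<beta> * (cmod z)\<^sup>2))"
  have iJ: "integrable lborel (\<lambda>z::complex. exp (- \<beta> * (cmod z)\<^sup>2))"
    by (rule integrable_gaussian_complex[OF \<beta>])
  have J: "J \<ge> 0" unfolding J_def by (intro integral_nonneg_AE) auto
  define C where "C = (c0 * J) powr (1 / p) + 1"
  have C: "C > 0" by (simp add: C_def add_nonneg_pos)
  have CJ: "c0 * J \<le> C powr p"
  proof -
    have "c0 * J = ((c0 * J) powr (1 / p)) powr p" using c0 J p by (simp add: powr_powr)
    also have "\<dots> \<le> C powr p" using p by (intro powr_mono2) (auto simp: C_def)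
    finally show ?thesis .
  qed
  have "mon n \<in> F \<and> N (mon n) \<le> C * K"
    if K: "\<And>x. x \<ge> 0 \<Longrightarrow> x ^ n \<le> K * exp (s * \<alpha> / 2 * x\<^sup>2)" for n K
  proof -
    have K0: "K \<ge> 0" using K[of 0] by (cases "n = 0") (auto simp: zero_power)
    have h: "mon n holomorphic_on UNIV" by (intro holomorphic_intros)
    have [measurable]: "wt (mon n) \<in> borel_measurable borel" by (intro wt_measurable h)
    have le: "wt (mon n) z powr p \<le> K powr p * exp (- \<beta> * (cmod z)\<^sup>2)" for z
    proof -
      have "wt (mon n) z \<le> K * exp (s * \<alpha> / 2 * (cmod z)\<^sup>2) * exp (- (\<alpha> / 2) * (cmod z)\<^sup>2)"
        unfolding wt_def norm_power by (intro mult_right_mono K) auto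
      also have "\<dots> = K * exp (s * \<alpha> / 2 * (cmod z)\<^sup>2 + - (\<alpha> / 2) * (cmod z)\<^sup>2)"
        by (simp only: exp_add mult.assoc)
      also have "s * \<alpha> / 2 * (cmod z)\<^sup>2 + - (\<alpha> / 2) * (cmod z)\<^sup>2 = - ((1 - s) * \<alpha> / 2) * (cmod z)\<^sup>2"
        by (simp add: field_simps)
      finally have "wt (mon n) z powr p \<le> (K * exp (- ((1 - s) * \<alpha> / 2) * (cmod z)\<^sup>2)) powr p"
        using p by (intro powr_mono2) auto
      then show ?thesis using K0 by (simp add: powr_mult exp_powr_real \<beta>_def mult_ac)
    qed
    have iK: "integrable lborel (\<lambda>z::complex. K powr p * exp (- \<beta> * (cmod z)\<^sup>2))"
      using iJ by (rule integrable_mult_right)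
    have i: "integrable lborel (\<lambda>z. wt (mon n) z powr p)"
      by (rule integrable_le[OF iK]) (use le in auto)
    have "(LINT z|lborel. wt (mon n) z powr p) \<le> (LINT z|lborel. K powr p * exp (- \<beta> * (cmod (z::complex))\<^sup>2))"
      using i iK le by (intro integral_mono) auto
    also have "\<dots> = K powr p * J" by (simp add: J_def)
    finally have "c0 * (LINT z|lborel. wt (mon n) z powr p) \<le> c0 * (K powr p * J)"
      using c0 by (intro mult_left_mono) auto
    also have "\<dots> = K powr p * (c0 * J)" by simp
    also have "\<dots> \<le> K powr p * C powr p" using CJ by (intro mult_left_mono) auto
    also have "\<dots> = (C * K) powr p" using C K0 by (simp add: powr_mult)
    finally show ?thesis
      using i h C K0 by (auto simp: F_iff intro!: N_leI)
  qed
  then show ?thesis using C by blast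
qed

text \<open>A term of the exponential series gives \<open>x\<^sup>n \<le> n! t\<^bsup>-n\<^esup> exp(t x)\<close>, and \<open>t x \<le> t\<^sup>2/\<alpha> + \<alpha> x\<^sup>2/4\<close>.\<close>
lemma monomial_factorial_bound:
  assumes "t > 0"
  shows "\<exists>C>0. \<forall>n. mon n \<in> F \<and> N (mon n) \<le> C * (fact n / t ^ n)"
proof -
  obtain C where C: "C > 0" "\<And>n K. (\<And>x. x \<ge> 0 \<Longrightarrow> x ^ n \<le> K * exp ((1/2) * \<alpha> / 2 * x\<^sup>2)) \<Longrightarrow> mon n \<in> F \<and> N (mon n) \<le> C * K"
    using monomial_bound[of "1/2"] by auto
  have le: "x ^ n \<le> (exp (t\<^sup>2 / \<alpha>) * (fact n / t ^ n)) * exp ((1/2) * \<alpha> / 2 * x\<^sup>2)" if "x \<ge> 0" for x n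
  proof -
    have "(t * x) ^ n / fact n \<le> (\<Sum>k. (t * x) ^ k / fact k)"
      using sum_le_suminf[OF summable_exp_generic[of "t * x"], of "{n}"] that assms
      by (simp add: divide_inverse mult.commute scaleR_conv_of_real)
    also have "\<dots> = exp (t * x)" by (simp add: exp_def divide_inverse mult.commute scaleR_conv_of_real)
    also have "t * x \<le> t\<^sup>2 / \<alpha> + (1/2) * \<alpha> / 2 * x\<^sup>2"
    proof -
      have "0 \<le> (t - \<alpha> / 2 * x)\<^sup>2 / \<alpha>" using \<alpha> by simp
      also have "\<dots> = t\<^sup>2 / \<alpha> - t * x + (1/2) * \<alpha> / 2 * x\<^sup>2"
        using \<alpha> by (simp add: power2_eq_square field_simps)
      finally show ?thesis by simp
    qed
    finally have "(t * x) ^ n / fact n \<le> exp (t\<^sup>2 / \<alpha>) * exp ((1/2) * \<alpha> / 2 * x\<^sup>2)"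
      by (simp add: exp_add[symmetric])
    then have "(t * x) ^ n / fact n * (fact n / t ^ n) \<le> exp (t\<^sup>2 / \<alpha>) * exp ((1/2) * \<alpha> / 2 * x\<^sup>2) * (fact n / t ^ n)"
      using assms by (intro mult_right_mono) auto
    moreover have "(t * x) ^ n / fact n * (fact n / t ^ n) = x ^ n"
      using assms by (simp add: power_mult_distrib)
    ultimately show ?thesis by (simp add: mult_ac)
  qed
  have "mon n \<in> F \<and> N (mon n) \<le> (C * exp (t\<^sup>2 / \<alpha>)) * (fact n / t ^ n)" for n
    using C(2)[OF le] by (simp add: mult.assoc)
  then show ?thesis using C(1) by (intro exI[of _ "C * exp (t\<^sup>2 / \<alpha>)"]) auto
qed

lemma monomial_mem: "mon n \<in> F"
  using monomial_factorial_bound[of 1] by auto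

lemma coef_bound:
  "\<exists>K>0. \<forall>R>0. \<forall>n. \<forall>f\<in>F. cmod (coef n f) \<le> K * exp (\<alpha> / 2 * R\<^sup>2) / R ^ n * N f"
proof -
  obtain K where K: "K > 0" "\<And>f z. f \<in> F \<Longrightarrow> cmod (f z) \<le> K * exp (\<alpha> / 2 * (cmod z)\<^sup>2) * N f"
    using pointwise_bound by blast
  have "cmod (coef n f) \<le> K * exp (\<alpha> / 2 * R\<^sup>2) / R ^ n * N f" if "R > 0" "f \<in> F" for R n f
  proof -
    have "cmod ((deriv ^^ n) f 0) \<le> fact n * (K * exp (\<alpha> / 2 * R\<^sup>2) * N f) / R ^ n"
    proof (rule Cauchy_inequality)
      show "f holomorphic_on ball 0 R" "continuous_on (cball 0 R) f"
        using holo[OF that(2)] holomorphic_on_subset holomorphic_on_imp_continuous_on by blast+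
      show "cmod (f x) \<le> K * exp (\<alpha> / 2 * R\<^sup>2) * N f" if "cmod (0 - x) = R" for x
        using K(2)[OF \<open>f \<in> F\<close>, of x] that by simp
    qed (use that in auto)
    then show ?thesis by (simp add: coef_def norm_divide field_simps)
  qed
  then show ?thesis using K(1) by blast
qed

definition cf :: "nat \<Rightarrow> (complex \<Rightarrow> complex) \<Rightarrow> complex" where
  "cf n = restrict (coef n) F"

lemma cf_dual: "cf n \<in> dual (fock \<alpha> p)"
proof -
  obtain K where "\<And>R n f. R > 0 \<Longrightarrow> f \<in> F \<Longrightarrow> cmod (coef n f) \<le> K * exp (\<alpha> / 2 * R\<^sup>2) / R ^ n * N f"
    using coef_bound by blast
  from this[of 1] show ?thesis
    unfolding cf_def by (intro dualI coef_add coef_scale holo) auto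
qed

lemma cf_norm_le: "\<exists>K>0. \<forall>R>0. \<forall>n. dN (cf n) \<le> K * exp (\<alpha> / 2 * R\<^sup>2) / R ^ n"
proof -
  obtain K where K: "K > 0" "\<And>R n f. R > 0 \<Longrightarrow> f \<in> F \<Longrightarrow> cmod (coef n f) \<le> K * exp (\<alpha> / 2 * R\<^sup>2) / R ^ n * N f"
    using coef_bound by blast
  then have "dN (cf n) \<le> K * exp (\<alpha> / 2 * R\<^sup>2) / R ^ n" if "R > 0" for R n
    using that by (intro dual_norm_le) (auto simp: cf_def)
  then show ?thesis using K(1) by blast
qed

text \<open>
  Cauchy's estimate for the \<open>n\<close>-th coefficient is used on the circle of radius \<open>R = sqrt (n/\<alpha>)\<close>, where
  \<open>|z|\<^sup>n exp(- \<alpha>/2 |z|\<^sup>2)\<close> is largest. It then matches the bound on the norm of \<open>z\<^sup>n\<close> up to a factor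
  \<open>s\<^bsup>-n/2\<^esup>\<close>, where \<open>s < 1\<close> is the loss in \<open>monomial_bound\<close>. With \<open>s = r\<close> the terms decay like
  \<open>r\<^bsup>n/2\<^esup>\<close>.
\<close>
lemma summable_coef_monomial:
  assumes r: "0 < r" "r < 1"
  shows "summable (\<lambda>n. r ^ n * dN (cf n) * N (mon n))"
proof -
  obtain K where K: "K > 0" "\<And>R n. R > 0 \<Longrightarrow> dN (cf n) \<le> K * exp (\<alpha> / 2 * R\<^sup>2) / R ^ n"
    using cf_norm_le by blast
  obtain C where C: "C > 0" "\<And>n K. (\<And>x. x \<ge> 0 \<Longrightarrow> x ^ n \<le> K * exp (r * \<alpha> / 2 * x\<^sup>2)) \<Longrightarrow> N (mon n) \<le> C * K"
    using monomial_bound[OF r] by blast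
  have le: "r ^ n * dN (cf n) * N (mon n) \<le> K * C * sqrt r ^ n" if n: "n \<ge> 1" for n
  proof -
    define R where "R = sqrt (real n / \<alpha>)"
    have R: "R > 0" "\<alpha> * R\<^sup>2 = real n" using n \<alpha> by (auto simp: R_def)
    define E where "E = exp (real n / 2)"
    have E: "E > 0" by (simp add: E_def)
    have 1: "dN (cf n) \<le> K * E / R ^ n"
      using K(2)[OF R(1), of n] R(2) by (simp add: E_def)
    have 2: "x ^ n \<le> (R ^ n / (sqrt r ^ n * E)) * exp (r * \<alpha> / 2 * x\<^sup>2)" if "x \<ge> 0" for x
    proof -
      define u where "u = sqrt r * x / R"
      have u: "u \<ge> 0" using that r R by (simp add: u_def)
      have "u \<le> exp (u - 1)" using exp_ge_add_one_self[of "u - 1"] by simp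
      also have "u - 1 \<le> (u\<^sup>2 - 1) / 2" using zero_le_power2[of "u - 1"] by (simp add: power2_eq_square field_simps)
      finally have "u \<le> exp ((u\<^sup>2 - 1) / 2)" by simp
      then have "u ^ n \<le> exp ((u\<^sup>2 - 1) / 2) ^ n" using u by (intro power_mono)
      also have "\<dots> = exp (real n * u\<^sup>2 / 2 - real n / 2)"
        by (simp add: exp_of_nat_mult[symmetric] field_simps)
      also have "real n * u\<^sup>2 = r * \<alpha> * x\<^sup>2"
        using R r by (simp add: u_def power_mult_distrib power_divide R(2)[symmetric])
      also have "exp (r * \<alpha> * x\<^sup>2 / 2 - real n / 2) = exp (r * \<alpha> / 2 * x\<^sup>2) / E"
        by (simp add: E_def exp_diff)
      finally have "u ^ n \<le> exp (r * \<alpha> / 2 * x\<^sup>2) / E" .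
      then have "(R ^ n / sqrt r ^ n) * u ^ n \<le> (R ^ n / sqrt r ^ n) * (exp (r * \<alpha> / 2 * x\<^sup>2) / E)"
        using R r by (intro mult_left_mono) auto
      moreover have "(R ^ n / sqrt r ^ n) * u ^ n = x ^ n"
        using R r by (simp add: u_def power_mult_distrib power_divide)
      ultimately show ?thesis by (simp add: mult_ac)
    qed
    have 3: "N (mon n) \<le> C * (R ^ n / (sqrt r ^ n * E))" by (rule C(2)[OF 2])
    have "r ^ n * dN (cf n) * N (mon n) \<le> r ^ n * (K * E / R ^ n) * (C * (R ^ n / (sqrt r ^ n * E)))"
      using 1 3 r K E R N_nonneg by (intro mult_mono mult_left_mono) auto
    also have "\<dots> = K * C * (r ^ n / sqrt r ^ n)" using R E by simp
    also have "r ^ n / sqrt r ^ n = sqrt r ^ n"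
      using r by (simp add: power_divide[symmetric] real_div_sqrt)
    finally show ?thesis .
  qed
  show ?thesis
  proof (rule summable_comparison_test'[where N = 1 and g = "\<lambda>n. K * C * sqrt r ^ n"])
    show "summable (\<lambda>n. K * C * sqrt r ^ n)" using r by (intro summable_mult summable_geometric) auto
    show "norm (r ^ n * dN (cf n) * N (mon n)) \<le> K * C * sqrt r ^ n" if "n \<ge> 1" for n
      using le[OF that] r N_nonneg dual_norm_nonneg[OF cf_dual] by (simp add: abs_mult)
  qed
qed

abbreviation trunc :: "real \<Rightarrow> nat \<Rightarrow> (complex \<Rightarrow> complex) \<Rightarrow> complex \<Rightarrow> complex" where
  "trunc r n f z \<equiv> \<Sum>m<n. (of_real r ^ m * coef m f) * z ^ m"

definition dil :: "real \<Rightarrow> (complex \<Rightarrow> complex) \<Rightarrow> complex \<Rightarrow> complex" where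
  "dil r f z = f (of_real r * z)"

lemma dil_bound:
  assumes f: "f \<in> F" and r: "0 < r" "r \<le> 1"
  shows "dil r f \<in> F" "N (dil r f) powr p \<le> N f powr p / r\<^sup>2"
proof -
  have "(f \<circ> (\<lambda>z. of_real r * z)) holomorphic_on UNIV"
    by (rule holomorphic_on_compose_gen[OF _ holo[OF f]]) (auto intro!: holomorphic_intros)
  then have h: "dil r f holomorphic_on UNIV" by (simp add: dil_def[abs_def] o_def)
  have [measurable]: "wt (dil r f) \<in> borel_measurable borel" "wt f \<in> borel_measurable borel"
    by (intro wt_measurable h holo f)+
  have le: "wt (dil r f) z powr p \<le> wt f (r *\<^sub>R z) powr p" for z
  proof (rule powr_mono2)
    have "r\<^sup>2 * (cmod z)\<^sup>2 \<le> 1 * (cmod z)\<^sup>2" using r by (intro mult_right_mono) (auto simp: power_le_one)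
    then have "exp (- (\<alpha> / 2) * (cmod z)\<^sup>2) \<le> exp (- (\<alpha> / 2) * (r\<^sup>2 * (cmod z)\<^sup>2))" using \<alpha> by simp
    then have "cmod (f (of_real r * z)) * exp (- (\<alpha> / 2) * (cmod z)\<^sup>2) \<le> cmod (f (of_real r * z)) * exp (- (\<alpha> / 2) * (r\<^sup>2 * (cmod z)\<^sup>2))"
      by (intro mult_left_mono) auto
    then show "wt (dil r f) z \<le> wt f (r *\<^sub>R z)"
      using r by (simp add: wt_def dil_def scaleR_conv_of_real norm_mult power_mult_distrib)
  qed (use p in auto)
  have i: "integrable lborel (\<lambda>z. wt f (r *\<^sub>R z) powr p)"
    "(LINT z|lborel. wt f (r *\<^sub>R z) powr p) = (LINT z|lborel. wt f z powr p) / r\<^sup>2"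
    using integrable_lborel_scaleR_iff[of "\<lambda>z. wt f z powr p" r] r intg[OF f] by auto
  have i2: "integrable lborel (\<lambda>z. wt (dil r f) z powr p)"
    by (rule Bochner_Integration.integrable_bound[OF i(1)])
      (use le in \<open>auto intro!: always_eventually\<close>)
  then show "dil r f \<in> F" using h by (simp add: F_iff)
  have "(LINT z|lborel. wt (dil r f) z powr p) \<le> (LINT z|lborel. wt f z powr p) / r\<^sup>2"
    unfolding i(2)[symmetric] using i(1) i2 le by (intro integral_mono) auto
  then have "c0 * (LINT z|lborel. wt (dil r f) z powr p) \<le> c0 * ((LINT z|lborel. wt f z powr p) / r\<^sup>2)"
    using c0 by (intro mult_left_mono) auto
  then show "N (dil r f) powr p \<le> N f powr p / r\<^sup>2" by (simp add: N_powr)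
qed

lemma dil_norm_le:
  assumes f: "f \<in> F" and r: "1/2 \<le> r" "r \<le> 1"
  shows "N (dil r f) \<le> 4 * N f"
proof -
  have "(1/2)\<^sup>2 \<le> r\<^sup>2" using r by (intro power_mono) auto
  then have "N f powr p / r\<^sup>2 \<le> N f powr p / (1/2)\<^sup>2"
    using r by (intro divide_left_mono) auto
  also have "\<dots> \<le> 4 powr p * N f powr p"
    using powr_mono[of 1 p 4] p by (simp add: power2_eq_square mult_right_mono mult.commute)
  also have "\<dots> = (4 * N f) powr p" using N_nonneg by (simp add: powr_mult)
  finally have "N (dil r f) powr p \<le> (4 * N f) powr p" using dil_bound(2)[OF f, of r] r by linarith
  then show ?thesis using N_nonneg[of f] by (intro N_leI) (auto simp: N_powr)
qed

definition rad :: "nat \<Rightarrow> real" where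
  "rad k = 1 - 1 / (real k + 2)"

lemma rad: "1/2 \<le> rad k" "0 < rad k" "rad k < 1" "rad k \<le> 1"
  by (simp_all add: rad_def field_simps)

lemma rad_tendsto: "rad \<longlonglongrightarrow> 1"
  unfolding rad_def by real_asymp

text \<open>
  The norms of the dilations are asymptotically at most that of \<open>f\<close>. By the Brezis-Lieb lemma there
  is then no room for the differences \<open>dil (rad k) f - f\<close>, which tend to \<open>0\<close> pointwise.
\<close>
lemma dil_tendsto:
  assumes f: "f \<in> F"
  shows "(\<lambda>k. N (\<lambda>z. dil (rad k) f z - f z)) \<longlonglongrightarrow> 0"
proof -
  define g where "g k z = dil (rad k) f z - f z" for k z
  have dF: "dil (rad k) f \<in> F" for k using dil_bound(1)[OF f rad(2,4)] .
  have g: "g k \<in> F" for k unfolding g_def[abs_def] by (intro diff_mem dF f)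
  have Ng: "N (g k) \<le> 5 * N f" for k
    using nrm_diff[OF dF f, of k] dil_norm_le[OF f rad(1,4), of k] by (simp add: g_def[abs_def])
  have "(\<lambda>k. g k z) \<longlonglongrightarrow> 0" for z
  proof -
    have "isCont f (of_real 1 * z)"
      using holomorphic_on_imp_continuous_on[OF holo[OF f]] by (simp add: continuous_on_eq_continuous_at)
    then have "(\<lambda>k. f (of_real (rad k) * z)) \<longlonglongrightarrow> f (of_real 1 * z)"
      by (rule isCont_tendsto_compose) (intro tendsto_intros rad_tendsto)
    then have "(\<lambda>k. f (of_real (rad k) * z) - f z) \<longlonglongrightarrow> f (of_real 1 * z) - f z"
      by (intro tendsto_intros)
    then show ?thesis by (simp add: g_def dil_def)
  qed
  from brezis_lieb[OF f g Ng this]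
  have bl: "(\<lambda>k. N (\<lambda>z. f z + g k z) powr p - N (g k) powr p) \<longlonglongrightarrow> N f powr p" .
  have "(\<lambda>z. f z + g k z) = dil (rad k) f" for k by (simp add: g_def fun_eq_iff)
  with bl have bl: "(\<lambda>k. N (dil (rad k) f) powr p - N (g k) powr p) \<longlonglongrightarrow> N f powr p" by simp
  have "(\<lambda>k. N f powr p / (rad k)\<^sup>2 - (N (dil (rad k) f) powr p - N (g k) powr p)) \<longlonglongrightarrow> N f powr p / 1\<^sup>2 - N f powr p"
    by (intro tendsto_intros bl rad_tendsto) auto
  then have "(\<lambda>k. N f powr p / (rad k)\<^sup>2 - (N (dil (rad k) f) powr p - N (g k) powr p)) \<longlonglongrightarrow> 0" by simp
  moreover have "\<forall>k. norm (N (g k) powr p) \<le> N f powr p / (rad k)\<^sup>2 - (N (dil (rad k) f) powr p - N (g k) powr p)"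
    using dil_bound(2)[OF f rad(2,4)] by simp
  ultimately have "(\<lambda>k. N (g k) powr p) \<longlonglongrightarrow> 0"
    by (rule Lim_null_comparison[OF always_eventually, rotated])
  then have "(\<lambda>k. (N (g k) powr p) powr (1 / p)) \<longlonglongrightarrow> 0 powr (1 / p)"
    using p by (intro tendsto_powr') auto
  then show ?thesis using p N_nonneg by (simp add: powr_powr g_def[abs_def])
qed

lemma dil_sums: "f \<in> F \<Longrightarrow> (\<lambda>n. of_real r ^ n * coef n f * z ^ n) sums dil r f z"
  using coef_sums[OF holo, of f "of_real r * z"] by (simp add: dil_def power_mult_distrib mult_ac)

text \<open>One degree of truncation serves all \<open>f\<close>; this is what gives approximation in the dual norm as well.\<close>
lemma dil_truncate:
  assumes r: "0 < r" "r < 1" and e: "e > 0"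
  shows "\<exists>n. \<forall>f\<in>F. N (\<lambda>z. dil r f z - trunc r n f z) \<le> e * N f"
proof -
  define b where "b n = r ^ n * dN (cf n) * N (mon n)" for n
  have sb: "summable b" unfolding b_def[abs_def] by (rule summable_coef_monomial[OF r])
  obtain n where n: "\<And>k. k \<ge> n \<Longrightarrow> norm (\<Sum>i. b (i + k)) < e"
    using suminf_exist_split[OF e sb] by blast
  have "N (\<lambda>z. dil r f z - trunc r n f z) \<le> e * N f" if f: "f \<in> F" for f
  proof -
    let ?g = "\<lambda>m z. (of_real r ^ m * coef m f) * z ^ m"
    have g: "?g m \<in> F" for m by (intro F_scale monomial_mem)
    have Ng: "N (?g m) \<le> b m * N f" for m
    proof -
      have "N (?g m) = r ^ m * cmod (coef m f) * N (mon m)"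
        using N_scale[of "of_real r ^ m * coef m f" "mon m"] r by (simp add: norm_mult norm_power)
      also have "\<dots> \<le> r ^ m * (dN (cf m) * N f) * N (mon m)"
        using dual_le[OF cf_dual f, of m] r f N_nonneg
        by (intro mult_right_mono mult_left_mono) (auto simp: cf_def)
      finally show ?thesis by (simp add: b_def mult_ac)
    qed
    have sbN: "summable (\<lambda>m. b m * N f)" using sb by (rule summable_mult2)
    have sm: "summable (\<lambda>m. N (?g m))"
      by (rule summable_comparison_test'[OF sbN]) (use Ng N_nonneg in auto)
    have "N (\<lambda>z. dil r f z - (\<Sum>m<n. ?g m z)) \<le> (\<Sum>m. N (?g (m + n)))"
      by (rule summable_in_F(2)[OF g sm dil_sums[OF f]])
    also have "\<dots> \<le> (\<Sum>m. b (m + n) * N f)"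
      using sm sbN Ng by (intro suminf_le) (simp_all add: summable_iff_shift[of "\<lambda>m. N (?g m)"] summable_iff_shift[of "\<lambda>m. b m * N f"])
    also have "\<dots> = (\<Sum>m. b (m + n)) * N f"
      using sb by (intro suminf_mult2[symmetric]) (simp add: summable_iff_shift)
    also have "\<dots> \<le> e * N f" using n[of n] N_nonneg by (intro mult_right_mono) auto
    finally show ?thesis .
  qed
  then show ?thesis by blast
qed

lemma polynomials_dense:
  assumes f: "f \<in> F" and e: "e > 0"
  shows "\<exists>n b. N (\<lambda>z. f z - (\<Sum>j<n. b j * z ^ j)) \<le> e"
proof -
  have "\<forall>\<^sub>F k in sequentially. N (\<lambda>z. dil (rad k) f z - f z) < e / 2"
    using e by (intro order_tendstoD(2)[OF dil_tendsto[OF f]]) auto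
  then obtain k where k: "N (\<lambda>z. dil (rad k) f z - f z) < e / 2" by (auto simp: eventually_sequentially)
  define r where "r = rad k"
  have r: "0 < r" "r < 1" using rad by (auto simp: r_def)
  obtain d where d: "d > 0" "d * N f < e / 2" using ex_mult_less[of "N f" "e / 2"] e N_nonneg by auto
  obtain n where n: "\<And>f. f \<in> F \<Longrightarrow> N (\<lambda>z. dil r f z - trunc r n f z) \<le> d * N f"
    using dil_truncate[OF r d(1)] by auto
  have dF: "dil r f \<in> F" using dil_bound(1)[OF f] r by simp
  have "N (\<lambda>z. f z - trunc r n f z) \<le>
    N (\<lambda>z. f z - dil r f z) + N (\<lambda>z. dil r f z - trunc r n f z)"
    by (intro nrm_triangle3 f dF sum_mem F_scale monomial_mem)
  also have "\<dots> \<le> e"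
    using n[OF f] d k[folded r_def] nrm_minus_commute[of f "dil r f"] by simp
  finally show ?thesis
    by (intro exI[of _ n] exI[of _ "\<lambda>m. of_real r ^ m * coef m f"])
qed

text \<open>
  Otherwise there are functions \<open>h k\<close> of norm \<open>1\<close> with \<open>|l(h k - dil (rad k) (h k))| > e\<close>. By
  Montel's theorem one may assume that \<open>h k\<close> converges locally uniformly. Then
  \<open>h k - dil (rad k) (h k)\<close> is bounded and tends to \<open>0\<close> pointwise, hence weakly.
\<close>
lemma dual_dilation:
  assumes p1: "p > 1" and l: "l \<in> dual (fock \<alpha> p)" and e: "e > 0"
  shows "\<exists>r. 0 < r \<and> r < 1 \<and> (\<forall>f\<in>F. cmod (l f - l (dil r f)) \<le> e * N f)"
proof (rule ccontr)
  assume contra: "\<not> ?thesis"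
  have "\<exists>f\<in>F. cmod (l f - l (dil (rad k) f)) > e * N f" for k
    using contra rad[of k] by (auto simp: not_le)
  then obtain f where f: "\<And>k. f k \<in> F" "\<And>k. cmod (l (f k) - l (dil (rad k) (f k))) > e * N (f k)"
    by metis
  have Nf: "N (f k) > 0" for k
  proof (rule ccontr)
    assume "\<not> N (f k) > 0"
    then have "N (f k) = 0" using N_nonneg[of "f k"] by linarith
    then have "f k = (\<lambda>_. 0)" using nrm_eq_0 f by blast
    then have "dil (rad k) (f k) = (\<lambda>_. 0)" by (simp add: dil_def[abs_def])
    then show False using f(2)[of k] \<open>N (f k) = 0\<close> \<open>f k = (\<lambda>_. 0)\<close> by simp
  qed
  define h where "h k z = of_real (1 / N (f k)) * f k z" for k z
  have hF: "h k \<in> F" for k unfolding h_def[abs_def] by (intro F_scale f)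
  have Nh: "N (h k) \<le> 1" for k
    using N_scale[of "of_real (1 / N (f k))" "f k"] Nf[of k] by (simp add: h_def[abs_def] norm_divide)
  obtain g s where g: "g holomorphic_on UNIV" "strict_mono (s :: nat \<Rightarrow> nat)"
    "\<And>z. (\<lambda>k. h (s k) z) \<longlonglongrightarrow> g z"
    "\<And>K. compact K \<Longrightarrow> uniform_limit K (h \<circ> s) g sequentially"
    by (rule montel[of h 1, OF hF Nh]) blast
  have rs: "(\<lambda>k. rad (s k)) \<longlonglongrightarrow> 1"
    using LIMSEQ_subseq_LIMSEQ[OF rad_tendsto g(2)] by (simp add: o_def)
  define u where "u k z = h (s k) z - dil (rad (s k)) (h (s k)) z" for k z
  have dF: "dil (rad k) (h k) \<in> F" for k using dil_bound(1)[OF hF] rad[of k] by simp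
  have uF: "u k \<in> F" for k unfolding u_def[abs_def] by (intro diff_mem hF dF)
  have Nu: "N (u k) \<le> 5" for k
    using nrm_diff[OF hF dF, of "s k" "s k"] dil_norm_le[OF hF, of "rad (s k)" "s k"] Nh[of "s k"] rad[of "s k"]
    by (simp add: u_def[abs_def])
  have "(\<lambda>k. u k z) \<longlonglongrightarrow> 0" for z
  proof -
    have "isCont g (of_real 1 * z)"
      using holomorphic_on_imp_continuous_on[OF g(1)] by (simp add: continuous_on_eq_continuous_at)
    then have 1: "(\<lambda>k. g (of_real (rad (s k)) * z)) \<longlonglongrightarrow> g (of_real 1 * z)"
      by (rule isCont_tendsto_compose) (intro tendsto_intros rs)
    have 2: "(\<lambda>k. h (s k) (of_real (rad (s k)) * z) - g (of_real (rad (s k)) * z)) \<longlonglongrightarrow> 0"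
    proof (rule LIMSEQ_I)
      fix d :: real assume "d > 0"
      then have "\<forall>\<^sub>F k in sequentially. \<forall>x\<in>cball 0 (cmod z). dist ((h \<circ> s) k x) (g x) < d"
        using uniform_limitD[OF g(4)[OF compact_cball]] by blast
      then obtain n0 where n0: "\<And>k x. k \<ge> n0 \<Longrightarrow> cmod x \<le> cmod z \<Longrightarrow> dist (h (s k) x) (g x) < d"
        unfolding eventually_sequentially o_def mem_cball_0 Ball_def by blast
      have "cmod (of_real (rad (s k)) * z) \<le> cmod z" for k
        using rad[of "s k"] by (simp add: norm_mult mult_left_le_one_le)
      then show "\<exists>n0. \<forall>k\<ge>n0. norm (h (s k) (of_real (rad (s k)) * z) - g (of_real (rad (s k)) * z) - 0) < d"
        using n0 by (intro exI[of _ n0]) (simp add: dist_norm)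
    qed
    have "(\<lambda>k. h (s k) z - ((h (s k) (of_real (rad (s k)) * z) - g (of_real (rad (s k)) * z)) + g (of_real (rad (s k)) * z)))
      \<longlonglongrightarrow> g z - (0 + g (of_real 1 * z))"
      by (intro tendsto_intros 1 2 g(3))
    then show ?thesis by (simp add: u_def dil_def)
  qed
  from weakly_null[OF p1 l uF Nu this] have "\<forall>\<^sub>F k in sequentially. cmod (l (u k)) < e"
    using e by (intro order_tendstoD(2)[OF tendsto_norm_zero]) auto
  then obtain k where k: "cmod (l (u k)) < e" by (auto simp: eventually_sequentially)
  define c where "c = complex_of_real (1 / N (f (s k)))"
  have h_eq: "h (s k) = (\<lambda>z. c * f (s k) z)" by (simp add: h_def[abs_def] c_def)
  have dil_h: "dil (rad (s k)) (h (s k)) = (\<lambda>z. c * dil (rad (s k)) (f (s k)) z)"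
    by (simp add: dil_def[abs_def] h_def c_def)
  have dFf: "dil (rad (s k)) (f (s k)) \<in> F" using dil_bound(1)[OF f(1)] rad[of "s k"] by simp
  have "l (u k) = l (h (s k)) - l (dil (rad (s k)) (h (s k)))"
    unfolding u_def[abs_def] by (intro dual_diff l hF dF)
  also have "\<dots> = c * (l (f (s k)) - l (dil (rad (s k)) (f (s k))))"
    unfolding dil_h unfolding h_eq using dual_scale[OF l f(1), of c "s k"] dual_scale[OF l dFf, of c]
    by (simp add: algebra_simps)
  finally have "cmod (l (u k)) = cmod (l (f (s k)) - l (dil (rad (s k)) (f (s k)))) / N (f (s k))"
    using Nf[of "s k"] by (simp add: c_def norm_mult norm_divide)
  also have "\<dots> > e" using f(2)[of "s k"] Nf[of "s k"] by (simp add: pos_less_divide_eq)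
  finally show False using k by simp
qed

text \<open>
  After \<open>l\<close> has been replaced by \<open>l \<circ> dil r\<close>, truncating the Taylor expansion of \<open>dil r f\<close> leaves a
  combination of coefficient functionals.
\<close>
lemma coefficients_dense:
  assumes p1: "p > 1" and l: "l \<in> dual (fock \<alpha> p)" and e: "e > 0"
  shows "\<exists>n a. \<forall>f\<in>F. cmod (l f - (\<Sum>i<n. a i * cf i f)) \<le> e * N f"
proof -
  obtain r where r: "0 < r" "r < 1" "\<And>f. f \<in> F \<Longrightarrow> cmod (l f - l (dil r f)) \<le> e / 2 * N f"
    using dual_dilation[OF p1 l, of "e / 2"] e by auto
  obtain d where d: "d > 0" "d * dN l < e / 2"
    using ex_mult_less[of "dN l" "e / 2"] e dual_norm_nonneg[OF l] by auto
  obtain n where n: "\<And>f. f \<in> F \<Longrightarrow> N (\<lambda>z. dil r f z - trunc r n f z) \<le> d * N f"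
    using dil_truncate[OF r(1,2) d(1)] by auto
  have "cmod (l f - (\<Sum>i<n. (of_real r ^ i * l (mon i)) * cf i f)) \<le> e * N f" if f: "f \<in> F" for f
  proof -
    have dF: "dil r f \<in> F" using dil_bound(1)[OF f] r by simp
    let ?t = "trunc r n f"
    have t: "?t \<in> F" by (intro sum_mem F_scale monomial_mem)
    let ?s = "\<Sum>i<n. (of_real r ^ i * l (mon i)) * cf i f"
    have "l ?t = ?s"
      using f unfolding dual_sum[OF l F_scale[OF monomial_mem]] dual_scale[OF l monomial_mem]
      by (simp add: cf_def mult_ac)
    then have "l (dil r f) - ?s = l (\<lambda>z. dil r f z - ?t z)"
      using dual_diff[OF l dF t] by simp
    also have "cmod \<dots> \<le> dN l * N (\<lambda>z. dil r f z - ?t z)"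
      by (intro dual_le l diff_mem dF t)
    also have "\<dots> \<le> dN l * (d * N f)"
      by (intro mult_left_mono n f dual_norm_nonneg l)
    also have "\<dots> \<le> e / 2 * N f"
      using mult_right_mono[OF less_imp_le[OF d(2)] N_nonneg[of f]] by (simp add: mult_ac)
    finally have "cmod (l (dil r f) - ?s) \<le> e / 2 * N f" .
    with r(3)[OF f] show ?thesis
      using norm_triangle_ineq[of "l f - l (dil r f)" "l (dil r f) - ?s"]
      by simp
  qed
  then show ?thesis
    by (intro exI[of _ n] exI[of _ "\<lambda>i. of_real r ^ i * l (mon i)"] ballI)
qed

end

section \<open>Compact operators\<close>

context normed_fun_space_pair
begin

lemma linear_op_bounded:
  assumes T: "T \<in> linear_ops X Y" and B: "\<And>f. f \<in> unit_cball X \<Longrightarrow> nrm Y (T f) \<le> B" and f: "f \<in> points X"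
  shows "nrm Y (T f) \<le> B * nrm X f"
proof (cases "nrm X f = 0")
  case True
  then have f0: "f = (\<lambda>_. 0)" using X.nrm_eq_0 f by blast
  have "T (\<lambda>z. c * f z) = (\<lambda>z. c * T f z)" for c
    using T f unfolding linear_ops_def by blast
  from this[of 0] show ?thesis using True f0 by simp
next
  case False
  then have pos: "nrm X f > 0" using X.nrm_nonneg[of f] by simp
  define c where "c = complex_of_real (1 / nrm X f)"
  have c: "cmod c = 1 / nrm X f" using pos by (simp add: c_def norm_divide)
  have Tf: "T f \<in> points Y" using T f by (auto simp: linear_ops_def)
  have "(\<lambda>z. c * f z) \<in> unit_cball X"
    using X.nrm_scale[OF f, of c] X.scale_mem[OF f, of c] pos by (simp add: unit_cball_def c)
  then have "nrm Y (T (\<lambda>z. c * f z)) \<le> B" by (rule B)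
  also have "T (\<lambda>z. c * f z) = (\<lambda>z. c * T f z)" using T f by (auto simp: linear_ops_def)
  finally show ?thesis using Y.nrm_scale[OF Tf, of c] pos by (simp add: c pos_divide_le_eq)
qed

lemma compact_ops_finite_net:
  assumes T: "T \<in> compact_ops X Y" and e: "e > 0"
  shows "\<exists>K. finite K \<and> K \<subseteq> points Y \<and> (\<forall>f\<in>unit_cball X. \<exists>x\<in>K. nrm Y (\<lambda>z. x z - T f z) < e)"
proof -
  interpret M: Metric_space "points Y" "\<lambda>f g. nrm Y (\<lambda>z. f z - g z)" by (rule Y.metric)
  have top: "norm_topology Y = M.mtopology" by (simp add: norm_topology_def)
  let ?S = "T ` unit_cball X"
  have sub: "?S \<subseteq> points Y" using T by (auto simp: compact_ops_def linear_ops_def unit_cball_def)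
  have "M.mtotally_bounded (M.mtopology closure_of ?S)"
    using T by (intro M.compactin_imp_mtotally_bounded) (simp add: compact_ops_def top)
  from this[unfolded M.mtotally_bounded_def, rule_format, OF e]
  obtain K where K: "finite K" "K \<subseteq> M.mtopology closure_of ?S"
    "M.mtopology closure_of ?S \<subseteq> (\<Union>x\<in>K. M.mball x e)"
    by (elim exE conjE) (rule that)
  have "?S \<subseteq> M.mtopology closure_of ?S" using sub by (intro closure_of_subset) simp
  then have "\<forall>f\<in>unit_cball X. \<exists>x\<in>K. nrm Y (\<lambda>z. x z - T f z) < e"
    using K(3) by (fastforce simp: M.in_mball)
  moreover have "K \<subseteq> points Y" using K(2) closure_of_subset_topspace[of M.mtopology ?S] by auto
  ultimately show ?thesis using K(1) by blast
qed

lemma compact_ops_bounded: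
  assumes T: "T \<in> compact_ops X Y"
  shows "\<exists>B\<ge>0. \<forall>f\<in>points X. nrm Y (T f) \<le> B * nrm X f"
proof -
  have lin: "T \<in> linear_ops X Y" using T by (simp add: compact_ops_def)
  obtain K where K: "finite K" "K \<subseteq> points Y" "\<And>f. f \<in> unit_cball X \<Longrightarrow> \<exists>x\<in>K. nrm Y (\<lambda>z. x z - T f z) < 1"
    using compact_ops_finite_net[OF T, of 1] by auto
  define B where "B = (\<Sum>x\<in>K. nrm Y x) + 1"
  have B: "B \<ge> 0" using sum_nonneg[of K "nrm Y"] Y.nrm_nonneg by (simp add: B_def)
  have "nrm Y (T f) \<le> B" if f: "f \<in> unit_cball X" for f
  proof -
    have Tf: "T f \<in> points Y" using lin f by (auto simp: linear_ops_def unit_cball_def)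
    obtain x where x: "x \<in> K" "nrm Y (\<lambda>z. x z - T f z) < 1" using K(3)[OF f] by blast
    have "nrm Y (T f) \<le> nrm Y x + nrm Y (\<lambda>z. x z - T f z)"
      using Y.nrm_diff[of x "\<lambda>z. x z - T f z"] K(2) x(1) Tf Y.diff_mem[of x "T f"] by auto
    moreover have "nrm Y x \<le> (\<Sum>x\<in>K. nrm Y x)" using x K Y.nrm_nonneg by (intro member_le_sum) auto
    ultimately show ?thesis using x(2) by (simp add: B_def)
  qed
  then show ?thesis using B linear_op_bounded[OF lin] by blast
qed

lemma compact_opsI:
  assumes T: "T \<in> linear_ops X Y"
    and sub: "\<And>f. (\<And>n::nat. f n \<in> unit_cball X) \<Longrightarrow> \<exists>g r. g \<in> unit_cball X \<and> strict_mono (r :: nat \<Rightarrow> nat) \<and>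
      (\<lambda>n. nrm Y (\<lambda>z. T (f (r n)) z - T g z)) \<longlonglongrightarrow> 0"
  shows "T \<in> compact_ops X Y"
proof -
  interpret M: Metric_space "points Y" "\<lambda>f g. nrm Y (\<lambda>z. f z - g z)" by (rule Y.metric)
  have top: "norm_topology Y = M.mtopology" by (simp add: norm_topology_def)
  let ?S = "T ` unit_cball X"
  have TY: "T f \<in> points Y" if "f \<in> unit_cball X" for f
    using T that by (auto simp: linear_ops_def unit_cball_def)
  have "compactin M.mtopology ?S"
    unfolding M.compactin_sequentially
  proof (intro conjI allI impI)
    show "?S \<subseteq> points Y" using TY by auto
    fix \<sigma> :: "nat \<Rightarrow> _" assume "range \<sigma> \<subseteq> ?S"
    then have "\<forall>n. \<exists>f. f \<in> unit_cball X \<and> \<sigma> n = T f" by auto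
    then obtain f where f: "\<And>n. f n \<in> unit_cball X" "\<And>n. \<sigma> n = T (f n)" by metis
    obtain g r where g: "g \<in> unit_cball X" "strict_mono (r :: nat \<Rightarrow> nat)"
      "(\<lambda>n. nrm Y (\<lambda>z. T (f (r n)) z - T g z)) \<longlonglongrightarrow> 0"
      using sub[of f] f(1) by blast
    have "limitin M.mtopology (\<sigma> \<circ> r) (T g) sequentially"
      unfolding M.limitin_metric
    proof (intro conjI allI impI)
      fix e :: real assume "e > 0"
      with g(3) have "\<forall>\<^sub>F n in sequentially. nrm Y (\<lambda>z. T (f (r n)) z - T g z) < e"
        by (rule order_tendstoD)
      then show "\<forall>\<^sub>F n in sequentially. (\<sigma> \<circ> r) n \<in> points Y \<and> nrm Y (\<lambda>z. (\<sigma> \<circ> r) n z - T g z) < e"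
        using f TY by (auto elim!: eventually_mono)
    qed (use g TY in auto)
    then show "\<exists>l r. l \<in> ?S \<and> strict_mono r \<and> limitin M.mtopology (\<sigma> \<circ> r) l sequentially"
      using g by blast
  qed
  moreover from this have "M.mtopology closure_of ?S = ?S"
    by (intro closure_of_closedin compactin_imp_closedin M.Hausdorff_space_mtopology)
  ultimately show ?thesis using T by (simp add: compact_ops_def top)
qed

end

section \<open>Toeplitz operators as power series\<close>

text \<open>
  A tent function, divided by its moment. The moment is positive because the disc of radius \<open>t/8\<close>
  about \<open>3t/8\<close> lies in the annulus \<open>t/4 \<le> |z| \<le> t/2\<close>, where the tent is at least \<open>1/2\<close>.
\<close>
lemma ex_radial_bump:
  assumes t: "t > 0"
  shows "\<exists>\<eta> :: real \<Rightarrow> real. continuous_on UNIV \<eta> \<and> (\<forall>s. \<eta> s \<ge> 0) \<and> (\<forall>s>t. \<eta> s = 0) \<and> (\<exists>M. \<forall>s. \<bar>\<eta> s\<bar> \<le> M) \<and>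
    (LINT z|(lborel :: complex measure). cmod z ^ k * \<eta> (cmod z)) = 1"
proof -
  define b where "b s = max 0 (1 - \<bar>s\<bar> / t)" for s :: real
  define m where "m = (LINT z|(lborel :: complex measure). cmod z ^ k * b (cmod z))"
  have b: "continuous_on UNIV b" "\<And>s. b s \<ge> 0" "\<And>s. s > t \<Longrightarrow> b s = 0" "\<And>s. b s \<le> 1"
    using t by (auto simp: b_def[abs_def] intro!: continuous_intros)
  let ?c = "complex_of_real (3 * t / 8)"
  have int: "integrable lborel (\<lambda>z::complex. cmod z ^ k * b (cmod z))"
  proof (rule Bochner_Integration.integrable_bound)
    show "integrable lborel (\<lambda>z::complex. t ^ k * indicator (cball 0 t) z :: real)"
      by (intro integrable_mult_right integrable_indicator_cball)
    show "(\<lambda>z::complex. cmod z ^ k * b (cmod z)) \<in> borel_measurable lborel"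
      using b(1) by (auto intro!: borel_measurable_continuous_onI continuous_intros continuous_on_compose2[OF b(1)])
    have "cmod z ^ k * b (cmod z) \<le> t ^ k * 1" if "cmod z \<le> t" for z
      using b that t by (intro mult_mono power_mono) auto
    then show "AE z::complex in lborel. norm (cmod z ^ k * b (cmod z)) \<le> norm (t ^ k * indicator (cball 0 t) z :: real)"
      using b t by (intro always_eventually allI) (auto simp: abs_mult split: split_indicator)
  qed
  have "0 < (t / 4) ^ k * (1 / 2) * measure lborel (ball ?c (t / 8))"
    using t by (intro mult_pos_pos content_ball_pos) auto
  also have "\<dots> = (LINT z|lborel. (t / 4) ^ k * (1 / 2) * indicator (ball ?c (t / 8)) z)"
    by simp
  also have "\<dots> \<le> m"
    unfolding m_def
  proof (rule integral_mono)
    show "integrable lborel (\<lambda>z. (t / 4) ^ k * (1 / 2) * indicator (ball ?c (t / 8)) z :: real)"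
      by (intro integrable_mult_right integrable_real_indicator)
        (use emeasure_bounded_finite[OF bounded_ball, of ?c "t / 8"] in auto)
    fix z
    show "(t / 4) ^ k * (1 / 2) * indicator (ball ?c (t / 8)) z \<le> cmod z ^ k * b (cmod z)"
    proof (cases "z \<in> ball ?c (t / 8)")
      case True
      then have "cmod (?c - z) < t / 8" by (simp add: dist_norm)
      moreover have "cmod ?c = 3 * t / 8" using t by (simp only: norm_of_real)
      ultimately have z: "t / 4 \<le> cmod z" "cmod z \<le> t / 2"
        using norm_triangle_ineq2[of ?c z] norm_triangle_ineq3[of ?c z] by linarith+
      then have "b (cmod z) \<ge> 1 / 2" using t by (simp add: b_def field_simps max_def)
      then have "(t / 4) ^ k * (1 / 2) \<le> cmod z ^ k * b (cmod z)"
        using z t by (intro mult_mono power_mono) auto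
      then show ?thesis using True by simp
    qed (use b in auto)
  qed (rule int)
  finally have m: "m > 0" .
  show ?thesis
  proof (intro exI[of _ "\<lambda>s. b s / m"] conjI allI impI)
    show "continuous_on UNIV (\<lambda>s. b s / m)" using b(1) m by (intro continuous_intros) auto
    show "b s / m \<ge> 0" for s using b m by simp
    show "b s / m = 0" if "s > t" for s using b that by simp
    show "\<exists>M. \<forall>s. \<bar>b s / m\<bar> \<le> M" using b m by (intro exI[of _ "1 / m"]) (auto simp: divide_right_mono)
    show "(LINT z|(lborel :: complex measure). cmod z ^ k * (b (cmod z) / m)) = 1"
      using m by (simp add: m_def)
  qed
qed

text \<open>
  When \<open>\<psi>\<close> is the product of the symbol with the Gaussian density, this is the \<open>k\<close>-th Taylor coefficient
  of the image of \<open>f\<close> under the Toeplitz operator, obtained by expanding \<open>exp(\<alpha> z cnj w)\<close>.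
\<close>
definition tcoef :: "real \<Rightarrow> (complex \<Rightarrow> complex) \<Rightarrow> nat \<Rightarrow> (complex \<Rightarrow> complex) \<Rightarrow> complex" where
  "tcoef \<alpha> \<psi> k f = of_real \<alpha> ^ k / fact k * (LINT w|lborel. cnj w ^ k * \<psi> w * f w)"

lemma integrable_compact_support:
  fixes g :: "complex \<Rightarrow> complex"
  assumes "continuous_on UNIV g" "\<And>w. cmod w > R \<Longrightarrow> g w = 0"
  shows "integrable lborel g"
proof -
  have "integrable lborel (\<lambda>w. indicator (cball 0 R) w *\<^sub>R g w)"
    using assms(1) continuous_on_subset by (intro borel_integrable_compact) auto
  also have "(\<lambda>w. indicator (cball 0 R) w *\<^sub>R g w) = g"
    using assms(2) by (auto simp: fun_eq_iff indicator_def)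
  finally show ?thesis .
qed

lemma toeplitz_eq:
  assumes "continuous_on UNIV \<phi>" "continuous_on UNIV f"
    and "\<alpha> > 0"
  shows "toeplitz \<alpha> \<phi> f z =
    (LINT w|lborel. exp (of_real \<alpha> * z * cnj w) * (of_real (\<alpha> / pi * exp (- \<alpha> * (cmod w)\<^sup>2)) * \<phi> w) * f w)"
proof -
  have "(\<lambda>w. exp (of_real \<alpha> * z * cnj w) * \<phi> w * f w) \<in> borel_measurable lborel"
    using assms by (auto intro!: borel_measurable_continuous_onI continuous_intros)
  then have "toeplitz \<alpha> \<phi> f z = (LINT w|lborel. (\<alpha> / pi * exp (- \<alpha> * (cmod w)\<^sup>2)) *\<^sub>R (exp (of_real \<alpha> * z * cnj w) * \<phi> w * f w))"
    unfolding toeplitz_def gauss_measure_def using assms(3)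
    by (intro integral_density) auto
  then show ?thesis by (simp add: scaleR_conv_of_real mult_ac)
qed

lemma tcoef_bound:
  assumes \<psi>: "continuous_on UNIV \<psi>" "\<And>w. cmod w > R \<Longrightarrow> \<psi> w = 0" and R: "R > 0" and \<alpha>: "\<alpha> > 0"
  shows "\<exists>A>0. \<forall>k S f. f holomorphic_on UNIV \<longrightarrow> (\<forall>w. cmod w \<le> R \<longrightarrow> cmod (f w) \<le> S) \<longrightarrow>
    cmod (tcoef \<alpha> \<psi> k f) \<le> (\<alpha> * R) ^ k / fact k * (A * S)"
proof -
  define A where "A = (LINT w|lborel. cmod (\<psi> w)) + 1"
  have i\<psi>: "integrable lborel (\<lambda>w. cmod (\<psi> w))" using integrable_compact_support[OF \<psi>] by (rule integrable_norm)
  have A: "A > 0" unfolding A_def by (intro add_nonneg_pos integral_nonneg_AE) auto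
  have "cmod (tcoef \<alpha> \<psi> k f) \<le> (\<alpha> * R) ^ k / fact k * (A * S)"
    if f: "f holomorphic_on UNIV" and S: "\<And>w. cmod w \<le> R \<Longrightarrow> cmod (f w) \<le> S" for k S f
  proof -
    have S0: "S \<ge> 0" using order_trans[OF norm_ge_zero S[of 0]] R by simp
    have cf: "continuous_on UNIV f" using f by (rule holomorphic_on_imp_continuous_on)
    have i: "integrable lborel (\<lambda>w. cnj w ^ k * \<psi> w * f w)"
      using \<psi> cf by (intro integrable_compact_support[where R = R]) (auto intro!: continuous_intros)
    have "cmod (LINT w|lborel. cnj w ^ k * \<psi> w * f w) \<le> (LINT w|lborel. R ^ k * S * cmod (\<psi> w))"
    proof (rule Bochner_Integration.integral_norm_bound_integral[OF i integrable_mult_right[OF i\<psi>]])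
      fix w
      show "cmod (cnj w ^ k * \<psi> w * f w) \<le> R ^ k * S * cmod (\<psi> w)"
      proof (cases "cmod w \<le> R")
        case True
        then have "cmod w ^ k * cmod (f w) * cmod (\<psi> w) \<le> R ^ k * S * cmod (\<psi> w)"
          using S[OF True] R by (intro mult_right_mono mult_mono power_mono) auto
        then show ?thesis by (simp add: norm_mult norm_power mult_ac)
      qed (use \<psi> in simp)
    qed
    also have "\<dots> = R ^ k * S * (LINT w|lborel. cmod (\<psi> w))" by simp
    also have "\<dots> \<le> R ^ k * S * A" using R S0 by (intro mult_left_mono) (auto simp: A_def)
    finally have "\<alpha> ^ k / fact k * cmod (LINT w|lborel. cnj w ^ k * \<psi> w * f w) \<le> \<alpha> ^ k / fact k * (R ^ k * S * A)"
      using \<alpha> by (intro mult_left_mono) auto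
    then show ?thesis using \<alpha> by (simp add: tcoef_def norm_mult norm_divide norm_power power_mult_distrib mult_ac)
  qed
  then show ?thesis using A by blast
qed

lemma tcoef_sums:
  assumes \<psi>: "continuous_on UNIV \<psi>" "\<And>w. cmod w > R \<Longrightarrow> \<psi> w = 0" and R: "R > 0" and \<alpha>: "\<alpha> > 0"
    and f: "continuous_on UNIV f"
  shows "(\<lambda>k. tcoef \<alpha> \<psi> k f * z ^ k) sums (LINT w|lborel. exp (of_real \<alpha> * z * cnj w) * \<psi> w * f w)"
proof -
  define x where "x w = of_real \<alpha> * z * cnj w" for w
  define h where "h w = \<psi> w * f w" for w
  define t where "t k w = x w ^ k / fact k * h w" for k w
  have ch: "continuous_on UNIV h" unfolding h_def[abs_def] using \<psi> f by (intro continuous_intros)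
  have h0: "cmod w > R \<Longrightarrow> h w = 0" for w using \<psi>(2) by (simp add: h_def)
  have cx: "continuous_on UNIV x" unfolding x_def[abs_def] by (intro continuous_intros)
  have it: "integrable lborel (t k)" for k
    by (rule integrable_compact_support[where R = R])
      (use ch cx h0 in \<open>auto simp: t_def[abs_def] intro!: continuous_intros\<close>)
  have ih: "integrable lborel (\<lambda>w. cmod (h w))" using integrable_compact_support[OF ch h0] by (rule integrable_norm)
  define c where "c = \<alpha> * cmod z * R"
  have tb: "cmod (t k w) \<le> c ^ k / fact k * cmod (h w)" for k w
  proof (cases "cmod w \<le> R")
    case True
    then have "cmod (x w) \<le> c" using \<alpha> by (auto simp: x_def c_def norm_mult intro!: mult_left_mono)
    then have "cmod (x w) ^ k / fact k * cmod (h w) \<le> c ^ k / fact k * cmod (h w)"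
      by (intro mult_right_mono divide_right_mono power_mono) auto
    then show ?thesis by (simp add: t_def norm_mult norm_divide norm_power)
  qed (simp add: t_def h0)
  have sc: "summable (\<lambda>k. c ^ k / fact k)"
    using summable_exp_generic[of c] by (simp add: divide_inverse mult.commute)
  have ts: "(\<lambda>k. t k w) sums (exp (x w) * h w)" for w
    using sums_mult2[OF exp_converges[of "x w"], of "h w"] by (simp add: t_def scaleR_conv_of_real field_simps)
  have "(\<lambda>k. integral\<^sup>L lborel (t k)) sums (LINT w|lborel. (\<Sum>k. t k w))"
  proof (rule sums_integral[OF it])
    have "summable (\<lambda>k. norm (t k w))" for w
      by (rule summable_comparison_test'[OF summable_mult2[OF sc, of "cmod (h w)"]]) (use tb in simp)
    then show "AE w in lborel. summable (\<lambda>k. norm (t k w))" by simp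
    show "summable (\<lambda>k. LINT w|lborel. norm (t k w))"
    proof (rule summable_comparison_test'[OF summable_mult2[OF sc, of "LINT w|lborel. cmod (h w)"]])
      fix k
      have "(LINT w|lborel. norm (t k w)) \<le> (LINT w|lborel. c ^ k / fact k * cmod (h w))"
        by (rule integral_mono[OF integrable_norm[OF it] integrable_mult_right[OF ih] tb])
      then show "norm (LINT w|lborel. norm (t k w)) \<le> c ^ k / fact k * (LINT w|lborel. cmod (h w))" by simp
    qed
  qed
  moreover have "(\<Sum>k. t k w) = exp (x w) * h w" for w using ts by (simp add: sums_iff)
  moreover have "integral\<^sup>L lborel (t k) = tcoef \<alpha> \<psi> k f * z ^ k" for k
  proof -
    have "t k = (\<lambda>w. (of_real \<alpha> ^ k / fact k * z ^ k) * (cnj w ^ k * \<psi> w * f w))"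
      by (simp add: t_def[abs_def] x_def h_def power_mult_distrib mult_ac)
    then show ?thesis by (simp add: tcoef_def)
  qed
  ultimately show ?thesis by (simp add: x_def h_def mult.assoc)
qed

definition cc_symbol :: "(complex \<Rightarrow> complex) \<Rightarrow> bool" where
  "cc_symbol \<phi> \<longleftrightarrow> continuous_on UNIV \<phi> \<and> compact (closure {w. \<phi> w \<noteq> 0})"

lemma cc_symbol_iff:
  "cc_symbol \<phi> \<longleftrightarrow> continuous_on UNIV \<phi> \<and> (\<exists>R>0. \<forall>w. cmod w > R \<longrightarrow> \<phi> w = 0)"
proof -
  have "compact (closure {w. \<phi> w \<noteq> 0}) \<longleftrightarrow> bounded {w. \<phi> w \<noteq> 0}"
    using compact_closure by blast
  also have "\<dots> \<longleftrightarrow> (\<exists>R>0. \<forall>w. cmod w > R \<longrightarrow> \<phi> w = 0)"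
    unfolding bounded_pos by (metis (mono_tags, lifting) mem_Collect_eq not_le)
  finally show ?thesis by (simp add: cc_symbol_def)
qed

section \<open>Toeplitz operators generate the nuclear operators\<close>

locale fock_pair = X: fock_space \<alpha> p + Y: fock_space \<alpha> q for \<alpha> p q :: real
begin

sublocale normed_fun_space_pair "fock \<alpha> p" "fock \<alpha> q" ..

abbreviation "dn \<equiv> dual_norm (fock \<alpha> p)"
abbreviation "toe \<equiv> toeplitz \<alpha>"
abbreviation "nle \<equiv> nuclear_le (fock \<alpha> p) (fock \<alpha> q)"

lemma nuclear_le_series:
  assumes l: "\<And>j. l j \<in> dual (fock \<alpha> p)" and y: "\<And>j. y j \<in> Y.F"
    and sb: "summable b" and b: "\<And>j. dn (l j) * Y.N (y j) \<le> b j"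
    and T: "\<And>f z. f \<in> X.F \<Longrightarrow> (\<lambda>j. l j f * y j z) sums T f z"
  shows "nle T (suminf b)"
proof -
  have lim: "T f \<in> Y.F \<and> (\<lambda>n. Y.N (\<lambda>z. T f z - (\<Sum>j<n. l j f * y j z))) \<longlonglongrightarrow> 0" if f: "f \<in> X.F" for f
  proof -
    have le: "Y.N (\<lambda>z. l j f * y j z) \<le> b j * X.N f" for j
    proof -
      have "Y.N (\<lambda>z. l j f * y j z) \<le> dn (l j) * X.N f * Y.N (y j)"
        unfolding Y.N_scale by (intro mult_right_mono X.dual_le l f Y.N_nonneg)
      also have "\<dots> = dn (l j) * Y.N (y j) * X.N f" by simp
      also have "\<dots> \<le> b j * X.N f" by (intro mult_right_mono b X.N_nonneg)
      finally show ?thesis .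
    qed
    have "summable (\<lambda>j. Y.N (\<lambda>z. l j f * y j z))"
      by (rule summable_comparison_test'[OF summable_mult2[OF sb, of "X.N f"]])
        (use le Y.N_nonneg in auto)
    then show ?thesis
      using Y.summable_in_F(1,3)[of "\<lambda>j z. l j f * y j z" "T f"] T[OF f] Y.F_scale[OF y] by blast
  qed
  show ?thesis
  proof (rule nuclear_leI[OF _ l y])
    have b0: "0 \<le> b j" for j
      using order_trans[OF mult_nonneg_nonneg[OF X.dual_norm_nonneg[OF l] Y.N_nonneg] b] .
    show "(\<Sum>j<n. dn (l j) * Y.N (y j)) \<le> suminf b" for n
      by (rule order_trans[OF sum_mono[OF b] sum_le_suminf[OF sb]]) (use b0 in auto)
  qed (use lim in auto)
qed

text \<open>
  Only the values of \<open>f\<close> on the support of the symbol matter, and the \<open>k\<close>-th coefficient is of order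
  \<open>(\<alpha> R)\<^sup>k / k!\<close>. The bound on the norm of \<open>z\<^sup>k\<close> is used with \<open>t = 2 \<alpha> R\<close>, which leaves a factor
  \<open>2\<^bsup>-k\<^esup>\<close>. The representation as a nuclear operator and compactness both rest on this estimate.
\<close>
lemma toeplitz_series:
  assumes "cc_symbol \<phi>"
  obtains \<psi> R A where "continuous_on UNIV \<psi>" "\<And>w. cmod w > R \<Longrightarrow> \<psi> w = 0" "R > 0" "A > 0"
    "\<And>f z. f \<in> X.F \<Longrightarrow> (\<lambda>k. tcoef \<alpha> \<psi> k f * z ^ k) sums toe \<phi> f z"
    "\<And>f S k. f \<in> X.F \<Longrightarrow> (\<And>w. cmod w \<le> R \<Longrightarrow> cmod (f w) \<le> S) \<Longrightarrow>
      cmod (tcoef \<alpha> \<psi> k f) * Y.N (mon k) \<le> A * S * (1/2) ^ k"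
proof -
  obtain R where \<phi>: "continuous_on UNIV \<phi>" and R: "R > 0" "\<And>w. cmod w > R \<Longrightarrow> \<phi> w = 0"
    using assms by (auto simp: cc_symbol_iff)
  define \<psi> where "\<psi> w = complex_of_real (\<alpha> / pi * exp (- \<alpha> * (cmod w)\<^sup>2)) * \<phi> w" for w
  have \<psi>: "continuous_on UNIV \<psi>" "\<And>w. cmod w > R \<Longrightarrow> \<psi> w = 0"
    using \<phi> R(2) by (auto simp: \<psi>_def[abs_def] intro!: continuous_intros)
  obtain A where A: "A > 0" "\<And>k S f. f holomorphic_on UNIV \<Longrightarrow> (\<And>w. cmod w \<le> R \<Longrightarrow> cmod (f w) \<le> S) \<Longrightarrow>
    cmod (tcoef \<alpha> \<psi> k f) \<le> (\<alpha> * R) ^ k / fact k * (A * S)"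
    using tcoef_bound[OF \<psi> R(1) X.\<alpha>] by blast
  have t: "2 * (\<alpha> * R) > 0" using X.\<alpha> R by simp
  obtain C where C: "C > 0" "\<And>k. Y.N (mon k) \<le> C * (fact k / (2 * (\<alpha> * R)) ^ k)"
    using Y.monomial_factorial_bound[OF t] by blast
  show ?thesis
  proof (rule that[OF \<psi> R(1), of "A * C"])
    fix f assume f: "f \<in> X.F"
    have cf: "continuous_on UNIV f" using X.holo[OF f] by (rule holomorphic_on_imp_continuous_on)
    show "(\<lambda>k. tcoef \<alpha> \<psi> k f * z ^ k) sums toe \<phi> f z" for z
      unfolding toeplitz_eq[OF \<phi> cf X.\<alpha>] \<psi>_def[symmetric] by (rule tcoef_sums[OF \<psi> R(1) X.\<alpha> cf])
    fix S k assume S: "\<And>w. cmod w \<le> R \<Longrightarrow> cmod (f w) \<le> S"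
    have "cmod (f 0) \<le> S" using S[of 0] R by simp
    then have S0: "S \<ge> 0" by (rule order_trans[OF norm_ge_zero])
    have "cmod (tcoef \<alpha> \<psi> k f) * Y.N (mon k) \<le> ((\<alpha> * R) ^ k / fact k * (A * S)) * (C * (fact k / (2 * (\<alpha> * R)) ^ k))"
      using A(2)[OF X.holo[OF f] S] C A(1) S0 X.\<alpha> R(1) Y.N_nonneg by (intro mult_mono) auto
    also have "\<dots> = A * C * S * ((\<alpha> * R) ^ k / (2 * (\<alpha> * R)) ^ k)" by simp
    also have "(\<alpha> * R) ^ k / (2 * (\<alpha> * R)) ^ k = (1/2) ^ k"
    proof -
      have "(\<alpha> * R) ^ k \<noteq> 0" using X.\<alpha> R(1) by simp
      then show ?thesis unfolding power_mult_distrib[of 2 "\<alpha> * R"] power_one_over by simp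
    qed
    finally show "cmod (tcoef \<alpha> \<psi> k f) * Y.N (mon k) \<le> A * C * S * (1/2) ^ k" .
  qed (use A C in auto)
qed

lemma tcoef_linear:
  assumes \<psi>: "continuous_on UNIV \<psi>" "\<And>w. cmod w > R \<Longrightarrow> \<psi> w = 0"
  shows "f \<in> X.F \<Longrightarrow> g \<in> X.F \<Longrightarrow> tcoef \<alpha> \<psi> k (\<lambda>z. f z + g z) = tcoef \<alpha> \<psi> k f + tcoef \<alpha> \<psi> k g"
    and "tcoef \<alpha> \<psi> k (\<lambda>z. c * f z) = c * tcoef \<alpha> \<psi> k f"
proof -
  have i: "integrable lborel (\<lambda>w. cnj w ^ k * \<psi> w * f w)" if "f \<in> X.F" for f
    using \<psi> holomorphic_on_imp_continuous_on[OF X.holo[OF that]]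
    by (intro integrable_compact_support[where R = R]) (auto intro!: continuous_intros)
  show "f \<in> X.F \<Longrightarrow> g \<in> X.F \<Longrightarrow> tcoef \<alpha> \<psi> k (\<lambda>z. f z + g z) = tcoef \<alpha> \<psi> k f + tcoef \<alpha> \<psi> k g"
    unfolding tcoef_def distrib_left[symmetric]
    by (subst Bochner_Integration.integral_add[symmetric]) (auto simp: i distrib_left)
  have "(LINT w|lborel. cnj w ^ k * \<psi> w * (c * f w)) = c * (LINT w|lborel. cnj w ^ k * \<psi> w * f w)"
    by (subst integral_mult_right_zero[symmetric]) (simp add: mult_ac)
  then show "tcoef \<alpha> \<psi> k (\<lambda>z. c * f z) = c * tcoef \<alpha> \<psi> k f"
    by (simp add: tcoef_def)
qed

lemma toeplitz_bounds:
  assumes "cc_symbol \<phi>"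
  shows "\<exists>s. nle (toe \<phi>) s"
    and "\<exists>R C. C > 0 \<and> (\<forall>f\<in>X.F. \<forall>S. (\<forall>w\<in>cball 0 R. cmod (f w) \<le> S) \<longrightarrow> Y.N (toe \<phi> f) \<le> C * S)"
proof -
  obtain \<psi> R A where \<psi>: "continuous_on UNIV \<psi>" "\<And>w. cmod w > R \<Longrightarrow> \<psi> w = 0" and R: "R > 0" and A: "A > 0"
    and sums: "\<And>f z. f \<in> X.F \<Longrightarrow> (\<lambda>k. tcoef \<alpha> \<psi> k f * z ^ k) sums toe \<phi> f z"
    and bound: "\<And>f S k. f \<in> X.F \<Longrightarrow> (\<And>w. cmod w \<le> R \<Longrightarrow> cmod (f w) \<le> S) \<Longrightarrow>
      cmod (tcoef \<alpha> \<psi> k f) * Y.N (mon k) \<le> A * S * (1/2) ^ k"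
    using toeplitz_series[OF assms] by blast
  obtain K where K: "K > 0" "\<And>f z. f \<in> X.F \<Longrightarrow> cmod (f z) \<le> K * exp (\<alpha> / 2 * (cmod z)\<^sup>2) * X.N f"
    using X.pointwise_bound by blast
  define B where "B = A * (K * exp (\<alpha> / 2 * R\<^sup>2))"
  have B: "B > 0" using A K by (simp add: B_def)
  have le: "cmod (tcoef \<alpha> \<psi> k f) * Y.N (mon k) \<le> B * (1/2) ^ k * X.N f" if f: "f \<in> X.F" for f k
  proof -
    have "cmod (f w) \<le> K * exp (\<alpha> / 2 * R\<^sup>2) * X.N f" if "cmod w \<le> R" for w
    proof (rule order_trans[OF K(2)[OF f]])
      have "exp (\<alpha> / 2 * (cmod w)\<^sup>2) \<le> exp (\<alpha> / 2 * R\<^sup>2)"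
        using that X.\<alpha> by (simp add: power_mono)
      then show "K * exp (\<alpha> / 2 * (cmod w)\<^sup>2) * X.N f \<le> K * exp (\<alpha> / 2 * R\<^sup>2) * X.N f"
        using K(1) X.N_nonneg by (intro mult_right_mono mult_left_mono) auto
    qed
    from bound[OF f this, of k] show ?thesis by (simp add: B_def mult_ac)
  qed
  define l where "l k = restrict (tcoef \<alpha> \<psi> k) X.F" for k
  show "\<exists>s. nle (toe \<phi>) s"
  proof (rule exI, rule nuclear_le_series[where l = l and y = mon and b = "\<lambda>k. B * (1/2) ^ k"])
    have pos: "Y.N (mon k) > 0" for k
    proof (rule ccontr)
      assume "\<not> ?thesis"
      then have "Y.N (mon k) = 0" using Y.N_nonneg[of "mon k"] by linarith
      from Y.nrm_eq_0[OF Y.monomial_mem this] have "(1 :: complex) ^ k = 0" by (rule fun_cong)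
      then show False by simp
    qed
    have le': "cmod (tcoef \<alpha> \<psi> k f) \<le> B * (1/2) ^ k / Y.N (mon k) * X.N f" if f: "f \<in> X.F" for f k
      using le[OF f, of k] pos[of k] by (simp add: pos_le_divide_eq mult_ac)
    show l: "l k \<in> dual (fock \<alpha> p)" for k
      unfolding l_def by (rule X.dualI[OF tcoef_linear(1)[OF \<psi>] tcoef_linear(2)[OF \<psi>] le'])
    have dl: "dn (l k) \<le> B * (1/2) ^ k / Y.N (mon k)" for k
      using le' B pos[of k] by (intro X.dual_norm_le) (auto simp: l_def)
    show "dn (l k) * Y.N (mon k) \<le> B * (1/2) ^ k" for k
      using dl[of k] pos[of k] by (simp add: pos_le_divide_eq)
    show "summable (\<lambda>k. B * (1/2) ^ k)" by (intro summable_mult summable_geometric) auto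
    show "(\<lambda>k. l k f * z ^ k) sums toe \<phi> f z" if "f \<in> X.F" for f z
      using sums[OF that] that by (simp add: l_def)
  qed (rule Y.monomial_mem)
  have "Y.N (toe \<phi> f) \<le> (2 * A) * S" if f: "f \<in> X.F" and S: "\<And>w. cmod w \<le> R \<Longrightarrow> cmod (f w) \<le> S" for f S
  proof -
    have g: "(\<lambda>z. tcoef \<alpha> \<psi> k f * z ^ k) \<in> Y.F" for k by (intro Y.F_scale Y.monomial_mem)
    have le: "Y.N (\<lambda>z. tcoef \<alpha> \<psi> k f * z ^ k) \<le> A * S * (1/2) ^ k" for k
      unfolding Y.N_scale by (rule bound[OF f S])
    have sm: "summable (\<lambda>k. A * S * (1/2) ^ k)" by (intro summable_mult summable_geometric) auto
    have sm': "summable (\<lambda>k. Y.N (\<lambda>z. tcoef \<alpha> \<psi> k f * z ^ k))"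
      by (rule summable_comparison_test'[OF sm]) (use le Y.N_nonneg in auto)
    have "Y.N (toe \<phi> f) \<le> (\<Sum>k. Y.N (\<lambda>z. tcoef \<alpha> \<psi> k f * z ^ k))"
      using Y.summable_in_F(2)[OF g sm' sums[OF f], of 0] by simp
    also have "\<dots> \<le> (\<Sum>k. A * S * (1/2) ^ k)" by (rule suminf_le[OF le sm' sm])
    also have "\<dots> = A * S * 2" by (subst suminf_mult) (auto simp: suminf_geometric summable_geometric)
    finally show ?thesis by (simp add: mult_ac)
  qed
  then show "\<exists>R C. C > 0 \<and> (\<forall>f\<in>X.F. \<forall>S. (\<forall>w\<in>cball 0 R. cmod (f w) \<le> S) \<longrightarrow> Y.N (toe \<phi> f) \<le> C * S)"
    using A by (intro exI[of _ R] exI[of _ "2 * A"]) auto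
qed

abbreviation "kern z w \<equiv> of_real (\<alpha> / pi * exp (- \<alpha> * (cmod w)\<^sup>2)) * exp (of_real \<alpha> * z * cnj w)"

lemma toeplitz_integrable:
  assumes "cc_symbol \<phi>" "f \<in> X.F"
  shows "toe \<phi> f z = (LINT w|lborel. kern z w * (\<phi> w * f w))"
    and "integrable lborel (\<lambda>w. kern z w * (\<phi> w * f w))"
proof -
  obtain R where \<phi>: "continuous_on UNIV \<phi>" and R: "R > 0" "\<And>w. cmod w > R \<Longrightarrow> \<phi> w = 0"
    using assms by (auto simp: cc_symbol_iff)
  have cf: "continuous_on UNIV f" using X.holo[OF assms(2)] by (rule holomorphic_on_imp_continuous_on)
  show "toe \<phi> f z = (LINT w|lborel. kern z w * (\<phi> w * f w))"
    unfolding toeplitz_eq[OF \<phi> cf X.\<alpha>] by (simp add: mult_ac)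
  show "integrable lborel (\<lambda>w. kern z w * (\<phi> w * f w))"
    using \<phi> cf R by (intro integrable_compact_support[where R = R]) (auto intro!: continuous_intros)
qed

lemma toeplitz_add_symbol:
  assumes "cc_symbol \<phi>" "cc_symbol \<psi>" "f \<in> X.F"
  shows "cc_symbol (\<lambda>w. \<phi> w + \<psi> w)" "toe (\<lambda>w. \<phi> w + \<psi> w) f z = toe \<phi> f z + toe \<psi> f z"
proof -
  obtain R S where "R > 0" "\<And>w. cmod w > R \<Longrightarrow> \<phi> w = 0" "S > 0" "\<And>w. cmod w > S \<Longrightarrow> \<psi> w = 0"
    "continuous_on UNIV \<phi>" "continuous_on UNIV \<psi>"
    using assms by (auto simp: cc_symbol_iff)
  then show cc: "cc_symbol (\<lambda>w. \<phi> w + \<psi> w)"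
    unfolding cc_symbol_iff by (intro conjI exI[of _ "max R S"] continuous_intros) auto
  show "toe (\<lambda>w. \<phi> w + \<psi> w) f z = toe \<phi> f z + toe \<psi> f z"
    unfolding toeplitz_integrable(1)[OF cc assms(3)] toeplitz_integrable(1)[OF assms(1,3)] toeplitz_integrable(1)[OF assms(2,3)]
    by (subst Bochner_Integration.integral_add[symmetric])
      (auto simp only: toeplitz_integrable(2) assms distrib_left distrib_right)
qed

lemma toeplitz_scale_symbol:
  assumes "cc_symbol \<phi>" "f \<in> X.F"
  shows "cc_symbol (\<lambda>w. c * \<phi> w)" "toe (\<lambda>w. c * \<phi> w) f z = c * toe \<phi> f z"
proof -
  show cc: "cc_symbol (\<lambda>w. c * \<phi> w)"
    using assms(1) unfolding cc_symbol_iff by (auto intro!: continuous_intros)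
  show "toe (\<lambda>w. c * \<phi> w) f z = c * toe \<phi> f z"
    unfolding toeplitz_integrable(1)[OF cc assms(2)] toeplitz_integrable(1)[OF assms]
    by (subst integral_mult_right_zero[symmetric]) (simp only: mult_ac)
qed

lemma toeplitz_linear:
  assumes \<phi>: "cc_symbol \<phi>" and f: "f \<in> X.F"
  shows "g \<in> X.F \<Longrightarrow> toe \<phi> (\<lambda>z. f z + g z) z = toe \<phi> f z + toe \<phi> g z"
    and "toe \<phi> (\<lambda>z. c * f z) z = c * toe \<phi> f z"
proof -
  show "toe \<phi> (\<lambda>z. f z + g z) z = toe \<phi> f z + toe \<phi> g z" if g: "g \<in> X.F"
    unfolding toeplitz_integrable(1)[OF \<phi> X.F_add[OF f g]] toeplitz_integrable(1)[OF \<phi> f] toeplitz_integrable(1)[OF \<phi> g]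
    by (subst Bochner_Integration.integral_add[symmetric])
      (auto simp only: toeplitz_integrable(2) f g \<phi> distrib_left distrib_right)
  show "toe \<phi> (\<lambda>z. c * f z) z = c * toe \<phi> f z"
    unfolding toeplitz_integrable(1)[OF \<phi> X.F_scale[OF f]] toeplitz_integrable(1)[OF \<phi> f]
    by (subst integral_mult_right_zero[symmetric]) (simp only: mult_ac)
qed

abbreviation "Toep \<equiv> toe ` Collect cc_symbol"

abbreviation "E \<equiv> nuclear_closure (fock \<alpha> p) (fock \<alpha> q) Toep"

lemma toeplitz_in_closure: "cc_symbol \<phi> \<Longrightarrow> toe \<phi> \<in> E"
  by (rule subsetD[OF subset_nuclear_closure]) simp

sublocale T: nuclear_subspace "fock \<alpha> p" "fock \<alpha> q" Toep
proof
  have "toe (\<lambda>_. 0) = (\<lambda>f z. 0)" by (simp add: toeplitz_def fun_eq_iff)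
  moreover have "cc_symbol (\<lambda>_. 0)" by (simp add: cc_symbol_def)
  ultimately show "(\<lambda>f z. 0) \<in> Toep" by (metis image_eqI mem_Collect_eq)
next
  fix S T assume "S \<in> Toep" "T \<in> Toep"
  then obtain \<phi> \<psi> where *: "cc_symbol \<phi>" "cc_symbol \<psi>" "S = toe \<phi>" "T = toe \<psi>" by auto
  have "toe (\<lambda>w. \<phi> w + \<psi> w) \<in> E"
    by (rule toeplitz_in_closure[OF toeplitz_add_symbol(1)[OF *(1,2) X.zero_mem]])
  then show "(\<lambda>f z. S f z + T f z) \<in> E"
    by (subst nuclear_closure_cong[where S = "toe (\<lambda>w. \<phi> w + \<psi> w)"])
      (auto simp: * toeplitz_add_symbol(2) fun_eq_iff)
next
  fix S c assume "S \<in> Toep"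
  then obtain \<phi> where *: "cc_symbol \<phi>" "S = toe \<phi>" by auto
  have "toe (\<lambda>w. c * \<phi> w) \<in> E"
    by (rule toeplitz_in_closure[OF toeplitz_scale_symbol(1)[OF *(1) X.zero_mem]])
  then show "(\<lambda>f z. c * S f z) \<in> E"
    by (subst nuclear_closure_cong[where S = "toe (\<lambda>w. c * \<phi> w)"])
      (auto simp: * toeplitz_scale_symbol(2) fun_eq_iff)
qed

text \<open>
  For the symbol \<open>\<phi>\<close> below, the \<open>n\<close>-th term of the Toeplitz operator is a multiple of
  \<open>c\<^bsub>n+i-k\<^esub> \<otimes> z\<^sup>n\<close>, with the moment \<open>\<mu> (n + i)\<close> of \<open>\<eta>\<close> as a factor. The terms with \<open>n < k\<close> lie in the
  closure by induction. The term with \<open>n = k\<close> is the operator in question, up to the number \<open>a\<close>. For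
  \<open>n > k\<close> the moments are at most \<open>t\<^bsup>2(n-k)\<^esup>\<close>, where \<open>t\<close> is the radius of the support, and the
  factor \<open>\<alpha>\<^sup>n / n!\<close> compensates the growth of the norm of \<open>z\<^sup>n\<close>.
\<close>
lemma matrix_unit_in_closure: "(\<lambda>f z. X.cf i f * z ^ k) \<in> E"
proof (induction k arbitrary: i rule: less_induct)
  case (less k)
  obtain K where K: "K > 0" "\<And>R n. R > 0 \<Longrightarrow> dn (X.cf n) \<le> K * exp (\<alpha> / 2 * R\<^sup>2) / R ^ n"
    using X.cf_norm_le by blast
  obtain C where C: "C > 0" "\<And>n. Y.N (mon n) \<le> C * (fact n / \<alpha> ^ n)"
    using Y.monomial_factorial_bound[OF X.\<alpha>] by blast
  define Q where "Q = K * exp (\<alpha> / 2) * C"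
  have Q: "Q > 0" using K C by (simp add: Q_def)
  have bound: "\<alpha> ^ n / fact n * (dn (X.cf j) * Y.N (mon n)) \<le> Q" for n j
  proof -
    have "dn (X.cf j) * Y.N (mon n) \<le> (K * exp (\<alpha> / 2)) * (C * (fact n / \<alpha> ^ n))"
      using K(2)[of 1 j] C(2)[of n] K(1) Y.N_nonneg by (intro mult_mono) auto
    then have "\<alpha> ^ n / fact n * (dn (X.cf j) * Y.N (mon n)) \<le> \<alpha> ^ n / fact n * ((K * exp (\<alpha> / 2)) * (C * (fact n / \<alpha> ^ n)))"
      using X.\<alpha> by (intro mult_left_mono) auto
    also have "\<dots> = Q" using X.\<alpha> by (simp add: Q_def)
    finally show ?thesis .
  qed
  define A where "A = (\<lambda>f z. X.cf i f * z ^ k)"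
  define a where "a = complex_of_real (\<alpha> ^ k / fact k)"
  have a: "a \<noteq> 0" using X.\<alpha> by (simp add: a_def)
  have "(\<lambda>f z. a * A f z) \<in> E"
  proof (rule nuclear_closure_closed)
    fix e :: real assume e: "e > 0"
    \<comment> \<open>The terms with \<open>n > k\<close> will sum to at most \<open>2 Q t\<close>.\<close>
    define t where "t = min (1/2) (e / (2 * Q))"
    have t: "t > 0" "t \<le> 1/2" "2 * Q * t \<le> e"
      using e Q by (auto simp: t_def min_def field_simps)
    obtain \<eta> :: "real \<Rightarrow> real" and M where \<eta>: "continuous_on UNIV \<eta>" "\<And>s. \<eta> s \<ge> 0" "\<And>s. s > t \<Longrightarrow> \<eta> s = 0" "\<And>s. \<bar>\<eta> s\<bar> \<le> M"
      and mu1: "(LINT z|(lborel :: complex measure). cmod z ^ (2 * (k + i)) * \<eta> (cmod z)) = 1"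
      using ex_radial_bump[OF t(1), of "2 * (k + i)"] by blast
    have \<eta>m: "\<eta> \<in> borel_measurable borel" using \<eta>(1) by (rule borel_measurable_continuous_onI)
    define \<mu> where "\<mu> n = (LINT z|(lborel :: complex measure). cmod z ^ (2 * n) * \<eta> (cmod z))" for n
    have i\<mu>: "integrable lborel (\<lambda>z::complex. cmod z ^ n * \<eta> (cmod z))" for n
    proof -
      have "integrable lborel (\<lambda>z::complex. complex_of_real (cmod z ^ n * \<eta> (cmod z)))"
        using \<eta>(3) by (intro integrable_compact_support[where R = t])
          (auto intro!: continuous_intros continuous_on_compose2[OF \<eta>(1)])
      then show ?thesis by (simp only: complex_of_real_integrable_eq)
    qed
    have \<mu>_le: "0 \<le> \<mu> (k + i + j) \<and> \<mu> (k + i + j) \<le> t ^ (2 * j)" for j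
    proof
      show "0 \<le> \<mu> (k + i + j)" unfolding \<mu>_def using \<eta> by (intro integral_nonneg_AE) auto
      have "\<mu> (k + i + j) \<le> (LINT z|(lborel :: complex measure). t ^ (2 * j) * (cmod z ^ (2 * (k + i)) * \<eta> (cmod z)))"
        unfolding \<mu>_def
      proof (rule integral_mono[OF i\<mu> integrable_mult_right[OF i\<mu>]])
        fix z :: complex
        show "cmod z ^ (2 * (k + i + j)) * \<eta> (cmod z) \<le> t ^ (2 * j) * (cmod z ^ (2 * (k + i)) * \<eta> (cmod z))"
        proof (cases "cmod z \<le> t")
          case True
          then have "cmod z ^ (2 * j) * (cmod z ^ (2 * (k + i)) * \<eta> (cmod z)) \<le> t ^ (2 * j) * (cmod z ^ (2 * (k + i)) * \<eta> (cmod z))"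
            using \<eta>(2) by (intro mult_right_mono power_mono) auto
          then show ?thesis by (simp add: power_add distrib_left mult_ac)
        qed (use \<eta>(3) in simp)
      qed
      then show "\<mu> (k + i + j) \<le> t ^ (2 * j)" using mu1 by simp
    qed
    \<comment> \<open>The exponential cancels the Gaussian weight of the Toeplitz operator.\<close>
    define \<phi> where "\<phi> w = complex_of_real (pi / \<alpha> * exp (\<alpha> * (cmod w)\<^sup>2)) * (cnj w ^ i * w ^ k * of_real (\<eta> (cmod w)))" for w
    have \<phi>c: "continuous_on UNIV \<phi>"
      unfolding \<phi>_def[abs_def] by (intro continuous_intros continuous_on_compose2[OF \<eta>(1)]) auto
    have \<phi>: "cc_symbol \<phi>"
      unfolding cc_symbol_iff using \<phi>c \<eta>(3) t(1) by (auto simp: \<phi>_def intro!: exI[of _ t])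
    define \<psi> where "\<psi> w = cnj w ^ i * w ^ k * complex_of_real (\<eta> (cmod w))" for w
    have \<psi>: "continuous_on UNIV \<psi>" "\<And>w. cmod w > t \<Longrightarrow> \<psi> w = 0"
      unfolding \<psi>_def[abs_def] using \<eta>(3)
      by (auto intro!: continuous_intros continuous_on_compose2[OF \<eta>(1)])
    have "of_real (\<alpha> / pi * exp (- \<alpha> * (cmod w)\<^sup>2)) * \<phi> w = \<psi> w" for w
    proof -
      have "(\<alpha> / pi * exp (- \<alpha> * (cmod w)\<^sup>2)) * (pi / \<alpha> * exp (\<alpha> * (cmod w)\<^sup>2)) = 1"
        using X.\<alpha> by (simp add: exp_minus field_simps)
      then have "complex_of_real (\<alpha> / pi * exp (- \<alpha> * (cmod w)\<^sup>2)) * complex_of_real (pi / \<alpha> * exp (\<alpha> * (cmod w)\<^sup>2)) = 1"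
        by (metis of_real_1 of_real_mult)
      then show ?thesis unfolding \<phi>_def \<psi>_def by (metis mult.assoc mult.left_neutral)
    qed
    then have toep: "toe \<phi> f z = (LINT w|lborel. exp (of_real \<alpha> * z * cnj w) * \<psi> w * f w)" if "f \<in> X.F" for f z
      using toeplitz_eq[OF \<phi>c holomorphic_on_imp_continuous_on[OF X.holo[OF that]] X.\<alpha>, of z] by simp
    define \<theta> where "\<theta> n = complex_of_real (\<alpha> ^ n / fact n * \<mu> (n + i))" for n
    have tc: "tcoef \<alpha> \<psi> n f = (if k \<le> n + i then \<theta> n * X.cf (n + i - k) f else 0)" if f: "f \<in> X.F" for n f
    proof -
      have eq: "(\<lambda>w. cnj w ^ n * \<psi> w * f w) = (\<lambda>w. cnj w ^ (n + i) * w ^ k * f w * of_real (\<eta> (cmod w)))"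
        by (simp add: \<psi>_def power_add mult_ac)
      have m: "(LINT w|lborel. cnj w ^ (n + i) * w ^ k * f w * of_real (\<eta> (cmod w))) =
          (if k \<le> n + i then coef (n + i - k) f * of_real (\<mu> (n + i)) else 0)"
        unfolding \<mu>_def by (rule integral_radial_moment[OF X.holo[OF f] \<eta>m \<eta>(4,3) t(1)])
      show ?thesis
        unfolding tcoef_def eq m \<theta>_def X.cf_def using f by simp
    qed
    define S where "S f z = (\<Sum>n<k. if k \<le> n + i then \<theta> n * (X.cf (n + i - k) f * z ^ n) else 0)" for f z
    have S: "S \<in> E"
    proof -
      have "(\<lambda>f z. if k \<le> n + i then \<theta> n * (X.cf (n + i - k) f * z ^ n) else 0) \<in> E" if "n < k" for n
      proof (cases "k \<le> n + i")
        case True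
        then show ?thesis using T.closure_scale[OF less.IH[OF that], of "\<theta> n"] by simp
      next
        case False
        then show ?thesis using subsetD[OF subset_nuclear_closure T.C_0] by simp
      qed
      then have "(\<lambda>f z. \<Sum>n<k. if k \<le> n + i then \<theta> n * (X.cf (n + i - k) f * z ^ n) else 0) \<in> E"
        by (intro T.closure_sum) auto
      then show ?thesis by (simp add: S_def[abs_def])
    qed
    define R where "R f z = toe \<phi> f z - S f z" for f z
    have R: "R \<in> E"
    proof -
      from T.closure_add[OF toeplitz_in_closure[OF \<phi>] T.closure_scale[OF S, of "-1"]] show ?thesis by (simp add: R_def[abs_def])
    qed
    have "nle (\<lambda>f z. R f z - a * A f z) (\<Sum>j. Q * t * (1/2) ^ j)"
    proof (rule nuclear_le_series[where l = "\<lambda>j. X.cf (i + Suc j)" and y = "\<lambda>j z. \<theta> (k + Suc j) * z ^ (k + Suc j)"])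
      show "summable (\<lambda>j. Q * t * (1/2) ^ j)" by (intro summable_mult summable_geometric) auto
      fix j
      have "\<bar>\<mu> (k + Suc j + i)\<bar> \<le> t * (1/2) ^ j"
      proof -
        have "k + i + Suc j = k + Suc j + i" by simp
        then have "\<bar>\<mu> (k + Suc j + i)\<bar> \<le> t ^ (2 * Suc j)" using \<mu>_le[of "Suc j"] by (metis abs_of_nonneg)
        also have "\<dots> = t * (t ^ j * t ^ (Suc j))" by (simp add: power_add[symmetric] mult_2)
        also have "\<dots> \<le> t * ((1/2) ^ j * 1)"
          using t by (intro mult_left_mono mult_mono power_mono power_le_one) auto
        finally show ?thesis by simp
      qed
      then have "(\<alpha> ^ (k + Suc j) / fact (k + Suc j) * (dn (X.cf (i + Suc j)) * Y.N (mon (k + Suc j)))) * \<bar>\<mu> (k + Suc j + i)\<bar> \<le> Q * (t * (1/2) ^ j)"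
        using bound[of "k + Suc j" "i + Suc j"] Q t by (intro mult_mono) auto
      moreover have "cmod (\<theta> (k + Suc j)) = \<alpha> ^ (k + Suc j) / fact (k + Suc j) * \<bar>\<mu> (k + Suc j + i)\<bar>"
        unfolding \<theta>_def norm_of_real using X.\<alpha> by (simp only: abs_mult abs_divide power_abs abs_of_pos abs_of_nonneg fact_ge_zero)
      ultimately show "dn (X.cf (i + Suc j)) * Y.N (\<lambda>z. \<theta> (k + Suc j) * z ^ (k + Suc j)) \<le> Q * t * (1/2) ^ j"
        unfolding Y.N_scale by (simp only: mult_ac)
    next
      fix f z assume f: "f \<in> X.F"
      have s: "(\<lambda>n. tcoef \<alpha> \<psi> n f * z ^ n) sums toe \<phi> f z"
        unfolding toep[OF f]
        by (rule tcoef_sums[OF \<psi> t(1) X.\<alpha> holomorphic_on_imp_continuous_on[OF X.holo[OF f]]])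
      have tail: "(\<lambda>j. tcoef \<alpha> \<psi> (j + Suc k) f * z ^ (j + Suc k)) sums (toe \<phi> f z - (\<Sum>n<Suc k. tcoef \<alpha> \<psi> n f * z ^ n))"
        using s by (subst sums_iff_shift) simp
      have low: "(\<Sum>n<k. tcoef \<alpha> \<psi> n f * z ^ n) = S f z"
        unfolding S_def by (intro sum.cong) (auto simp: tc[OF f])
      have "\<theta> k = a" using mu1 by (simp add: \<theta>_def a_def \<mu>_def)
      then have mid: "tcoef \<alpha> \<psi> k f * z ^ k = a * A f z" by (simp add: tc[OF f] A_def)
      have high: "tcoef \<alpha> \<psi> (j + Suc k) f * z ^ (j + Suc k) = X.cf (i + Suc j) f * (\<theta> (k + Suc j) * z ^ (k + Suc j))" for j
        by (simp add: tc[OF f] ac_simps)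
      show "(\<lambda>j. X.cf (i + Suc j) f * (\<theta> (k + Suc j) * z ^ (k + Suc j))) sums (R f z - a * A f z)"
        using tail by (simp only: sum.lessThan_Suc low mid high R_def diff_diff_eq)
    qed (rule X.cf_dual Y.F_scale[OF Y.monomial_mem])+
    moreover have "(\<Sum>j. Q * t * (1/2) ^ j) \<le> e"
      using t by (subst suminf_mult) (auto simp: suminf_geometric summable_geometric)
    ultimately have "nle (\<lambda>f z. R f z - a * A f z) e" by (rule nuclear_le_mono)
    from nuclear_le_scale[OF this, of "-1"] have "nle (\<lambda>f z. a * A f z - R f z) e" by simp
    then show "\<exists>S\<in>E. nle (\<lambda>f z. a * A f z - S f z) e" using R by (intro bexI[of _ R])
  qed
  from T.closure_scale[OF this, of "1 / a"] a show ?case by (simp add: A_def)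
qed

end

context fock_pair
begin

lemma nuclear_in_closure:
  assumes "p > 1" "nle T s"
  shows "T \<in> E"
proof (rule T.nuclear_closure_all[OF _ assms(2)])
  fix l y assume l: "l \<in> dual (fock \<alpha> p)" and y: "y \<in> Y.F"
  show "(\<lambda>f z. l f * y z) \<in> E"
    by (rule T.nuclear_closure_rank_one[where c = X.cf and u = mon, OF matrix_unit_in_closure
          X.cf_dual Y.monomial_mem X.coefficients_dense[OF assms(1)] Y.polynomials_dense l y])
qed

lemma nuclear_op_approx:
  assumes "p > 1" "nle T s" "e > 0"
  shows "\<exists>\<phi>. cc_symbol \<phi> \<and> nle (\<lambda>f z. T f z - toe \<phi> f z) e"
  using nuclear_closureD[OF nuclear_in_closure[OF assms(1,2)] assms(3)] by blast

lemma toeplitz_mem: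
  assumes "cc_symbol \<phi>" "f \<in> X.F"
  shows "toe \<phi> f \<in> Y.F"
  using toeplitz_bounds(1)[OF assms(1)] assms(2) by (auto simp: nuclear_le_def)

lemma toeplitz_linear_op:
  assumes \<phi>: "cc_symbol \<phi>"
  shows "restrict (toe \<phi>) X.F \<in> linear_ops (fock \<alpha> p) (fock \<alpha> q)"
  unfolding linear_ops_def
  using toeplitz_mem[OF \<phi>] toeplitz_linear[OF \<phi>]
  by (auto simp: X.F_add X.F_scale fun_eq_iff)

lemma toeplitz_nuclear_op:
  assumes \<phi>: "cc_symbol \<phi>"
  shows "restrict (toe \<phi>) X.F \<in> nuclear_ops (fock \<alpha> p) (fock \<alpha> q)"
proof -
  obtain s where s: "nle (toe \<phi>) s" using toeplitz_bounds(1)[OF \<phi>] by blast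
  have "\<forall>f\<in>X.F. Y.N (restrict (toe \<phi>) X.F f) \<le> s * X.N f"
    using nuclear_le_bound[OF s] by simp
  moreover have "nuclear_reps (fock \<alpha> p) (fock \<alpha> q) (restrict (toe \<phi>) X.F) \<noteq> {}"
    using s by (subst nuclear_reps_cong[where S = "toe \<phi>"]) (auto simp: nuclear_le_def)
  ultimately show ?thesis
    using toeplitz_linear_op[OF \<phi>] by (auto simp: nuclear_ops_def bounded_ops_def)
qed

section \<open>Density of the Toeplitz operators\<close>

text \<open>
  By Montel's theorem, a sequence in the unit ball has a locally uniformly convergent subsequence, and
  a Toeplitz operator with compactly supported symbol maps it to a norm convergent sequence. So
  the image of the unit ball is itself compact.
\<close>
lemma toeplitz_compact_op:
  assumes \<phi>: "cc_symbol \<phi>"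
  shows "restrict (toe \<phi>) X.F \<in> compact_ops (fock \<alpha> p) (fock \<alpha> q)"
proof (rule compact_opsI[OF toeplitz_linear_op[OF \<phi>]])
  fix f assume "\<And>n::nat. f n \<in> unit_cball (fock \<alpha> p)"
  then have f: "\<And>n. f n \<in> X.F" "\<And>n. X.N (f n) \<le> 1" by (auto simp: unit_cball_def)
  obtain g r where g: "g holomorphic_on UNIV" and r: "strict_mono (r :: nat \<Rightarrow> nat)"
    and lim: "\<And>z. (\<lambda>k. f (r k) z) \<longlonglongrightarrow> g z"
    and unif: "\<And>K. compact K \<Longrightarrow> uniform_limit K (f \<circ> r) g sequentially"
    by (rule X.montel[of f 1, OF f]) blast
  have gF: "g \<in> X.F" "X.N g \<le> 1"
    using X.fock_limit[of "\<lambda>k. f (r k)" 1 g] f lim by auto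
  obtain R C where C: "C > 0" "\<And>f S. f \<in> X.F \<Longrightarrow> (\<And>w. w \<in> cball 0 R \<Longrightarrow> cmod (f w) \<le> S) \<Longrightarrow> Y.N (toe \<phi> f) \<le> C * S"
    using toeplitz_bounds(2)[OF \<phi>] by blast
  have diff: "(\<lambda>z. toe \<phi> (f (r n)) z - toe \<phi> g z) = toe \<phi> (\<lambda>z. f (r n) z - g z)" for n
    using toeplitz_linear(1)[OF \<phi> f(1) X.F_scale[OF gF(1)], of "r n" "-1"] toeplitz_linear(2)[OF \<phi> gF(1), of "-1"]
    by (simp add: fun_eq_iff)
  have "(\<lambda>n. Y.N (\<lambda>z. toe \<phi> (f (r n)) z - toe \<phi> g z)) \<longlonglongrightarrow> 0"
  proof (rule LIMSEQ_I)
    fix e :: real assume e: "e > 0"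
    then have "e / (2 * C) > 0" using C by simp
    from uniform_limitD[OF unif[OF compact_cball[of 0 R]] this]
    obtain n0 where n0: "\<And>n w. n \<ge> n0 \<Longrightarrow> w \<in> cball 0 R \<Longrightarrow> dist (f (r n) w) (g w) < e / (2 * C)"
      unfolding eventually_sequentially o_def by blast
    show "\<exists>n0. \<forall>n\<ge>n0. norm (Y.N (\<lambda>z. toe \<phi> (f (r n)) z - toe \<phi> g z) - 0) < e"
    proof (intro exI allI impI)
      fix n assume "n \<ge> n0"
      then have "Y.N (toe \<phi> (\<lambda>z. f (r n) z - g z)) \<le> C * (e / (2 * C))"
        using n0[of n] by (intro C(2) X.diff_mem f gF) (auto simp: dist_norm less_imp_le)
      also have "\<dots> < e" using C e by simp
      finally show "norm (Y.N (\<lambda>z. toe \<phi> (f (r n)) z - toe \<phi> g z) - 0) < e"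
        unfolding diff using Y.N_nonneg by simp
    qed
  qed
  then show "\<exists>g r. g \<in> unit_cball (fock \<alpha> p) \<and> strict_mono (r :: nat \<Rightarrow> nat) \<and>
      (\<lambda>n. Y.N (\<lambda>z. restrict (toe \<phi>) X.F (f (r n)) z - restrict (toe \<phi>) X.F g z)) \<longlonglongrightarrow> 0"
    using gF f(1) r by (intro exI[of _ g] exI[of _ r]) (auto simp: unit_cball_def)
qed

text \<open>The representation is \<open>(c\<^sub>n \<circ> T) \<otimes> r\<^sup>n z\<^sup>n\<close>, by the Taylor expansion of \<open>T f\<close>.\<close>
lemma dil_comp_nuclear:
  assumes r: "0 < r" "r < 1" and T: "T \<in> linear_ops (fock \<alpha> p) (fock \<alpha> q)"
    and B: "B \<ge> 0" "\<And>f. f \<in> X.F \<Longrightarrow> Y.N (T f) \<le> B * X.N f"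
  shows "\<exists>s. nle (\<lambda>f. Y.dil r (T f)) s"
proof -
  have TF: "T f \<in> Y.F" if "f \<in> X.F" for f using T that by (auto simp: linear_ops_def)
  define dY where "dY n = dual_norm (fock \<alpha> q) (Y.cf n)" for n
  have dY: "dY n \<ge> 0" for n unfolding dY_def by (intro Y.dual_norm_nonneg Y.cf_dual)
  define l where "l n = (\<lambda>f\<in>X.F. of_real r ^ n * coef n (T f))" for n
  have le: "cmod (of_real r ^ n * coef n (T f)) \<le> r ^ n * dY n * B * X.N f" if f: "f \<in> X.F" for n f
  proof -
    have "cmod (coef n (T f)) \<le> dY n * Y.N (T f)"
      using Y.dual_le[OF Y.cf_dual TF[OF f], of n] TF[OF f] by (simp add: Y.cf_def dY_def)
    also have "\<dots> \<le> dY n * (B * X.N f)" by (intro mult_left_mono B f dY)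
    finally have "r ^ n * cmod (coef n (T f)) \<le> r ^ n * (dY n * (B * X.N f))"
      using r by (intro mult_left_mono) auto
    then show ?thesis using r by (simp add: norm_mult norm_power mult_ac)
  qed
  show ?thesis
  proof (rule exI, rule nuclear_le_series[where l = l and y = mon
        and b = "\<lambda>n. r ^ n * dY n * Y.N (mon n) * B"])
    show "l n \<in> dual (fock \<alpha> p)" for n
      unfolding l_def
    proof (rule X.dualI[OF _ _ le])
      fix f g assume fg: "f \<in> X.F" "g \<in> X.F"
      then have "T (\<lambda>z. f z + g z) = (\<lambda>z. T f z + T g z)" using T unfolding linear_ops_def by blast
      then show "of_real r ^ n * coef n (T (\<lambda>z. f z + g z)) = of_real r ^ n * coef n (T f) + of_real r ^ n * coef n (T g)"
        using coef_add[OF Y.holo[OF TF[OF fg(1)]] Y.holo[OF TF[OF fg(2)]], of n] by (simp add: distrib_left)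
    next
      fix c f assume f: "f \<in> X.F"
      then have "T (\<lambda>z. c * f z) = (\<lambda>z. c * T f z)" using T unfolding linear_ops_def by blast
      then show "of_real r ^ n * coef n (T (\<lambda>z. c * f z)) = c * (of_real r ^ n * coef n (T f))"
        using coef_scale[OF Y.holo[OF TF[OF f]], of n c] by simp
    qed
    have "dn (l n) \<le> r ^ n * dY n * B" for n
      using le r dY B by (intro X.dual_norm_le) (auto simp: l_def)
    then have "dn (l n) * Y.N (mon n) \<le> r ^ n * dY n * B * Y.N (mon n)" for n
      using Y.N_nonneg by (rule mult_right_mono)
    then show "dn (l n) * Y.N (mon n) \<le> r ^ n * dY n * Y.N (mon n) * B" for n
      by (simp only: mult_ac)
    show "summable (\<lambda>n. r ^ n * dY n * Y.N (mon n) * B)"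
      unfolding dY_def by (intro summable_mult2 Y.summable_coef_monomial r)
    show "(\<lambda>n. l n f * z ^ n) sums Y.dil r (T f) z" if "f \<in> X.F" for f z
      using Y.dil_sums[OF TF[OF that], of r z] that by (simp add: l_def)
  qed (rule Y.monomial_mem)
qed

text \<open>
  The dilations are bounded uniformly and converge strongly to the identity, hence uniformly on the
  precompact set of all \<open>T f\<close> with \<open>f\<close> in the unit ball. So \<open>dil r \<circ> T\<close> is close to \<open>T\<close>, and being
  nuclear it is close to a Toeplitz operator.
\<close>
lemma compact_op_approx:
  assumes p1: "p > 1" and T: "T \<in> compact_ops (fock \<alpha> p) (fock \<alpha> q)" and e: "e > 0"
  shows "\<exists>\<phi>. cc_symbol \<phi> \<and> (\<forall>f\<in>unit_cball (fock \<alpha> p). Y.N (\<lambda>z. T f z - toe \<phi> f z) \<le> e)"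
proof -
  have lin: "T \<in> linear_ops (fock \<alpha> p) (fock \<alpha> q)" using T by (simp add: compact_ops_def)
  have TF: "T f \<in> Y.F" if "f \<in> X.F" for f using lin that by (auto simp: linear_ops_def)
  \<comment> \<open>\<open>d + d + 4 d\<close> for replacing \<open>T\<close> by \<open>dil r \<circ> T\<close>, and \<open>d\<close> for the Toeplitz operator\<close>
  define d where "d = e / 7"
  have d: "d > 0" using e by (simp add: d_def)
  obtain K where K: "finite K" "K \<subseteq> Y.F"
    "\<And>f. f \<in> unit_cball (fock \<alpha> p) \<Longrightarrow> \<exists>x\<in>K. Y.N (\<lambda>z. x z - T f z) < d"
    using compact_ops_finite_net[OF T d] by auto
  have "\<forall>\<^sub>F k in sequentially. \<forall>x\<in>K. Y.N (\<lambda>z. Y.dil (Y.rad k) x z - x z) < d"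
    using K(2) d by (intro eventually_ball_finite[OF K(1)] ballI order_tendstoD(2)[OF Y.dil_tendsto]) auto
  then obtain k where k: "\<And>x. x \<in> K \<Longrightarrow> Y.N (\<lambda>z. Y.dil (Y.rad k) x z - x z) < d"
    by (auto simp: eventually_sequentially)
  define r where "r = Y.rad k"
  have r: "1/2 \<le> r" "r < 1" "0 < r" using Y.rad by (auto simp: r_def)
  have dF: "Y.dil r y \<in> Y.F" if "y \<in> Y.F" for y using Y.dil_bound(1)[OF that r(3)] r(2) by simp
  have 1: "Y.N (\<lambda>z. T f z - Y.dil r (T f) z) \<le> 6 * d" if f: "f \<in> unit_cball (fock \<alpha> p)" for f
  proof -
    have y: "T f \<in> Y.F" using TF f by (auto simp: unit_cball_def)
    obtain x where x: "x \<in> K" "Y.N (\<lambda>z. x z - T f z) < d" using K(3)[OF f] by blast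
    have xF: "x \<in> Y.F" using x K by auto
    have "Y.N (\<lambda>z. T f z - Y.dil r (T f) z) \<le> Y.N (\<lambda>z. T f z - x z) + Y.N (\<lambda>z. x z - Y.dil r (T f) z)"
      by (intro Y.nrm_triangle3 y xF dF)
    also have "Y.N (\<lambda>z. x z - Y.dil r (T f) z) \<le> Y.N (\<lambda>z. x z - Y.dil r x z) + Y.N (\<lambda>z. Y.dil r x z - Y.dil r (T f) z)"
      by (intro Y.nrm_triangle3 y xF dF)
    also have "(\<lambda>z. Y.dil r x z - Y.dil r (T f) z) = Y.dil r (\<lambda>z. x z - T f z)" by (simp add: Y.dil_def[abs_def])
    also have "Y.N \<dots> \<le> 4 * Y.N (\<lambda>z. x z - T f z)"
      using r by (intro Y.dil_norm_le Y.diff_mem xF y) auto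
    finally show ?thesis
      using x(2) k[OF x(1), folded r_def]
        Y.nrm_minus_commute[of "T f" x] Y.nrm_minus_commute[of x "Y.dil r x"] by simp
  qed
  obtain B where B: "B \<ge> 0" "\<And>f. f \<in> X.F \<Longrightarrow> Y.N (T f) \<le> B * X.N f"
    using compact_ops_bounded[OF T] by blast
  obtain s where "nle (\<lambda>f. Y.dil r (T f)) s"
    using dil_comp_nuclear[OF r(3,2) lin B] by blast
  from nuclear_op_approx[OF p1 this d]
  obtain \<phi> where \<phi>: "cc_symbol \<phi>" "nle (\<lambda>f z. Y.dil r (T f) z - toe \<phi> f z) d" by blast
  have "Y.N (\<lambda>z. T f z - toe \<phi> f z) \<le> e" if f: "f \<in> unit_cball (fock \<alpha> p)" for f
  proof -
    have fF: "f \<in> X.F" "X.N f \<le> 1" using f by (auto simp: unit_cball_def)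
    have "Y.N (\<lambda>z. T f z - toe \<phi> f z) \<le> Y.N (\<lambda>z. T f z - Y.dil r (T f) z) + Y.N (\<lambda>z. Y.dil r (T f) z - toe \<phi> f z)"
      by (intro Y.nrm_triangle3 TF fF dF toeplitz_mem \<phi>(1))
    also have "Y.N (\<lambda>z. Y.dil r (T f) z - toe \<phi> f z) \<le> d * X.N f"
      by (rule nuclear_le_bound[OF \<phi>(2) fF(1)])
    also have "d * X.N f \<le> d" using mult_left_mono[OF fF(2), of d] d by simp
    finally show ?thesis using 1[OF f] by (simp add: d_def)
  qed
  then show ?thesis using \<phi>(1) by blast
qed

end

theorem theorem1p2:
  fixes \<alpha> p q :: real
  assumes "\<alpha> > 0" and "1 < p" and "1 < q"
  shows "dense_in (nuclear_ops (fock \<alpha> p) (fock \<alpha> q))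
           (\<lambda>S T. nuclear_norm (fock \<alpha> p) (fock \<alpha> q) (op_diff (fock \<alpha> p) S T)) (toeplitz_cc \<alpha> p)
       \<and> dense_in (compact_ops (fock \<alpha> p) (fock \<alpha> q))
           (\<lambda>S T. op_norm (fock \<alpha> p) (fock \<alpha> q) (op_diff (fock \<alpha> p) S T)) (toeplitz_cc \<alpha> p)"
proof -
  interpret fock_pair \<alpha> p q using assms by unfold_locales auto
  have C: "toeplitz_cc \<alpha> p = {restrict (toeplitz \<alpha> \<phi>) X.F | \<phi>. cc_symbol \<phi>}"
    by (simp add: toeplitz_cc_def cc_symbol_def)
  have diff: "op_diff (fock \<alpha> p) T (restrict S X.F) f = (\<lambda>z. T f z - S f z)" if "f \<in> X.F" for T S f
    using that by (simp add: op_diff_def)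
  show ?thesis
    unfolding dense_in_def
  proof (intro conjI ballI allI impI)
    show "toeplitz_cc \<alpha> p \<subseteq> nuclear_ops (fock \<alpha> p) (fock \<alpha> q)"
      using toeplitz_nuclear_op by (auto simp: C)
    show "toeplitz_cc \<alpha> p \<subseteq> compact_ops (fock \<alpha> p) (fock \<alpha> q)"
      using toeplitz_compact_op by (auto simp: C)
  next
    fix T and e :: real assume T: "T \<in> nuclear_ops (fock \<alpha> p) (fock \<alpha> q)" and e: "e > 0"
    obtain l y where ly: "(l, y) \<in> nuclear_reps (fock \<alpha> p) (fock \<alpha> q) T"
      using T by (auto simp: nuclear_ops_def)
    have "T \<in> X.F \<rightarrow> Y.F" using T by (auto simp: nuclear_ops_def bounded_ops_def linear_ops_def)
    then have "nle T (\<Sum>j. dn (l j) * Y.N (y j))" using ly by (auto simp: nuclear_le_def)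
    from nuclear_op_approx[OF assms(2) this, of "e / 2"] e
    obtain \<phi> where \<phi>: "cc_symbol \<phi>" "nle (\<lambda>f z. T f z - toeplitz \<alpha> \<phi> f z) (e / 2)" by auto
    from \<phi>(2) have "nle (op_diff (fock \<alpha> p) T (restrict (toeplitz \<alpha> \<phi>) X.F)) (e / 2)"
      by (subst nuclear_le_cong[OF diff])
    from nuclear_norm_le[OF this] e
    have "nuclear_norm (fock \<alpha> p) (fock \<alpha> q) (op_diff (fock \<alpha> p) T (restrict (toeplitz \<alpha> \<phi>) X.F)) < e" by linarith
    then show "\<exists>S\<in>toeplitz_cc \<alpha> p. nuclear_norm (fock \<alpha> p) (fock \<alpha> q) (op_diff (fock \<alpha> p) T S) < e"
      using \<phi>(1) by (auto simp: C)
  next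
    fix T and e :: real assume T: "T \<in> compact_ops (fock \<alpha> p) (fock \<alpha> q)" and e: "e > 0"
    from compact_op_approx[OF assms(2) T, of "e / 2"] e
    obtain \<phi> where \<phi>: "cc_symbol \<phi>"
      "\<And>f. f \<in> unit_cball (fock \<alpha> p) \<Longrightarrow> Y.N (\<lambda>z. T f z - toeplitz \<alpha> \<phi> f z) \<le> e / 2" by auto
    have "op_norm (fock \<alpha> p) (fock \<alpha> q) (op_diff (fock \<alpha> p) T (restrict (toeplitz \<alpha> \<phi>) X.F)) \<le> e / 2"
      using \<phi>(2) by (intro X.op_norm_le) (auto simp: diff unit_cball_def)
    then show "\<exists>S\<in>toeplitz_cc \<alpha> p. op_norm (fock \<alpha> p) (fock \<alpha> q) (op_diff (fock \<alpha> p) T S) < e"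
      using \<phi>(1) e by (intro bexI[of _ "restrict (toeplitz \<alpha> \<phi>) X.F"]) (auto simp: C)
  qed
qed

end
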